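(* Let $F(x,y)\in\mathbb{Z}[x,y]$ be a diagonalizable form of degree $r\geq 5$ with discriminant $\Delta$, and let $h$ be an integer. (1) Let $m\geq 3$ be an integer and let $\epsilon$ be a positive real number with $$\frac{r^2+r+2}{4(r-1)\left[(r-1)^{m-1}-2r-1\right]}<\epsilon<\frac{1}{2(r-1)}.$$ If $$0<h\leq \frac{|\Delta|^{\frac{1}{2(r-1)}-\epsilon}}{2^{r/2}r^{7}},$$ then $$N_F(h)\leq \begin{cases} rm & \text{if } D<0,\\ 2m & \text{if } D>0,\ r \text{ is even and } F \text{ is indefinite},\\ m & \text{if } D>0,\ r \text{ is odd and } F \text{ is indefinite},\\ 1 & \text{if } D>0 \text{ and } F \text{ is definite}.\end{cases}$$ (2) In particular, if $D<0$, $0<\epsilon<\frac{1}{2(r-1)}$ and $$0<h\leq \frac{|\Delta|^{\frac{1}{2(r-1)}-\epsilon}}{2^{r/2}r^{7}},$$ then $$N_F(h)\leq \left(4+\left\lceil \frac{\log(1/\epsilon)-\log 4}{\log(r-1)}\right\rceil\right) r.$$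
   Context: A binary form $F(x,y)\in\mathbb{Z}[x,y]$ of degree $r$ is called diagonalizable if it can be written as $F(x,y)=(\alpha x+\beta y)^r-(\gamma x+\delta y)^r$ with (complex) constants $\alpha,\beta,\gamma,\delta$ satisfying $j=\alpha\delta-\beta\gamma\neq 0$. For such a form one can write $(\alpha x+\beta y)(\gamma x+\delta y)=\chi(Ax^2+Bxy+Cy^2)$ with $A,B,C\in\mathbb{Z}$ and a constant $\chi$; put $D=D(F)=B^2-4AC$ (which is nonzero). $F$ is definite if $F(x,y)$ takes values of only one strict sign for real $(x,y)\neq(0,0)$, and indefinite if it takes both signs. A solution $(x,y)\in\mathbb{Z}^2$ is primitive if $\gcd(x,y)=1$. $N_F(h)$ is the number of primitive solutions $(x,y)\in\mathbb{Z}^2$ of $0<|F(x,y)|\leq h$, where $(x,y)$ and $(-x,-y)$ are counted as one solution. $\lceil x\rceil$ denotes the smallest integer greater than or equal to $x$. *)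

theory Defs
  imports "HOL-Analysis.Analysis"
begin

text \<open>
  A binary form of degree \<open>r\<close> with integer coefficients is given by its coefficients
  \<open>a 0, \<dots>, a r\<close> (the values \<open>a i\<close> for \<open>i > r\<close> are irrelevant).  It can be evaluated in any
  commutative ring.  Identities between complex forms are stated as identities between the
  functions on pairs of complex numbers, which is the same as equality of polynomials.
\<close>

definition form_eval :: "nat \<Rightarrow> (nat \<Rightarrow> int) \<Rightarrow> 'a \<Rightarrow> 'a \<Rightarrow> 'a :: comm_ring_1" where
  "form_eval r a x y = (\<Sum>i\<le>r. of_int (a i) * x ^ (r - i) * y ^ i)"

definition diagonalization ::
    "nat \<Rightarrow> (nat \<Rightarrow> int) \<Rightarrow> complex \<Rightarrow> complex \<Rightarrow> complex \<Rightarrow> complex \<Rightarrow> bool" where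
  "diagonalization r a \<alpha> \<beta> \<gamma> \<delta> \<longleftrightarrow>
     \<alpha> * \<delta> - \<beta> * \<gamma> \<noteq> 0 \<and>
     (\<forall>x y. form_eval r a x y = (\<alpha> * x + \<beta> * y) ^ r - (\<gamma> * x + \<delta> * y) ^ r)"

definition diagonalizable :: "nat \<Rightarrow> (nat \<Rightarrow> int) \<Rightarrow> bool" where
  "diagonalizable r a \<longleftrightarrow> (\<exists>\<alpha> \<beta> \<gamma> \<delta>. diagonalization r a \<alpha> \<beta> \<gamma> \<delta>)"

text \<open>
  \<open>quad_disc r a D\<close>: \<open>D\<close> is the discriminant of an integral quadratic form proportional to
  the product of the two linear forms of a diagonalization.  The integers \<open>A, B, C\<close> are
  determined only up to a common factor, so \<open>D\<close> is determined only up to the square of a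
  rational number; hence a relation rather than a function.  Lemma \<open>quad_disc_exists\<close> below
  shows that every diagonalizable form of degree at least 3 has such a \<open>D\<close>, and lemma
  \<open>quad_disc_nonzero\<close> that \<open>D\<close> is nonzero.
\<close>

definition quad_disc :: "nat \<Rightarrow> (nat \<Rightarrow> int) \<Rightarrow> int \<Rightarrow> bool" where
  "quad_disc r a D \<longleftrightarrow>
     (\<exists>\<alpha> \<beta> \<gamma> \<delta> \<kappa> A B C.
        diagonalization r a \<alpha> \<beta> \<gamma> \<delta> \<and>
        (\<forall>x y. (\<alpha> * x + \<beta> * y) * (\<gamma> * x + \<delta> * y) =
                \<kappa> * (of_int A * x\<^sup>2 + of_int B * x * y + of_int C * y\<^sup>2)) \<and>
        D = B\<^sup>2 - 4 * A * C)"

text \<open>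
  The discriminant of \<open>F = \<Prod>\<^sub>i (p\<^sub>i x - q\<^sub>i y)\<close> is \<open>\<Prod>\<^sub>i\<^sub><\<^sub>j (p\<^sub>i q\<^sub>j - p\<^sub>j q\<^sub>i)\<^sup>2\<close>.
  Working with a factorization of the form, rather than with the roots of \<open>F(x, 1)\<close>, covers
  the case of a vanishing leading coefficient.  For \<open>r \<ge> 1\<close> a factorization exists by the
  fundamental theorem of algebra.  Lemma \<open>form_disc_eqI\<close> below shows that the
  value does not depend on the factorization.
\<close>

definition form_disc :: "nat \<Rightarrow> (nat \<Rightarrow> int) \<Rightarrow> complex" where
  "form_disc r a =
     (THE \<Delta>. \<exists>p q. (\<forall>x y :: complex. form_eval r a x y = (\<Prod>i<r. p i * x - q i * y)) \<and>
                   \<Delta> = (\<Prod>j<r. \<Prod>i<j. (p i * q j - p j * q i)\<^sup>2))"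

definition definite_form :: "nat \<Rightarrow> (nat \<Rightarrow> int) \<Rightarrow> bool" where
  "definite_form r a \<longleftrightarrow>
     (\<forall>x y :: real. (x, y) \<noteq> (0, 0) \<longrightarrow> form_eval r a x y > 0) \<or>
     (\<forall>x y :: real. (x, y) \<noteq> (0, 0) \<longrightarrow> form_eval r a x y < 0)"

definition indefinite_form :: "nat \<Rightarrow> (nat \<Rightarrow> int) \<Rightarrow> bool" where
  "indefinite_form r a \<longleftrightarrow>
     (\<exists>x y :: real. form_eval r a x y > 0) \<and> (\<exists>x y :: real. form_eval r a x y < 0)"

definition primitive_solutions :: "nat \<Rightarrow> (nat \<Rightarrow> int) \<Rightarrow> int \<Rightarrow> (int \<times> int) set" where
  "primitive_solutions r a h =
     {(x, y). gcd x y = 1 \<and> 0 < \<bar>form_eval r a x y\<bar> \<and> \<bar>form_eval r a x y\<bar> \<le> h}"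

definition solution_classes :: "nat \<Rightarrow> (nat \<Rightarrow> int) \<Rightarrow> int \<Rightarrow> (int \<times> int) set set" where
  "solution_classes r a h = (\<lambda>(x, y). {(x, y), (- x, - y)}) ` primitive_solutions r a h"

text \<open>As \<open>card\<close> of an infinite set is 0, an upper bound for \<open>num_solutions\<close> is meaningful only
  together with the finiteness of \<open>solution_classes\<close>.\<close>

definition num_solutions :: "nat \<Rightarrow> (nat \<Rightarrow> int) \<Rightarrow> int \<Rightarrow> nat" where
  "num_solutions r a h = card (solution_classes r a h)"


subsection \<open>Existence and nonvanishing of \<open>D\<close>\<close>

lemma quad_disc_nonzero:
  assumes "quad_disc r a D"
  shows "D \<noteq> 0"
proof -
  obtain \<alpha> \<beta> \<gamma> \<delta> \<kappa> :: complex and A B C :: int where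
    j: "\<alpha> * \<delta> - \<beta> * \<gamma> \<noteq> 0" and
    q: "\<And>x y. (\<alpha> * x + \<beta> * y) * (\<gamma> * x + \<delta> * y) =
                \<kappa> * (of_int A * x\<^sup>2 + of_int B * x * y + of_int C * y\<^sup>2)" and
    D: "D = B\<^sup>2 - 4 * A * C"
    using assms unfolding quad_disc_def diagonalization_def by blast
  have 1: "\<alpha> * \<gamma> = \<kappa> * of_int A" using q[of 1 0] by simp
  have 3: "\<beta> * \<delta> = \<kappa> * of_int C" using q[of 0 1] by simp
  have 2: "\<alpha> * \<delta> + \<beta> * \<gamma> = \<kappa> * of_int B" using q[of 1 1] 1 3 by (simp add: algebra_simps)
  have "(\<alpha> * \<delta> - \<beta> * \<gamma>)\<^sup>2 = (\<alpha> * \<delta> + \<beta> * \<gamma>)\<^sup>2 - 4 * (\<alpha> * \<gamma>) * (\<beta> * \<delta>)"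
    by (simp add: power2_eq_square algebra_simps)
  also have "\<dots> = \<kappa>\<^sup>2 * of_int D"
    unfolding 1 2 3 D by (simp add: power2_eq_square algebra_simps)
  finally show ?thesis using j by auto
qed

lemma diagonalization_coeff:
  assumes "diagonalization r a \<alpha> \<beta> \<gamma> \<delta>" "i \<le> r"
  shows "of_int (a i * (fact i * fact (r - i))) =
           fact r * (\<alpha> ^ (r - i) * \<beta> ^ i - \<gamma> ^ (r - i) * \<delta> ^ i)"
proof -
  have "\<forall>y::complex. (\<Sum>i\<le>r. of_int (a i) * y ^ i) =
          (\<Sum>i\<le>r. (of_nat (r choose i) * (\<alpha> ^ (r - i) * \<beta> ^ i - \<gamma> ^ (r - i) * \<delta> ^ i)) * y ^ i)"
  proof
    fix y :: complex
    have "form_eval r a 1 y = (\<alpha> * 1 + \<beta> * y) ^ r - (\<gamma> * 1 + \<delta> * y) ^ r"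
      using assms(1) unfolding diagonalization_def by blast
    then have "(\<Sum>i\<le>r. of_int (a i) * y ^ i) = (\<alpha> + \<beta> * y) ^ r - (\<gamma> + \<delta> * y) ^ r"
      by (simp add: form_eval_def)
    also have "\<dots> = (\<beta> * y + \<alpha>) ^ r - (\<delta> * y + \<gamma>) ^ r" by (simp add: add.commute)
    also have "\<dots> = (\<Sum>i\<le>r. (of_nat (r choose i) *
                   (\<alpha> ^ (r - i) * \<beta> ^ i - \<gamma> ^ (r - i) * \<delta> ^ i)) * y ^ i)"
      unfolding binomial_ring sum_subtractf[symmetric]
      by (intro sum.cong) (simp_all add: power_mult_distrib algebra_simps)
    finally show "(\<Sum>i\<le>r. of_int (a i) * y ^ i) = \<dots>" .
  qed
  then have c: "of_int (a i) =
      (of_nat (r choose i) :: complex) * (\<alpha> ^ (r - i) * \<beta> ^ i - \<gamma> ^ (r - i) * \<delta> ^ i)"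
    using assms(2) unfolding polyfun_eq_coeffs by blast
  have "(fact i * fact (r - i) * of_nat (r choose i) :: complex) = fact r"
    using binomial_fact_lemma[OF assms(2)] by (metis of_nat_fact of_nat_mult)
  then show ?thesis
    unfolding c of_int_mult of_int_fact by (metis mult.assoc mult.commute)
qed

lemma quad_disc_exists:
  assumes "diagonalizable r a" "r \<ge> 3"
  shows "\<exists>D. quad_disc r a D"
proof -
  obtain \<alpha> \<beta> \<gamma> \<delta> where d: "diagonalization r a \<alpha> \<beta> \<gamma> \<delta>"
    using assms(1) unfolding diagonalizable_def by blast
  then have j: "\<alpha> * \<delta> - \<beta> * \<gamma> \<noteq> 0" unfolding diagonalization_def by blast
  define J where "J = (\<alpha> * \<delta> - \<beta> * \<gamma>)\<^sup>2 * (fact r)\<^sup>2"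
  have J: "J \<noteq> 0" using j by (simp add: J_def)
  define z where "z i = a i * (fact i * fact (r - i))" for i
  have z: "of_int (z i) = fact r * (\<alpha> ^ (r - i) * \<beta> ^ i - \<gamma> ^ (r - i) * \<delta> ^ i)" if "i \<le> r" for i
    unfolding z_def using diagonalization_coeff[OF d that] .
  obtain s where s: "r = s + 3" using assms(2) by (metis add.commute le_Suc_ex)
  have main: "\<exists>D. quad_disc r a D"
    if e: "\<mu> * (\<alpha> * \<gamma>) = of_int A" "\<mu> * (\<alpha> * \<delta> + \<beta> * \<gamma>) = of_int B" "\<mu> * (\<beta> * \<delta>) = of_int C"
      "\<mu> \<noteq> 0" for \<mu> :: complex and A B C
  proof -
    have "(\<alpha> * x + \<beta> * y) * (\<gamma> * x + \<delta> * y) =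
            (1 / \<mu>) * (of_int A * x\<^sup>2 + of_int B * x * y + of_int C * y\<^sup>2)" for x y
      unfolding e(1-3)[symmetric] using e(4)
      by (simp add: field_simps power2_eq_square)
    then show ?thesis using d unfolding quad_disc_def by blast
  qed
  consider "\<alpha> * \<gamma> \<noteq> 0" | "\<beta> * \<delta> \<noteq> 0" | "\<alpha> * \<gamma> = 0" "\<beta> * \<delta> = 0" by blast
  then show ?thesis
  proof cases
    case 1
    have z0: "of_int (z 0) = fact r * (\<alpha> ^ s * \<alpha> ^ 3 - \<gamma> ^ s * \<gamma> ^ 3)"
      and z1: "of_int (z 1) = fact r * (\<alpha> ^ s * \<alpha> ^ 2 * \<beta> - \<gamma> ^ s * \<gamma> ^ 2 * \<delta>)"
      and z2: "of_int (z 2) = fact r * (\<alpha> ^ s * \<alpha> * \<beta> ^ 2 - \<gamma> ^ s * \<gamma> * \<delta> ^ 2)"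
      and z3: "of_int (z 3) = fact r * (\<alpha> ^ s * \<beta> ^ 3 - \<gamma> ^ s * \<delta> ^ 3)"
      using z[of 0] z[of 1] z[of 2] z[of 3] unfolding s
      by (simp_all add: power_add eval_nat_numeral)
    show ?thesis
    proof (rule main[of "J * (\<alpha> ^ s * \<gamma> ^ s)" "(z 1)\<^sup>2 - z 0 * z 2" "z 1 * z 2 - z 0 * z 3"
          "(z 2)\<^sup>2 - z 1 * z 3"])
      show "J * (\<alpha> ^ s * \<gamma> ^ s) \<noteq> 0" using J 1 by simp
    qed (simp_all only: z0 z1 z2 z3 J_def power2_eq_square power3_eq_cube of_int_diff of_int_mult,
         simp_all add: algebra_simps)
  next
    case 2
    have z0: "of_int (z (s + 3)) = fact r * (\<beta> ^ s * \<beta> ^ 3 - \<delta> ^ s * \<delta> ^ 3)"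
      and z1: "of_int (z (s + 2)) = fact r * (\<beta> ^ s * \<beta> ^ 2 * \<alpha> - \<delta> ^ s * \<delta> ^ 2 * \<gamma>)"
      and z2: "of_int (z (s + 1)) = fact r * (\<beta> ^ s * \<beta> * \<alpha> ^ 2 - \<delta> ^ s * \<delta> * \<gamma> ^ 2)"
      and z3: "of_int (z s) = fact r * (\<beta> ^ s * \<alpha> ^ 3 - \<delta> ^ s * \<gamma> ^ 3)"
      using z[of "s + 3"] z[of "s + 2"] z[of "s + 1"] z[of s] unfolding s
      by (simp_all add: power_add eval_nat_numeral algebra_simps)
    show ?thesis
    proof (rule main[of "J * (\<beta> ^ s * \<delta> ^ s)" "(z (s + 1))\<^sup>2 - z (s + 2) * z s"
          "z (s + 2) * z (s + 1) - z (s + 3) * z s" "(z (s + 2))\<^sup>2 - z (s + 3) * z (s + 1)"])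
      show "J * (\<beta> ^ s * \<delta> ^ s) \<noteq> 0" using J 2 by simp
    qed (simp_all only: z0 z1 z2 z3 J_def power2_eq_square power3_eq_cube of_int_diff of_int_mult,
         simp_all add: algebra_simps)
  next
    case 3
    have "\<alpha> * \<delta> + \<beta> * \<gamma> \<noteq> 0" using j 3 by auto
    then show ?thesis using main[of "1 / (\<alpha> * \<delta> + \<beta> * \<gamma>)" 0 1 0] 3 by simp
  qed
qed


subsection \<open>Independence of \<open>form_disc\<close> of the factorization\<close>

definition lin :: "complex \<times> complex \<Rightarrow> complex \<Rightarrow> complex \<Rightarrow> complex" where
  "lin l x y = fst l * x - snd l * y"

definition lins :: "(complex \<times> complex) list \<Rightarrow> complex \<Rightarrow> complex \<Rightarrow> complex" where
  "lins ls x y = (\<Prod>l\<leftarrow>ls. lin l x y)"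

fun disc_list :: "(complex \<times> complex) list \<Rightarrow> complex" where
  "disc_list [] = 1"
| "disc_list (l # ls) = (lins ls (snd l) (fst l))\<^sup>2 * disc_list ls"

lemma lins_simps [simp]:
  "lins [] x y = 1" "lins (l # ls) x y = lin l x y * lins ls x y"
  "lins (xs @ ys) x y = lins xs x y * lins ys x y"
  by (simp_all add: lins_def)

lemma lin_swap_sq: "(lin l (snd k) (fst k))\<^sup>2 = (lin k (snd l) (fst l))\<^sup>2"
  by (simp add: lin_def power2_eq_square algebra_simps)

lemma disc_list_move: "disc_list (xs @ l # ys) = disc_list (l # xs @ ys)"
  by (induction xs) (simp_all add: power_mult_distrib lin_swap_sq[of _ l])

lemma lins_scale: "lins ls (c * x) (c * y) = c ^ length ls * lins ls x y"
  by (induction ls) (simp_all add: lin_def algebra_simps)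

lemma lins_eq_0_iff: "lins ls x y = 0 \<longleftrightarrow> (\<exists>l\<in>set ls. lin l x y = 0)"
  by (induction ls) auto

lemma isCont_lins: "isCont (\<lambda>t. lins ls (x + t * x') (y + t * y')) t"
  by (induction ls) (auto intro!: continuous_intros simp: lin_def)

lemma lins_cancel:
  assumes "\<And>x y. lin l x y * lins ls x y = lin l x y * (c * lins ks x y)" "l \<noteq> (0, 0)"
  shows "lins ls x y = c * lins ks x y"
proof (cases "lin l x y = 0")
  case True
  define x' y' where "x' = cnj (fst l)" and "y' = - cnj (snd l)"
  have "lin l x' y' = of_real ((cmod (fst l))\<^sup>2 + (cmod (snd l))\<^sup>2)"
    unfolding of_real_add complex_norm_square by (simp add: lin_def x'_def y'_def)
  moreover have "(cmod (fst l))\<^sup>2 + (cmod (snd l))\<^sup>2 \<noteq> 0"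
    using assms(2) by (simp add: prod_eq_iff sum_power2_eq_zero_iff)
  ultimately have nz: "lin l x' y' \<noteq> 0" by (metis of_real_eq_0_iff)
  let ?f = "\<lambda>t. lins ls (x + t * x') (y + t * y')"
  let ?g = "\<lambda>t. c * lins ks (x + t * x') (y + t * y')"
  have "?f t = ?g t" if "t \<noteq> 0" for t
  proof -
    have "lin l (x + t * x') (y + t * y') = lin l x y + t * lin l x' y'"
      by (simp add: lin_def algebra_simps)
    then show ?thesis using assms(1)[of "x + t * x'" "y + t * y'"] that nz True by simp
  qed
  then have "?f \<midarrow>0\<rightarrow> L \<longleftrightarrow> ?g \<midarrow>0\<rightarrow> L" for L by (intro LIM_equal) blast
  moreover have "?f \<midarrow>0\<rightarrow> ?f 0" "?g \<midarrow>0\<rightarrow> ?g 0"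
    using isCont_lins[where ls = ls and t = 0] isCont_lins[where ls = ks and t = 0]
    by (auto simp only: isCont_def intro!: tendsto_mult_left)
  ultimately have "?f 0 = ?g 0" using LIM_unique by blast
  then show ?thesis by simp
qed (use assms(1)[of x y] in simp)

lemma lins_not_identically_0:
  assumes "(0, 0) \<notin> set ls"
  obtains x y where "lins ls x y \<noteq> 0"
proof -
  have "\<exists>x y. lins ls x y \<noteq> 0" using assms
  proof (induction ls)
    case (Cons l ls)
    have "\<not> (\<forall>x y. lins ls x y = 0)" using Cons by auto
    then show ?case using lins_cancel[of l ls 0 "[]"] Cons.prems by fastforce
  qed simp
  then show thesis using that by blast
qed

lemma disc_list_zero_factor:
  assumes "(0, 0) \<in> set ls" "length ls \<ge> 2"
  shows "disc_list ls = 0"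
proof -
  obtain xs ys where ls: "ls = xs @ (0, 0) # ys" using assms(1) by (meson split_list)
  then obtain k ks where k: "xs @ ys = k # ks" using assms(2) by (cases "xs @ ys") auto
  show ?thesis unfolding ls disc_list_move k by (simp add: lin_def)
qed

lemma disc_list_unique:
  assumes "\<And>x y. lins ls x y = c * lins ks x y" "length ls = length ks" "c \<noteq> 0"
    "(0, 0) \<notin> set ls" "(0, 0) \<notin> set ks"
  shows "disc_list ls = c ^ (2 * (length ls - 1)) * disc_list ks"
  using assms
proof (induction ls arbitrary: ks c)
  case (Cons l ls)
  obtain p q where l: "l = (p, q)" by (cases l)
  have "lins ks q p = 0" using Cons.prems(1)[of q p] \<open>c \<noteq> 0\<close> by (simp add: l lin_def)
  then obtain k where k: "k \<in> set ks" "lin k q p = 0" by (auto simp: lins_eq_0_iff)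
  then obtain xs ys where ks: "ks = xs @ k # ys" by (meson split_list)
  have k0: "k \<noteq> (0, 0)" using k Cons.prems by auto
  obtain e where e: "e \<noteq> 0" "fst k = e * p" "snd k = e * q"
  proof (cases "p = 0")
    case True
    then have "q \<noteq> 0" using Cons.prems l by auto
    then show ?thesis using that[of "snd k / q"] k(2) k0 True
      by (auto simp: lin_def prod_eq_iff)
  next
    case False
    have kq: "fst k * q = snd k * p" using k(2) by (simp add: lin_def)
    then have "fst k \<noteq> 0" using k0 False by (auto simp: prod_eq_iff)
    then show ?thesis using that[of "fst k / p"] kq False by (simp add: field_simps)
  qed
  have lk: "lin k x y = e * lin l x y" for x y by (simp add: lin_def e l algebra_simps)
  have eq: "lins ls x y = (c * e) * lins (xs @ ys) x y" for x y
    by (rule lins_cancel[of l]) (use Cons.prems in \<open>auto simp: ks lk algebra_simps\<close>)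
  have len: "length ls = length (xs @ ys)" using Cons.prems by (simp add: ks)
  have IH: "disc_list ls = (c * e) ^ (2 * (length ls - 1)) * disc_list (xs @ ys)"
    by (rule Cons.IH[OF eq len]) (use Cons.prems e ks in auto)
  have "lins (xs @ ys) (snd k) (fst k) = e ^ length ls * lins (xs @ ys) q p"
    unfolding e lins_scale len ..
  then have "disc_list ks = (e ^ length ls * lins (xs @ ys) q p)\<^sup>2 * disc_list (xs @ ys)"
    by (simp only: ks disc_list_move disc_list.simps)
  moreover have "disc_list (l # ls) =
      (c * e * lins (xs @ ys) q p)\<^sup>2 * ((c * e) ^ (2 * (length ls - 1)) * disc_list (xs @ ys))"
    by (simp only: disc_list.simps IH eq l fst_conv snd_conv)
  moreover have "(c * e)\<^sup>2 * (c * e) ^ (2 * (length ls - 1)) * disc_list (xs @ ys) * (lins (xs @ ys) q p)\<^sup>2 =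
      (c * e) ^ (2 * length ls) * disc_list (xs @ ys) * (lins (xs @ ys) q p)\<^sup>2"
    if "length ls > 0"
    using that by (cases "length ls") (simp_all add: power2_eq_square)
  ultimately show ?case
  proof (cases "ls = []")
    case True
    then show ?thesis using Cons.prems(2) ks by auto
  qed (simp add: power_mult_distrib algebra_simps power_mult[symmetric] mult.commute[of 2])
qed simp

lemma disc_prod_eq_disc_list:
  "(\<Prod>j<r. \<Prod>i<j. (p i * q j - p j * q i)\<^sup>2) = disc_list (map (\<lambda>i. (p i, q i)) (rev [0..<r]))"
  "(\<Prod>i<r. p i * x - q i * y) = lins (map (\<lambda>i. (p i, q i)) (rev [0..<r])) x y"
  for p q :: "nat \<Rightarrow> complex"
proof -
  show 2: "(\<Prod>i<r. p i * x - q i * y) = lins (map (\<lambda>i. (p i, q i)) (rev [0..<r])) x y" for r x y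
    by (induction r) (simp_all add: lin_def)
  show "(\<Prod>j<r. \<Prod>i<j. (p i * q j - p j * q i)\<^sup>2) = disc_list (map (\<lambda>i. (p i, q i)) (rev [0..<r]))"
    by (induction r) (simp_all add: 2[symmetric] prod_power_distrib mult.commute)
qed

lemma form_disc_eqI:
  assumes F: "\<And>x y :: complex. form_eval r a x y = (\<Prod>i<r. p i * x - q i * y)"
  shows "form_disc r a = (\<Prod>j<r. \<Prod>i<j. (p i * q j - p j * q i)\<^sup>2)"
  unfolding form_disc_def
proof (rule the_equality)
  fix \<Delta> assume "\<exists>p q. (\<forall>x y :: complex. form_eval r a x y = (\<Prod>i<r. p i * x - q i * y)) \<and>
                   \<Delta> = (\<Prod>j<r. \<Prod>i<j. (p i * q j - p j * q i)\<^sup>2)"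
  then obtain p' q' :: "nat \<Rightarrow> complex" where F': "\<And>x y :: complex. form_eval r a x y = (\<Prod>i<r. p' i * x - q' i * y)"
    and D': "\<Delta> = (\<Prod>j<r. \<Prod>i<j. (p' i * q' j - p' j * q' i)\<^sup>2)" by blast
  define ls where "ls = map (\<lambda>i. (p i, q i)) (rev [0..<r])"
  define ks where "ks = map (\<lambda>i. (p' i, q' i)) (rev [0..<r])"
  have eq: "lins ks x y = lins ls x y" for x y
    using F[of x y] F'[of x y] unfolding disc_prod_eq_disc_list ls_def ks_def by simp
  have len: "length ks = length ls" "length ls = r" by (simp_all add: ls_def ks_def)
  have "disc_list ks = disc_list ls"
  proof (cases "(0, 0) \<in> set ls \<or> (0, 0) \<in> set ks")
    case False
    then show ?thesis using disc_list_unique[of ks 1 ls] eq len by simp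
  next
    case True
    have "lins ms x y = 0" if "(0, 0) \<in> set ms" for ms x y
      unfolding lins_eq_0_iff using that by (intro bexI[of _ "(0, 0)"]) (simp_all add: lin_def)
    then have "lins ls x y = 0" for x y
      using True eq by metis
    then have both: "(0, 0) \<in> set ls" "(0, 0) \<in> set ks"
      using eq lins_not_identically_0 by metis+
    show ?thesis
    proof (cases "length ls \<ge> 2")
      case True
      then show ?thesis using both len by (simp add: disc_list_zero_factor)
    next
      case False
      have one: "disc_list ms = 1" if "length ms < 2" for ms
        using that by (cases ms) auto
      show ?thesis using False len by (simp add: one)
    qed
  qed
  then show "\<Delta> = (\<Prod>j<r. \<Prod>i<j. (p i * q j - p j * q i)\<^sup>2)"
    unfolding D' disc_prod_eq_disc_list ls_def ks_def .
qed (use F in blast)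

end

theory Submission
  imports Defs "HOL-Number_Theory.Cong"
begin

text \<open>
  Write \<open>F = \<xi>\<^sup>r - \<eta>\<^sup>r\<close> with linear forms \<open>\<xi>, \<eta>\<close> of determinant \<open>j\<close>, and \<open>J = \<bar>j\<bar>\<close>, so that
  \<open>\<bar>\<Delta>\<bar> = r\<^sup>r J\<^bsup>r(r-1)\<^esup>\<close>.  At most one class of solutions has \<open>Z = max \<bar>\<xi>\<bar> \<bar>\<eta>\<bar> < \<surd>(J/2)\<close>, because
  \<open>\<xi> v \<eta> w - \<xi> w \<eta> v\<close> is \<open>j\<close> times an integer.  For every other solution \<open>\<eta> / \<xi>\<close> is close to an
  \<open>r\<close>-th root of unity \<open>\<omega>\<close>, and two solutions \<open>v, w\<close> with the same \<open>\<omega>\<close> repel each other: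
  \<open>Z w\<close> is at least about \<open>J Z v\<^bsup>r-1\<^esup> / h\<close>.

  Thue's method shows that at most \<open>m - 1\<close> of these solutions belong to one \<open>\<omega>\<close>.  The diagonal Pade
  approximants of \<open>t\<^bsup>1/r\<^esup>\<close> at \<open>t = 1\<close> yield numbers \<open>S n v w\<close> which are \<open>j (2r\<surd>D)\<^bsup>-n\<^esup>\<close> times an
  integer, where \<open>D\<close> is the discriminant of the primitive quadratic form proportional to \<open>\<xi>\<eta>\<close>.
  Of \<open>S n v w\<close> and \<open>S (n+1) v w\<close> one is nonzero, hence bounded below; but once \<open>m - 2\<close> gaps have
  made \<open>Z v\<close> large, a suitable \<open>n\<close> makes both too small.  For \<open>D > 0\<close> the ratio of any two
  occurring \<open>\<omega>\<close> is real, so there are at most two of them, one if \<open>r\<close> is odd, and none if \<open>F\<close>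
  is definite.
\<close>

subsection \<open>Factorials dividing products over arithmetic progressions\<close>

text \<open>Each step of the Pade index loses a factor \<open>2 r \<sigma>\<close>,
  \<open>\<sigma> = \<surd>\<bar>D\<bar>\<close>, but the hypotheses say nothing about the size of
  \<open>D\<close>. This loss has to be paid by the discriminant, through
  \<open>\<sigma>^(r-2) \<le> 4 r^2 J^r\<close>.

  The slack \<open>E = \<bar>\<Delta>\<bar>^\<epsilon>\<close> in the bound on \<open>h\<close>
  drives the growth. With \<open>c = r J / (8 h)\<close>, every large solution satisfies
  \<open>c Z^(r-2) \<ge> r^6 E\<close>, and each gap raises this lower bound to the power
  \<open>r - 1\<close>. After \<open>m - 2\<close> gaps it contains the factor
  \<open>\<Psi> = E^((r-1)^(m-2))\<close>, and the lower bound on \<epsilon> is what yields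
  \<open>\<Psi>^4 \<ge> J^(r (r+2))\<close>. This is enough for the two size conditions of the Pade
  argument.

  The index \<open>n\<close> is adapted to \<open>Z w\<close>, so the second solution of a pair may
  be arbitrarily large. The small class and \<open>m - 1\<close> classes for each root of unity add
  up to at most \<open>m\<close> times the number of roots, as soon as there is a root.\<close>

lemma multiplicity_fact_le:
  fixes p :: nat
  assumes "prime p"
  shows "multiplicity p (fact m) \<le> m"
proof (induction m rule: less_induct)
  case (less m)
  have p2: "p \<ge> 2" using assms by (rule prime_ge_2_nat)
  show ?case
  proof (cases "m = 0")
    case False
    define q where "q = m div p"
    have qm: "q < m" unfolding q_def using False p2 by (simp add: div_less_dividend)
    have mult_fact: "multiplicity p (fact k) = (\<Sum>i\<in>{1..k}. multiplicity p i)" for k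
      unfolding fact_prod of_nat_id using assms
      by (intro prime_elem_multiplicity_prod_distrib) auto
    \<comment> \<open>Legendre's recursion: only the multiples of \<open>p\<close> contribute, so
      with \<open>q = m div p\<close> the multiplicity is \<open>q\<close> plus that of
      \<open>fact q\<close>. By induction this is at most
      \<open>2 q \<le> p q \<le> m\<close>.\<close>
    have "multiplicity p (fact m) = (\<Sum>i\<in>(\<lambda>j. p * j) ` {1..q}. multiplicity p i)"
      unfolding mult_fact
    proof (rule sum.mono_neutral_right)
      show "(\<lambda>j. p * j) ` {1..q} \<subseteq> {1..m}"
        using p2 by (auto simp: q_def less_eq_div_iff_mult_less_eq mult.commute)
      show "\<forall>i\<in>{1..m} - (\<lambda>j. p * j) ` {1..q}. multiplicity p i = 0"
      proof
        fix i assume i: "i \<in> {1..m} - (\<lambda>j. p * j) ` {1..q}"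
        have "\<not> p dvd i"
        proof
          assume "p dvd i"
          then obtain j where j: "i = p * j" by blast
          then have "j \<in> {1..q}" using i p2
            by (auto simp: q_def less_eq_div_iff_mult_less_eq mult.commute)
          then show False using i j by blast
        qed
        then show "multiplicity p i = 0" by (rule not_dvd_imp_multiplicity_0)
      qed
    qed simp
    also have "\<dots> = (\<Sum>j\<in>{1..q}. multiplicity p (p * j))"
      using p2 by (subst sum.reindex) (auto simp: inj_on_def)
    also have "\<dots> = (\<Sum>j\<in>{1..q}. 1 + multiplicity p j)"
      using assms p2 by (intro sum.cong refl) (subst prime_elem_multiplicity_mult_distrib, auto)
    also have "\<dots> = q + multiplicity p (fact q)" unfolding mult_fact sum.distrib by simp
    also have "\<dots> \<le> 2 * q" using less.IH[OF qm] by simp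
    also have "\<dots> \<le> m" using p2 unfolding q_def
      by (meson div_times_less_eq_dividend le_trans mult_le_mono1 mult.commute order_refl times_div_less_eq_dividend)
    finally show ?thesis .
  qed simp
qed

lemma multiplicity_of_int_nat: "multiplicity (int p) (int x) = multiplicity p x"
  unfolding multiplicity_def by (simp flip: of_nat_power)

text \<open>Primes not dividing \<open>r\<close> are handled by inverting \<open>r\<close>, which turns the progression into
  consecutive integers; the others by \<open>r ^ m\<close> alone.\<close>

lemma fact_dvd_power_mult_progression:
  fixes r a :: int
  assumes "r > 0" "(\<Prod>i<m. a + int i * r) \<noteq> 0"
  shows "fact m dvd r ^ m * (\<Prod>i<m. a + int i * r)"
proof (rule multiplicity_le_imp_dvd)
  fix p :: int
  assume p: "prime p"
  let ?P = "\<Prod>i<m. a + int i * r"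
  have nz: "r ^ m * ?P \<noteq> 0" using assms by simp
  show "multiplicity p (fact m) \<le> multiplicity p (r ^ m * ?P)"
  proof (cases "p dvd r")
    case True
    have "multiplicity p (fact m :: int) = multiplicity (nat p) (fact m)"
      using multiplicity_of_int_nat[of "nat p" "fact m"] prime_gt_0_int[OF p] by simp
    also have "\<dots> \<le> m" using multiplicity_fact_le p by simp
    finally have "multiplicity p (fact m :: int) \<le> m" .
    moreover have "p ^ m dvd r ^ m * ?P" using True by (simp add: dvd_power_same)
    then have "m \<le> multiplicity p (r ^ m * ?P)"
      using p nz by (intro multiplicity_geI) (auto simp: not_prime_unit)
    ultimately show ?thesis by linarith
  next
    case False
    define v where "v = multiplicity p (fact m :: int)"
    have "coprime r (p ^ v)" using False p by (simp add: prime_imp_coprime coprime_commute)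
    then obtain r' where r': "[r * r' = 1] (mod p ^ v)" using cong_solve_coprime_int by blast
    have "[?P = (\<Prod>i<m. r * (a * r' + int i))] (mod p ^ v)"
    proof (rule cong_prod)
      fix i
      have "[a * 1 + int i * r = a * (r * r') + int i * r] (mod p ^ v)"
        by (intro cong_add cong_mult cong_refl cong_sym[OF r'])
      then show "[a + int i * r = r * (a * r' + int i)] (mod p ^ v)"
        by (simp add: algebra_simps)
    qed
    also have "(\<Prod>i<m. r * (a * r' + int i)) = r ^ m * pochhammer (a * r') m"
      by (simp add: prod.distrib pochhammer_prod atLeast0LessThan)
    finally have c: "[?P = r ^ m * pochhammer (a * r') m] (mod p ^ v)" .
    have "p ^ v dvd fact m" unfolding v_def by (rule multiplicity_dvd)
    then have "p ^ v dvd r ^ m * pochhammer (a * r') m"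
      using fact_dvd_pochhammer by (meson dvd_mult dvd_trans)
    then have "p ^ v dvd ?P" using c by (simp add: cong_dvd_iff)
    then have "p ^ v dvd r ^ m * ?P" by simp
    then show ?thesis unfolding v_def[symmetric]
      using p nz by (intro multiplicity_geI) (auto simp: not_prime_unit)
  qed
qed (use assms in auto)

subsection \<open>Pade approximants of an \<open>r\<close>-th root\<close>

text \<open>The divided difference of \<open>f\<close> at the nodes \<open>S\<close> in Lagrange
  form, that is, the top coefficient of the interpolation polynomial.\<close>

definition divdiff :: "('a \<Rightarrow> 'a) \<Rightarrow> 'a set \<Rightarrow> 'a :: field" where
  "divdiff f S = (\<Sum>x\<in>S. f x / (\<Prod>y\<in>S - {x}. x - y))"

lemma divdiff_add: "divdiff (\<lambda>x. f x + g x) S = divdiff f S + divdiff g S"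
  and divdiff_diff: "divdiff (\<lambda>x. f x - g x) S = divdiff f S - divdiff g S"
  and divdiff_cmult: "divdiff (\<lambda>x. c * f x) S = c * divdiff f S"
  by (simp_all add: divdiff_def add_divide_distrib diff_divide_distrib sum.distrib sum_subtractf
      sum_distrib_left)

text \<open>The factor \<open>x - a\<close> kills the term of the node \<open>a\<close> and cancels
  one factor in the denominator of every other term.\<close>

lemma divdiff_insert:
  assumes "finite S" "a \<notin> S"
  shows "divdiff (\<lambda>x. (x - a) * f x) (insert a S) = divdiff f S"
proof -
  have "(\<Prod>y\<in>insert a S - {x}. x - y) = (x - a) * (\<Prod>y\<in>S - {x}. x - y)" if "x \<in> S" for x
  proof -
    have "insert a S - {x} = insert a (S - {x})" using that assms by auto
    then show ?thesis using assms by simp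
  qed
  then show ?thesis using assms unfolding divdiff_def
    by (auto intro!: sum.cong)
qed

lemma divdiff_const:
  assumes "finite S" "card S \<ge> 2"
  shows "divdiff (\<lambda>_. 1) S = 0"
  using assms
proof (induction "card S" arbitrary: S rule: less_induct)
  case less
  then obtain a b where ab: "a \<in> S" "b \<in> S" "a \<noteq> b"
    by (metis card_2_iff' obtain_subset_with_card_n subset_eq)
  define T where "T = S - {a, b}"
  have S: "S = insert a (insert b T)" "S = insert b (insert a T)" and T: "finite T" "a \<notin> T" "b \<notin> T"
    using ab less.prems by (auto simp: T_def)
  have IH: "divdiff (\<lambda>_. 1) (insert a T) = divdiff (\<lambda>_. 1) (insert b T)"
  proof (cases "T = {}")
    case False
    then have "card T \<ge> 1" using T by (simp add: Suc_leI card_gt_0_iff)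
    then show ?thesis using less.hyps[of "insert a T"] less.hyps[of "insert b T"] T ab
      by (simp add: S)
  qed (simp add: divdiff_def)
  \<comment> \<open>The constant \<open>a - b\<close> is written as
    \<open>(x - b) - (x - a)\<close>; each summand removes one node, which leads to two smaller node
    sets of equal size.\<close>
  have "(a - b) * divdiff (\<lambda>_. 1) S = divdiff (\<lambda>x. (x - b) * 1 - (x - a) * 1) S"
    by (subst divdiff_cmult[symmetric]) simp
  also have "\<dots> = divdiff (\<lambda>x. (x - b) * 1) (insert b (insert a T))
                - divdiff (\<lambda>x. (x - a) * 1) (insert a (insert b T))"
    unfolding divdiff_diff using S by simp
  also have "\<dots> = 0" using T ab IH by (subst (1 2) divdiff_insert) auto
  finally show ?case using ab by simp
qed

text \<open>Writing \<open>x = (x - a) + a\<close> lowers the degree in both summands. The first one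
  also loses the node \<open>a\<close>, which the bound on the number of nodes allows.\<close>

lemma divdiff_power:
  assumes "finite S" "card S \<ge> l + 2"
  shows "divdiff (\<lambda>x. x ^ l) S = 0"
  using assms
proof (induction l arbitrary: S)
  case 0
  then show ?case using divdiff_const[of S] by simp
next
  case (Suc l)
  then obtain a where a: "a \<in> S" by fastforce
  define T where "T = S - {a}"
  have S: "S = insert a T" and T: "finite T" "a \<notin> T" and cT: "card T \<ge> l + 2"
    using a Suc.prems by (auto simp: T_def)
  have "divdiff (\<lambda>x. x ^ Suc l) S = divdiff (\<lambda>x. (x - a) * x ^ l + a * x ^ l) S"
    by (simp add: algebra_simps)
  also have "\<dots> = divdiff (\<lambda>x. (x - a) * x ^ l) (insert a T) + a * divdiff (\<lambda>x. x ^ l) S"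
    by (simp only: divdiff_add divdiff_cmult S)
  also have "\<dots> = 0" using Suc.IH[of S] Suc.IH[of T] Suc.prems T cT
    by (simp add: divdiff_insert)
  finally show ?case .
qed

text \<open>For fixed \<open>n\<close> these are, up to a common factor, the coefficients of the
  hypergeometric polynomial \<open>2F1(-n, -n - 1/r; 1 - 1/r; t)\<close>, the denominator of the
  diagonal Pade approximant of \<open>t^(1/r)\<close> at 1. The numerator has them in reverse order.
  The factor \<open>r^n\<close> makes them integers.\<close>

definition pade :: "nat \<Rightarrow> nat \<Rightarrow> nat \<Rightarrow> real" where
  "pade r n k = real r ^ n * ((\<Prod>i\<in>{k<..n}. real i * real r - 1) / fact (n - k))
                           * ((\<Prod>i\<in>{n - k<..n}. real i * real r + 1) / fact k)"

lemma pade_pos: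
  assumes "r \<ge> 2"
  shows "pade r n k > 0"
proof -
  have "real i * real r - 1 > 0" if "i > k" for i
  proof -
    have "1 * 2 \<le> real i * real r" using that assms by (intro mult_mono) auto
    then show ?thesis by simp
  qed
  moreover have "real i * real r + 1 > 0" for i by (simp add: add_nonneg_pos)
  ultimately show ?thesis unfolding pade_def using assms
    by (auto intro!: mult_pos_pos divide_pos_pos prod_pos)
qed

text \<open>Both quotients are products over progressions with difference \<open>r\<close>, divided
  by the factorial of their length; \<open>r^n\<close> is shared out as \<open>r^(n-k)\<close> and
  \<open>r^k\<close> between them.\<close>

lemma pade_Ints:
  assumes "r \<ge> 2" "k \<le> n"
  shows "pade r n k \<in> \<int>"
proof -
  have aux: "real r ^ m * (\<Prod>i<m. of_int a + real i * real r) / fact m \<in> \<int>"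
    if "\<And>i. i < m \<Longrightarrow> a + int i * int r \<noteq> 0" for m a
  proof -
    have "fact m dvd int r ^ m * (\<Prod>i<m. a + int i * int r)"
      using that assms by (intro fact_dvd_power_mult_progression) auto
    then obtain c where "int r ^ m * (\<Prod>i<m. a + int i * int r) = fact m * c" by blast
    then have "real_of_int (int r ^ m * (\<Prod>i<m. a + int i * int r)) = of_int (fact m * c)" by simp
    then have "real r ^ m * (\<Prod>i<m. of_int a + real i * real r) / fact m = of_int c" by simp
    then show ?thesis by simp
  qed
  have shift: "(\<Prod>i\<in>{l<..n}. g i) = (\<Prod>i<n - l. g (i + Suc l))" if "l \<le> n" for l and g :: "nat \<Rightarrow> real"
    using that by (intro prod.reindex_bij_witness[of _ "\<lambda>i. i + Suc l" "\<lambda>i. i - Suc l"]) auto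
  have r1: "int i * int r \<ge> 0" for i by simp
  have 1: "real r ^ (n - k) * (\<Prod>i\<in>{k<..n}. real i * real r - 1) / fact (n - k) \<in> \<int>"
  proof -
    have "int (Suc k) * int r - 1 + int i * int r \<noteq> 0" for i
    proof -
      have "1 * 2 \<le> int (Suc k) * int r" using assms by (intro mult_mono) auto
      then show ?thesis using r1[of i] by linarith
    qed
    from aux[OF this, of "n - k"] show ?thesis
      unfolding shift[OF assms(2)] by (simp add: algebra_simps)
  qed
  have 2: "real r ^ k * (\<Prod>i\<in>{n - k<..n}. real i * real r + 1) / fact k \<in> \<int>"
  proof -
    have "int (Suc (n - k)) * int r + 1 + int i * int r \<noteq> 0" for i
      using r1[of "Suc (n - k)"] r1[of i] by linarith
    from aux[OF this, of k] show ?thesis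
      unfolding shift[OF diff_le_self] using assms(2) by (simp add: algebra_simps)
  qed
  have "pade r n k = (real r ^ (n - k) * (\<Prod>i\<in>{k<..n}. real i * real r - 1) / fact (n - k)) *
                     (real r ^ k * (\<Prod>i\<in>{n - k<..n}. real i * real r + 1) / fact k)"
    unfolding pade_def using assms(2) by (simp flip: power_add)
  then show ?thesis by (simp only: Ints_mult[OF 1 2])
qed

text \<open>The two quotients are at most \<open>r^(n-k)\<close> and \<open>r^k\<close> times a
  binomial coefficient. Only the second binomial is replaced by a power of 2; the first is kept, as
  its row sum costs just another \<open>2^n\<close>.\<close>

lemma pade_le:
  assumes "r \<ge> 2" "k \<le> n"
  shows "pade r n k \<le> real r ^ (2 * n) * 2 ^ (n + 1) * real (n choose k)"
proof -
  have prod_real: "(\<Prod>i\<in>{l<..m}. real i) = fact m / fact l" if "l \<le> m" for l m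
  proof -
    have "fact m = (\<Prod>i\<in>{1..m}. real i)" by (simp add: fact_prod)
    also have "{1..m} = {1..l} \<union> {l<..m}" using that by auto
    also have "(\<Prod>i\<in>{1..l} \<union> {l<..m}. real i) = fact l * (\<Prod>i\<in>{l<..m}. real i)"
      by (subst prod.union_disjoint) (auto simp: fact_prod)
    finally show ?thesis by simp
  qed
  have "(\<Prod>i\<in>{k<..n}. real i * real r - 1) \<le> (\<Prod>i\<in>{k<..n}. real i * real r)"
  proof (intro prod_mono conjI)
    fix i assume "i \<in> {k<..n}"
    then have "1 * 2 \<le> real i * real r" using assms by (intro mult_mono) auto
    then show "0 \<le> real i * real r - 1" by simp
  qed simp
  also have "\<dots> = real r ^ (n - k) * (fact n / fact k)"
    using assms by (simp add: prod.distrib prod_real)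
  finally have "(\<Prod>i\<in>{k<..n}. real i * real r - 1) / fact (n - k)
      \<le> real r ^ (n - k) * (fact n / fact k) / fact (n - k)" by (rule divide_right_mono) simp
  also have "\<dots> = real r ^ (n - k) * real (n choose k)"
    using assms by (simp add: binomial_fact)
  finally have 1: "(\<Prod>i\<in>{k<..n}. real i * real r - 1) / fact (n - k)
      \<le> real r ^ (n - k) * real (n choose k)" .
  have "(\<Prod>i\<in>{n - k<..n}. real i * real r + 1) \<le> (\<Prod>i\<in>{n - k<..n}. real (Suc i) * real r)"
    using assms by (intro prod_mono conjI) (auto simp: algebra_simps)
  also have "\<dots> = real r ^ k * (\<Prod>i\<in>{n - k<..n}. real (Suc i))"
    using assms by (simp add: prod.distrib mult.commute)
  also have "(\<Prod>i\<in>{n - k<..n}. real (Suc i)) = (\<Prod>i\<in>{Suc (n - k)<..Suc n}. real i)"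
    by (rule prod.reindex_bij_witness[of _ "\<lambda>i. i - 1" Suc]) auto
  also have "\<dots> = fact (Suc n) / fact (Suc (n - k))" by (rule prod_real) simp
  finally have "(\<Prod>i\<in>{n - k<..n}. real i * real r + 1) / fact k
      \<le> real r ^ k * (fact (Suc n) / fact (Suc (n - k))) / fact k" by (rule divide_right_mono) simp
  also have "\<dots> = real r ^ k * real (Suc n choose k)"
    using assms by (simp add: binomial_fact Suc_diff_le)
  also have "\<dots> \<le> real r ^ k * 2 ^ Suc n"
    by (intro mult_left_mono) (metis binomial_le_pow2 of_nat_le_iff of_nat_numeral of_nat_power, simp)
  finally have 2: "(\<Prod>i\<in>{n - k<..n}. real i * real r + 1) / fact k \<le> real r ^ k * 2 ^ Suc n" .
  have "pade r n k \<le> real r ^ n * (real r ^ (n - k) * real (n choose k)) * (real r ^ k * 2 ^ Suc n)"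
    unfolding pade_def
  proof (intro mult_mono 1 2)
    have "real i * real r - 1 \<ge> 0" if "i > k" for i
    proof -
      have "1 * 2 \<le> real i * real r" using that assms by (intro mult_mono) auto
      then show ?thesis by simp
    qed
    then show "0 \<le> (\<Prod>i\<in>{k<..n}. real i * real r - 1) / fact (n - k)"
      by (intro divide_nonneg_pos prod_nonneg) auto
    show "0 \<le> (\<Prod>i\<in>{n - k<..n}. real i * real r + 1) / fact k"
      by (intro divide_nonneg_pos prod_nonneg) auto
    show "0 \<le> real r ^ n * (real r ^ (n - k) * real (n choose k))" by simp
  qed simp_all
  also have "\<dots> = real r ^ (n + (n - k) + k) * 2 ^ (n + 1) * real (n choose k)"
    by (simp only: power_add Suc_eq_plus1 mult_ac)
  also have "n + (n - k) + k = 2 * n" using assms by simp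
  finally show ?thesis .
qed

lemma sum_pade_le:
  assumes "r \<ge> 2"
  shows "(\<Sum>k\<le>n. pade r n k) \<le> 2 * (4 * real r ^ 2) ^ n"
proof -
  have "(\<Sum>k\<le>n. pade r n k) \<le> (\<Sum>k\<le>n. real r ^ (2 * n) * 2 ^ (n + 1) * real (n choose k))"
    using assms by (intro sum_mono pade_le) auto
  also have "\<dots> = real r ^ (2 * n) * 2 ^ (n + 1) * real (\<Sum>k\<le>n. n choose k)"
    by (simp add: sum_distrib_left)
  also have "\<dots> = 2 * (2 ^ n * 2 ^ n * (real r ^ 2) ^ n)"
    by (simp add: choose_row_sum power_mult)
  also have "(2::real) ^ n * 2 ^ n = 4 ^ n"
    unfolding power_mult_distrib[symmetric] by simp
  also have "4 ^ n * (real r ^ 2) ^ n = (4 * real r ^ 2) ^ n"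
    by (simp only: power_mult_distrib)
  finally show ?thesis .
qed

section \<open>Vanishing moments of the Pade coefficients\<close>

lemma prod_shifted:
  fixes g :: "real \<Rightarrow> real"
  assumes "k \<le> n"
  shows "(\<Prod>l\<le>n. g (real k - real l)) = (\<Prod>i\<in>{1..k}. g (real i)) * (\<Prod>i\<le>n - k. g (- real i))"
    and "(\<Prod>l\<in>{..n} - {k}. g (real k - real l)) =
           (\<Prod>i\<in>{1..k}. g (real i)) * (\<Prod>i\<in>{1..n - k}. g (- real i))"
proof -
  have 1: "(\<Prod>l\<in>{..<k}. g (real k - real l)) = (\<Prod>i\<in>{1..k}. g (real i))"
    by (rule prod.reindex_bij_witness[of _ "\<lambda>i. k - i" "\<lambda>i. k - i"]) (auto simp: of_nat_diff)
  have 2: "(\<Prod>l\<in>{k..n}. g (real k - real l)) = (\<Prod>i\<le>n - k. g (- real i))"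
    by (rule prod.reindex_bij_witness[of _ "\<lambda>i. k + i" "\<lambda>i. i - k"]) (use assms in \<open>auto simp: of_nat_diff\<close>)
  have 3: "(\<Prod>l\<in>{k<..n}. g (real k - real l)) = (\<Prod>i\<in>{1..n - k}. g (- real i))"
    by (rule prod.reindex_bij_witness[of _ "\<lambda>i. k + i" "\<lambda>i. i - k"]) (use assms in \<open>auto simp: of_nat_diff\<close>)
  have 4: "{..n} = {..<k} \<union> {k..n}" "{..n} - {k} = {..<k} \<union> {k<..n}" using assms by auto
  show "(\<Prod>l\<le>n. g (real k - real l)) = (\<Prod>i\<in>{1..k}. g (real i)) * (\<Prod>i\<le>n - k. g (- real i))"
    "(\<Prod>l\<in>{..n} - {k}. g (real k - real l)) =
           (\<Prod>i\<in>{1..k}. g (real i)) * (\<Prod>i\<in>{1..n - k}. g (- real i))"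
    unfolding 4(2) unfolding 4(1) 1[symmetric] 2[symmetric] 3[symmetric]
    by (intro prod.union_disjoint; force)+
qed

text \<open>The exponents of \<open>x\<close> in \<open>x P(x^r) - Q(x^r)\<close>, where
  \<open>P\<close> and \<open>Q\<close> are the numerator and the denominator of the
  approximant.\<close>

definition pade_nodes :: "nat \<Rightarrow> nat \<Rightarrow> real set" where
  "pade_nodes r n = (\<lambda>k. real k * real r) ` {..n} \<union> (\<lambda>k. real k * real r + 1) ` {..n}"

lemma pade_node_neq:
  assumes "r \<ge> 2"
  shows "real k * real r \<noteq> real l * real r + 1"
proof
  assume "real k * real r = real l * real r + 1"
  then have "real (k * r) = real (l * r + 1)" by simp
  then have "k * r = l * r + 1" by (simp only: of_nat_eq_iff)
  then have "r dvd l * r + 1" by (metis dvd_triv_right)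
  then have "r dvd 1" using dvd_add_right_iff[of r "l * r" 1] by simp
  then show False using assms by simp
qed

lemma pade_node_inj: "r \<ge> 2 \<Longrightarrow> inj (\<lambda>k. real k * real r)" "r \<ge> 2 \<Longrightarrow> inj (\<lambda>k. real k * real r + 1)"
  by (auto simp: inj_def)

lemma card_pade_nodes:
  assumes "r \<ge> 2"
  shows "card (pade_nodes r n) = 2 * n + 2" "finite (pade_nodes r n)"
proof -
  have "card (pade_nodes r n) = card ((\<lambda>k. real k * real r) ` {..n}) +
      card ((\<lambda>k. real k * real r + 1) ` {..n})"
    unfolding pade_nodes_def using pade_node_neq[OF assms]
    by (intro card_Un_disjoint) (auto simp: disjoint_iff)
  then show "card (pade_nodes r n) = 2 * n + 2"
    using inj_on_subset[OF pade_node_inj(1)[OF assms], of "{..n}"]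
      inj_on_subset[OF pade_node_inj(2)[OF assms], of "{..n}"] by (simp add: card_image)
qed (simp add: pade_nodes_def)

lemma sum_pade_nodes:
  assumes "r \<ge> 2"
  shows "(\<Sum>x\<in>pade_nodes r n. g x) =
           (\<Sum>k\<le>n. g (real k * real r)) + (\<Sum>k\<le>n. g (real k * real r + 1))"
  unfolding pade_nodes_def using pade_node_neq[OF assms] assms
  by (subst sum.union_disjoint)
     (auto simp: sum.reindex inj_on_subset[OF pade_node_inj(1)] inj_on_subset[OF pade_node_inj(2)]
       disjoint_iff)

text \<open>This is the origin of the coefficients: with one constant \<open>K\<close>, the Lagrange
  weights at the nodes \<open>k r\<close> and \<open>k r + 1\<close> are
  \<open>- pade r n k / K\<close> and \<open>pade r n (n - k) / K\<close>.\<close>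

lemma pade_weights:
  assumes "r \<ge> 2" "k \<le> n"
  defines "K \<equiv> real r ^ (2 * n) * ((\<Prod>i\<in>{1..n}. real i * real r - 1) * (\<Prod>i\<in>{1..n}. real i * real r + 1))"
  shows "(\<Prod>y\<in>pade_nodes r n - {real k * real r}. real k * real r - y) * pade r n k = - K"
    and "(\<Prod>y\<in>pade_nodes r n - {real k * real r + 1}. real k * real r + 1 - y) * pade r n (n - k) = K"
proof -
  define A where "A k = (\<Prod>i\<in>{1..k}. real i * real r - 1)" for k
  define B where "B k = (\<Prod>i\<in>{1..k}. real i * real r + 1)" for k
  have split: "(\<Prod>i\<in>{1..n}. g i) = (\<Prod>i\<in>{1..k}. g i) * (\<Prod>i\<in>{k<..n}. g i)" if "k \<le> n"
    for k and g :: "nat \<Rightarrow> real"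
  proof -
    have "{1..n} = {1..k} \<union> {k<..n}" using that by auto
    then show ?thesis by (simp add: prod.union_disjoint ivl_disj_int)
  qed
  have neg: "(\<Prod>i\<in>{1..m}. - g i) = (-1) ^ m * (\<Prod>i\<in>{1..m}. g i)" for m and g :: "nat \<Rightarrow> real"
    by (induction m) auto
  have f: "(\<Prod>i\<in>{1..m}. real i) = fact m" for m by (simp add: fact_prod)
  have m1: "real r ^ m * fact m = (\<Prod>i\<in>{1..m}. real i * real r)" for m
    unfolding f[symmetric] by (simp add: prod.distrib)
  have sq: "(-1::real) ^ m * (-1) ^ m = 1" for m by (simp flip: power_mult_distrib)
  have neq: "real k * real r \<noteq> real l * real r + 1" "real l * real r + 1 \<noteq> real k * real r" for k l
    using pade_node_neq[OF assms(1), of k l] by auto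
  have im1: "prod f ((\<lambda>k. real k * real r) ` M) = (\<Prod>l\<in>M. f (real l * real r))" for f :: "real \<Rightarrow> real" and M
    using inj_on_subset[OF pade_node_inj(1)[OF assms(1)], of M] by (simp add: prod.reindex)
  have im2: "prod f ((\<lambda>k. real k * real r + 1) ` M) = (\<Prod>l\<in>M. f (real l * real r + 1))" for f :: "real \<Rightarrow> real" and M
    using inj_on_subset[OF pade_node_inj(2)[OF assms(1)], of M] by (simp add: prod.reindex)
  have nodes1: "(\<Prod>y\<in>pade_nodes r n - {real k * real r}. real k * real r - y) =
      (\<Prod>l\<in>{..n} - {k}. (real k - real l) * real r) * (\<Prod>l\<le>n. (real k - real l) * real r - 1)"
  proof -
    have "pade_nodes r n - {real k * real r} =
        (\<lambda>k. real k * real r) ` ({..n} - {k}) \<union> (\<lambda>k. real k * real r + 1) ` {..n}"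
      using assms(1) by (auto simp: pade_nodes_def neq)
    then have "(\<Prod>y\<in>pade_nodes r n - {real k * real r}. real k * real r - y) =
        prod (\<lambda>y. real k * real r - y) ((\<lambda>k. real k * real r) ` ({..n} - {k})) *
        prod (\<lambda>y. real k * real r - y) ((\<lambda>k. real k * real r + 1) ` {..n})"
      by (simp only:, intro prod.union_disjoint) (auto simp: neq)
    then show ?thesis unfolding im1 im2 by (simp add: left_diff_distrib diff_diff_eq)
  qed
  have nodes2: "(\<Prod>y\<in>pade_nodes r n - {real k * real r + 1}. real k * real r + 1 - y) =
      (\<Prod>l\<le>n. (real k - real l) * real r + 1) * (\<Prod>l\<in>{..n} - {k}. (real k - real l) * real r)"
  proof -
    have "pade_nodes r n - {real k * real r + 1} =
        (\<lambda>k. real k * real r) ` {..n} \<union> (\<lambda>k. real k * real r + 1) ` ({..n} - {k})"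
      using assms(1) by (auto simp: pade_nodes_def neq)
    then have "(\<Prod>y\<in>pade_nodes r n - {real k * real r + 1}. real k * real r + 1 - y) =
        prod (\<lambda>y. real k * real r + 1 - y) ((\<lambda>k. real k * real r) ` {..n}) *
        prod (\<lambda>y. real k * real r + 1 - y) ((\<lambda>k. real k * real r + 1) ` ({..n} - {k}))"
      by (simp only:, intro prod.union_disjoint) (auto simp: neq)
    then show ?thesis unfolding im1 im2 by (simp add: left_diff_distrib algebra_simps)
  qed
  have e0: "(\<Prod>l\<in>{..n} - {k}. (real k - real l) * real r) =
      real r ^ k * fact k * ((-1) ^ (n - k) * (real r ^ (n - k) * fact (n - k)))"
    unfolding m1 using prod_shifted(2)[OF assms(2), of "\<lambda>x. x * real r"] neg[of "\<lambda>i. real i * real r"]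
    by simp
  \<comment> \<open>The factor at \<open>i = 0\<close> belongs to the adjacent node of the other
    family. It is -1 here and 1 in \<open>e2\<close>, whence the opposite signs of the two families
    of weights.\<close>
  have "(\<Prod>i\<le>m. - real i * real r - 1) = - ((-1) ^ m * B m)" for m
    by (induction m) (simp_all add: B_def algebra_simps)
  then have e1: "(\<Prod>l\<le>n. (real k - real l) * real r - 1) = A k * (- ((-1) ^ (n - k) * B (n - k)))"
    unfolding prod_shifted(1)[OF assms(2), of "\<lambda>x. x * real r - 1"] A_def by simp
  have "(\<Prod>i\<le>m. - real i * real r + 1) = (-1) ^ m * A m" for m
    by (induction m) (simp_all add: A_def algebra_simps)
  then have e2: "(\<Prod>l\<le>n. (real k - real l) * real r + 1) = B k * ((-1) ^ (n - k) * A (n - k))"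
    unfolding prod_shifted(1)[OF assms(2), of "\<lambda>x. x * real r + 1"] B_def by simp
  have p1: "pade r n k = real r ^ n * ((\<Prod>i\<in>{k<..n}. real i * real r - 1) / fact (n - k))
                           * ((\<Prod>i\<in>{n - k<..n}. real i * real r + 1) / fact k)"
    by (simp add: pade_def)
  have p2: "pade r n (n - k) = real r ^ n * ((\<Prod>i\<in>{n - k<..n}. real i * real r - 1) / fact k)
                           * ((\<Prod>i\<in>{k<..n}. real i * real r + 1) / fact (n - k))"
    using assms(2) by (simp add: pade_def)
  have rr: "real r ^ k * real r ^ (n - k) = real r ^ n" using assms(2) by (simp flip: power_add)
  have AB: "A n = A k * (\<Prod>i\<in>{k<..n}. real i * real r - 1)"
    "A n = A (n - k) * (\<Prod>i\<in>{n - k<..n}. real i * real r - 1)"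
    "B n = B k * (\<Prod>i\<in>{k<..n}. real i * real r + 1)"
    "B n = B (n - k) * (\<Prod>i\<in>{n - k<..n}. real i * real r + 1)"
    unfolding A_def B_def by (rule split, use assms(2) in simp)+
  have K: "K = real r ^ n * real r ^ n * (A n * B n)"
    unfolding K_def A_def B_def mult_2 power_add by simp
  have "(\<Prod>y\<in>pade_nodes r n - {real k * real r}. real k * real r - y) * pade r n k =
      - ((-1) ^ (n - k) * (-1) ^ (n - k)) * (real r ^ k * real r ^ (n - k)) * real r ^ n *
        ((A k * (\<Prod>i\<in>{k<..n}. real i * real r - 1)) * (B (n - k) * (\<Prod>i\<in>{n - k<..n}. real i * real r + 1)))"
    unfolding nodes1 e0 e1 p1 by (simp add: field_simps)
  then show "(\<Prod>y\<in>pade_nodes r n - {real k * real r}. real k * real r - y) * pade r n k = - K"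
    unfolding AB(1)[symmetric] AB(4)[symmetric] rr sq K by simp
  have "(\<Prod>y\<in>pade_nodes r n - {real k * real r + 1}. real k * real r + 1 - y) * pade r n (n - k) =
      ((-1) ^ (n - k) * (-1) ^ (n - k)) * (real r ^ k * real r ^ (n - k)) * real r ^ n *
        ((A (n - k) * (\<Prod>i\<in>{n - k<..n}. real i * real r - 1)) * (B k * (\<Prod>i\<in>{k<..n}. real i * real r + 1)))"
    unfolding nodes2 e0 e2 p2 by (simp add: field_simps)
  then show "(\<Prod>y\<in>pade_nodes r n - {real k * real r + 1}. real k * real r + 1 - y) * pade r n (n - k) = K"
    unfolding AB(2)[symmetric] AB(3)[symmetric] rr sq K by simp
qed

text \<open>Up to a constant factor, the coefficients are those of the divided difference at the
  exponents \<open>k r\<close> and \<open>k r + 1\<close>.\<close>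

lemma pade_moments:
  assumes "r \<ge> 2" "l \<le> 2 * n"
  shows "(\<Sum>k\<le>n. pade r n (n - k) * (real k * real r + 1) ^ l - pade r n k * (real k * real r) ^ l) = 0"
proof -
  define K where "K = real r ^ (2 * n) *
    ((\<Prod>i\<in>{1..n}. real i * real r - 1) * (\<Prod>i\<in>{1..n}. real i * real r + 1))"
  have inv: "x / P = p * x / C" if "P * p = C" "p \<noteq> 0" for x P p C :: real
    using that by (cases "P = 0") (auto simp: field_simps)
  have nz: "pade r n k \<noteq> 0" for k using pade_pos[OF assms(1), of n k] by simp
  have K0: "K \<noteq> 0"
  proof -
    have "real i * real r - 1 > 0" if "i \<ge> 1" for i
    proof -
      have "1 * 2 \<le> real i * real r" using that assms by (intro mult_mono) auto
      then show ?thesis by simp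
    qed
    moreover have "real i * real r + 1 > 0" for i by (simp add: add_nonneg_pos)
    ultimately have "K > 0" using assms unfolding K_def
      by (intro mult_pos_pos prod_pos zero_less_power) auto
    then show ?thesis by simp
  qed
  \<comment> \<open>There are \<open>2 n + 2\<close> nodes, just enough to annihilate the powers up
    to \<open>2 n\<close>.\<close>
  have "0 = divdiff (\<lambda>x. x ^ l) (pade_nodes r n)"
    using divdiff_power[of "pade_nodes r n" l] card_pade_nodes[OF assms(1)] assms(2) by simp
  also have "\<dots> = (\<Sum>k\<le>n. pade r n k * (real k * real r) ^ l / (- K)) +
                 (\<Sum>k\<le>n. pade r n (n - k) * (real k * real r + 1) ^ l / K)"
    unfolding divdiff_def sum_pade_nodes[OF assms(1)]
    by (intro arg_cong2[where f = "(+)"] sum.cong refl inv nz)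
       (use pade_weights[OF assms(1), of _ n, folded K_def] in auto)
  also have "\<dots> = (\<Sum>k\<le>n. pade r n (n - k) * (real k * real r + 1) ^ l - pade r n k * (real k * real r) ^ l) / K"
    by (simp add: sum_subtractf diff_divide_distrib sum_divide_distrib sum_negf)
  finally show ?thesis using K0 by simp
qed

section \<open>The remainder of the approximation near 1\<close>

lemma sum_pade_rev: "(\<Sum>k\<le>n. f (pade r n (n - k))) = (\<Sum>k\<le>n. f (pade r n k))"
  by (rule sum.reindex_bij_witness[of _ "\<lambda>k. n - k" "\<lambda>k. n - k"]) auto

text \<open>This is \<open>t^(1/r) P(t) - Q(t)\<close> at \<open>t = exp (r l)\<close>. In this
  parameter the root is the entire function \<open>exp l\<close>, so that no branch has to be
  chosen.\<close>

definition pade_rem :: "nat \<Rightarrow> nat \<Rightarrow> complex \<Rightarrow> complex" where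
  "pade_rem r n l = (\<Sum>k\<le>n. of_real (pade r n (n - k)) * exp (of_nat (k * r + 1) * l)
                          - of_real (pade r n k) * exp (of_nat (k * r) * l))"

text \<open>By the vanishing moments, the Taylor polynomials of degree \<open>2 n\<close> of all the
  exponentials cancel. Only Taylor tails remain; \<open>E\<close> is the largest exponent, and the
  coefficients add up to at most \<open>4 (4 r^2)^n\<close>.\<close>

lemma norm_pade_rem_le:
  fixes r n :: nat
  assumes "r \<ge> 2"
  defines "E \<equiv> real (n * r + 1)"
  shows "norm (pade_rem r n l) \<le> 4 * (4 * real r ^ 2) ^ n *
           (exp (E * norm l) * (E * norm l) ^ (2 * n + 1) / fact (2 * n))"
proof -
  define T where "T e = exp (of_nat e * l) - (\<Sum>i\<le>2 * n. (of_nat e * l) ^ i / fact i)" for e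
  define b where "b = exp (E * norm l) * (E * norm l) ^ (2 * n + 1) / fact (2 * n)"
  have T: "norm (T e) \<le> b" if "real e \<le> E" for e
  proof -
    have le: "norm (of_nat e * l) \<le> E * norm l"
      using that by (simp add: norm_mult mult_right_mono)
    have "norm (T e) \<le> exp (norm (of_nat e * l)) * norm (of_nat e * l) ^ Suc (2 * n) / fact (2 * n)"
      unfolding T_def by (rule Taylor_exp_field)
    also have "\<dots> \<le> b" unfolding b_def Suc_eq_plus1
      by (intro divide_right_mono mult_mono power_mono) (use le in auto)
    finally show ?thesis .
  qed
  have mom: "(\<Sum>k\<le>n. of_real (pade r n (n - k)) * (of_nat (k * r + 1)) ^ i
                       - of_real (pade r n k) * (of_nat (k * r)) ^ i) = (0 :: complex)"
    if "i \<le> 2 * n" for i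
    using arg_cong[OF pade_moments[OF assms(1) that], of complex_of_real] by (simp add: add.commute)
  have "(\<Sum>k\<le>n. of_real (pade r n (n - k)) * (\<Sum>i\<le>2 * n. (of_nat (k * r + 1) * l) ^ i / fact i)
                - of_real (pade r n k) * (\<Sum>i\<le>2 * n. (of_nat (k * r) * l) ^ i / fact i)) =
        (\<Sum>i\<le>2 * n. (l ^ i / fact i) * (\<Sum>k\<le>n. of_real (pade r n (n - k)) * (of_nat (k * r + 1)) ^ i
                       - of_real (pade r n k) * (of_nat (k * r)) ^ i))"
    unfolding sum_distrib_left sum_subtractf[symmetric]
    by (subst sum.swap) (simp add: power_mult_distrib right_diff_distrib mult_ac
        del: of_nat_add of_nat_mult of_nat_Suc)
  also have "\<dots> = 0" using mom by simp
  finally have "pade_rem r n l =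
      (\<Sum>k\<le>n. of_real (pade r n (n - k)) * T (k * r + 1) - of_real (pade r n k) * T (k * r))"
    unfolding pade_rem_def T_def right_diff_distrib sum_subtractf by simp
  also have "norm \<dots> \<le> (\<Sum>k\<le>n. pade r n (n - k) * b + pade r n k * b)"
  proof (intro sum_norm_le)
    fix k assume k: "k \<in> {..n}"
    have "real (k * r + 1) \<le> E" unfolding E_def of_nat_le_iff using k by simp
    then have "norm (T (k * r + 1)) \<le> b" "norm (T (k * r)) \<le> b" using T by auto
    then show "norm (of_real (pade r n (n - k)) * T (k * r + 1) - of_real (pade r n k) * T (k * r))
        \<le> pade r n (n - k) * b + pade r n k * b"
      using less_imp_le[OF pade_pos[OF assms(1), of n]]
      by (intro order.trans[OF norm_triangle_ineq4] add_mono) (auto simp: norm_mult intro!: mult_mono)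
  qed
  also have "\<dots> = 2 * (\<Sum>k\<le>n. pade r n k) * b"
    unfolding sum.distrib sum_pade_rev[of "\<lambda>x. x * b"] by (simp add: sum_distrib_right)
  also have "\<dots> \<le> 2 * (2 * (4 * real r ^ 2) ^ n) * b"
    using sum_pade_le[OF assms(1), of n] by (intro mult_right_mono mult_left_mono) (auto simp: b_def E_def)
  finally show ?thesis by (simp add: b_def)
qed

lemma power_div_fact_le_exp:
  fixes x :: real
  assumes "x \<ge> 0"
  shows "x ^ n / fact n \<le> exp x"
proof -
  have "(\<lambda>n. x ^ n /\<^sub>R fact n) sums exp x" by (rule exp_converges)
  then have "(\<Sum>i\<in>{n}. x ^ i /\<^sub>R fact i) \<le> exp x"
    using assms sum_le_suminf[of "\<lambda>n. x ^ n /\<^sub>R fact n" "{n}"] by (simp add: sums_iff)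
  then show ?thesis by (simp add: divide_inverse_commute)
qed

text \<open>With \<open>m = 2 n + 1\<close>, the tail is at most
  \<open>(exp 1 * exp q * q)^m * m\<close> because \<open>m^m / fact m \<le> exp m\<close>. Then
  \<open>exp 1 * exp q \<le> 3\<close> and \<open>m \<le> 3^n\<close> give
  \<open>3 q (9 q^2)^n 3^n\<close>; the constants are \<open>12 = 4 * 3\<close> and
  \<open>108 = 4 * 9 * 3\<close>. In the application, \<open>q\<close> is
  \<open>h / Z v ^ r\<close>.\<close>

lemma norm_pade_rem_le':
  assumes "r \<ge> 2" "real r * norm l \<le> 2 * q" "q \<le> 1 / 100"
  shows "norm (pade_rem r n l) \<le> 12 * q * (108 * real r ^ 2 * q ^ 2) ^ n"
proof -
  define m where "m = 2 * n + 1"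
  define E where "E = real (n * r + 1) * norm l"
  have q0: "q \<ge> 0" using assms(2) by (meson dual_order.trans mult_nonneg_nonneg norm_ge_zero of_nat_0_le_iff zero_le_mult_iff zero_le_numeral not_numeral_le_zero)
  have "2 * E = 2 * real n * (real r * norm l) + 2 * norm l" by (simp add: E_def algebra_simps)
  also have "2 * norm l \<le> real r * norm l" using assms(1) by (intro mult_right_mono) auto
  also have "2 * real n * (real r * norm l) + real r * norm l = real m * (real r * norm l)"
    by (simp add: m_def algebra_simps)
  also have "\<dots> \<le> real m * (2 * q)" using assms(2) by (intro mult_left_mono) auto
  finally have E: "E \<le> real m * q" by simp
  have E0: "E \<ge> 0" by (simp add: E_def)
  have "exp q \<le> 1 + q + q ^ 2" using q0 assms(3) by (intro exp_bound) auto
  also have "\<dots> \<le> 1 + 1 / 100 + (1 / 100) ^ 2" using q0 assms(3) by (intro add_mono power_mono) auto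
  finally have "exp 1 * exp q \<le> (272 / 100) * (1 + 1 / 100 + (1 / 100) ^ 2)"
    using e_less_272 by (intro mult_mono) auto
  also have "\<dots> \<le> 3" by (simp add: power2_eq_square)
  finally have e3: "exp 1 * exp q \<le> 3" .
  have m1: "real m \<le> 3 ^ n"
  proof -
    have "m \<le> 3 ^ n" unfolding m_def by (induction n) auto
    then show ?thesis by (metis of_nat_le_iff of_nat_numeral of_nat_power)
  qed
  have mf: "real m ^ m / fact (2 * n) \<le> real m * exp 1 ^ m"
  proof -
    have "real m ^ m / fact (2 * n) = real m * (real m ^ m / fact m)"
      unfolding m_def by (simp add: divide_simps del: power_Suc)
    also have "\<dots> \<le> real m * exp (real m)"
      by (intro mult_left_mono power_div_fact_le_exp) auto
    finally show ?thesis by (simp add: exp_of_nat_mult[of m 1, simplified])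
  qed
  have "exp E * E ^ m / fact (2 * n) \<le> exp (real m * q) * (real m * q) ^ m / fact (2 * n)"
    using E E0 by (intro divide_right_mono mult_mono power_mono) auto
  also have "\<dots> = (exp q * q) ^ m * (real m ^ m / fact (2 * n))"
    by (simp add: exp_of_nat_mult power_mult_distrib)
  also have "\<dots> \<le> (exp q * q) ^ m * (real m * exp 1 ^ m)"
    using q0 mf by (intro mult_left_mono) auto
  also have "\<dots> = (exp 1 * exp q * q) ^ m * real m"
    by (simp add: power_mult_distrib)
  also have "\<dots> \<le> (3 * q) ^ m * 3 ^ n"
    using q0 e3 m1 by (intro mult_mono power_mono mult_right_mono) auto
  also have "\<dots> = 3 * q * (9 * q ^ 2) ^ n * 3 ^ n"
    by (simp add: m_def power_mult_distrib power_mult)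
  finally have b: "exp E * E ^ m / fact (2 * n) \<le> 3 * q * (9 * q ^ 2) ^ n * 3 ^ n" .
  have "norm (pade_rem r n l) \<le> 4 * (4 * real r ^ 2) ^ n * (exp E * E ^ m / fact (2 * n))"
    unfolding E_def m_def by (rule norm_pade_rem_le[OF assms(1)])
  also have "\<dots> \<le> 4 * (4 * real r ^ 2) ^ n * (3 * q * (9 * q ^ 2) ^ n * 3 ^ n)"
    using b by (intro mult_left_mono) auto
  also have "\<dots> = 12 * q * ((4 * real r ^ 2) * (9 * q ^ 2) * 3) ^ n"
    unfolding power_mult_distrib by simp
  also have "(4 * real r ^ 2) * (9 * q ^ 2) * 3 = 108 * real r ^ 2 * q ^ 2" by simp
  finally show ?thesis .
qed

text \<open>Since the numerator is the reversal of the denominator, one form homogenises both: with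
  \<open>t = (y / x)^r\<close>, the values at \<open>(x, y)\<close> and \<open>(y, x)\<close> are
  \<open>x^(n r) y P(t)\<close> and \<open>x^(n r) x Q(t)\<close>.\<close>

definition pade_form :: "nat \<Rightarrow> nat \<Rightarrow> complex \<Rightarrow> complex \<Rightarrow> complex" where
  "pade_form r n x y = (\<Sum>k\<le>n. of_real (pade r n k) * (x ^ (k * r) * y ^ ((n - k) * r + 1)))"

lemma norm_pade_form_le:
  assumes "r \<ge> 2" "norm x \<le> z" "norm y \<le> z"
  shows "norm (pade_form r n x y) \<le> 2 * (4 * real r ^ 2) ^ n * z ^ (n * r + 1)"
proof -
  have z: "z \<ge> 0" using assms(2) norm_ge_zero order.trans by blast
  have "norm (pade_form r n x y) \<le> (\<Sum>k\<le>n. pade r n k * z ^ (n * r + 1))"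
    unfolding pade_form_def
  proof (intro sum_norm_le)
    fix k assume k: "k \<in> {..n}"
    have "norm (x ^ (k * r) * y ^ ((n - k) * r + 1)) \<le> z ^ (k * r) * z ^ ((n - k) * r + 1)"
      unfolding norm_mult norm_power using assms z by (intro mult_mono power_mono) auto
    also have "\<dots> = z ^ (k * r + ((n - k) * r + 1))" by (simp only: power_add)
    also have "k * r + ((n - k) * r + 1) = n * r + 1"
      using k by (simp add: add_mult_distrib[symmetric])
    finally show "norm (of_real (pade r n k) * (x ^ (k * r) * y ^ ((n - k) * r + 1))) \<le>
        pade r n k * z ^ (n * r + 1)"
      using pade_pos[OF assms(1), of n k] by (simp add: norm_mult mult_left_mono)
  qed
  also have "\<dots> = (\<Sum>k\<le>n. pade r n k) * z ^ (n * r + 1)" by (simp add: sum_distrib_right)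
  also have "\<dots> \<le> 2 * (4 * real r ^ 2) ^ n * z ^ (n * r + 1)"
    using sum_pade_le[OF assms(1)] z by (intro mult_right_mono) auto
  finally show ?thesis .
qed

lemma pade_form_diff_eq_rem:
  assumes "\<omega> ^ r = 1" "y = \<omega> * x * exp l"
  shows "pade_form r n x y - \<omega> * pade_form r n y x = \<omega> * x ^ (n * r + 1) * pade_rem r n l"
proof -
  have y: "y ^ (k * r) = x ^ (k * r) * exp (of_nat (k * r) * l)" for k
    unfolding assms(2) power_mult_distrib exp_of_nat_mult
    using assms(1) by (simp add: power_mult mult.commute[of k r])
  have y1: "y ^ (k * r + 1) = \<omega> * (x ^ (k * r + 1) * exp (of_nat (k * r + 1) * l))" for k
    unfolding power_add y by (simp add: assms(2) exp_add ring_distribs)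
  have deg: "x ^ (k * r) * x ^ ((n - k) * r + 1) = x ^ (n * r + 1)" if "k \<le> n" for k
    using that by (simp add: power_add[symmetric] add_mult_distrib[symmetric] flip: power_Suc)
  have "pade_form r n x y = (\<Sum>k\<le>n. of_real (pade r n (n - k)) * (x ^ ((n - k) * r) * y ^ (k * r + 1)))"
    unfolding pade_form_def
    by (rule sum.reindex_bij_witness[of _ "\<lambda>k. n - k" "\<lambda>k. n - k"]) auto
  also have "\<dots> = (\<Sum>k\<le>n. \<omega> * x ^ (n * r + 1) * (of_real (pade r n (n - k)) * exp (of_nat (k * r + 1) * l)))"
  proof (intro sum.cong refl)
    fix k assume "k \<in> {..n}"
    then have "n * r + 1 = (n - k) * r + (k * r + 1)" by (simp add: add_mult_distrib[symmetric])
    then have "x ^ (n * r + 1) = x ^ ((n - k) * r) * x ^ (k * r + 1)" by (simp only: power_add)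
    then show "of_real (pade r n (n - k)) * (x ^ ((n - k) * r) * y ^ (k * r + 1)) =
        \<omega> * x ^ (n * r + 1) * (of_real (pade r n (n - k)) * exp (of_nat (k * r + 1) * l))"
      unfolding y1 by (simp only: mult_ac)
  qed
  finally have 1: "pade_form r n x y = (\<Sum>k\<le>n. \<omega> * x ^ (n * r + 1) *
      (of_real (pade r n (n - k)) * exp (of_nat (k * r + 1) * l)))" .
  have 2: "\<omega> * pade_form r n y x = (\<Sum>k\<le>n. \<omega> * x ^ (n * r + 1) *
      (of_real (pade r n k) * exp (of_nat (k * r) * l)))"
    unfolding pade_form_def sum_distrib_left y
  proof (intro sum.cong refl)
    fix k assume "k \<in> {..n}"
    then have k: "k \<le> n" by simp
    show "\<omega> * (of_real (pade r n k) * (x ^ (k * r) * exp (of_nat (k * r) * l) * x ^ ((n - k) * r + 1))) =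
        \<omega> * x ^ (n * r + 1) * (of_real (pade r n k) * exp (of_nat (k * r) * l))"
      unfolding deg[OF k, symmetric] by (simp only: mult_ac)
  qed
  show ?thesis unfolding 1 2 pade_rem_def sum_distrib_left sum_subtractf right_diff_distrib ..
qed

text \<open>Splitting \<open>y' = \<omega> x' + (y' - \<omega> x')\<close> separates two sources of
  smallness: the Pade remainder at \<open>(x, y)\<close>, and the distance of the second point from
  the line with slope \<omega>.\<close>

lemma pade_form_upper:
  assumes "r \<ge> 2" "\<omega> ^ r = 1" "y = \<omega> * x * exp l" "norm x \<le> z" "norm y \<le> z"
    "real r * norm l \<le> 2 * q" "q \<le> 1 / 100"
  shows "norm (x' * pade_form r n x y - y' * pade_form r n y x) \<le>
    z ^ (n * r + 1) * (12 * q * (108 * real r ^ 2 * q ^ 2) ^ n * norm x'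
                        + 2 * (4 * real r ^ 2) ^ n * norm (y' - \<omega> * x'))"
proof -
  have z: "z \<ge> 0" using assms(4) norm_ge_zero order.trans by blast
  have "norm \<omega> ^ r = 1 ^ r" using assms(2) by (simp flip: norm_power)
  then have w: "norm \<omega> = 1" using assms(1) by (intro power_eq_imp_eq_base[of "norm \<omega>" r 1]) auto
  have "x' * pade_form r n x y - y' * pade_form r n y x =
      x' * (pade_form r n x y - \<omega> * pade_form r n y x) - (y' - \<omega> * x') * pade_form r n y x"
    by (simp add: algebra_simps)
  also have "\<dots> = x' * (\<omega> * x ^ (n * r + 1) * pade_rem r n l) - (y' - \<omega> * x') * pade_form r n y x"
    unfolding pade_form_diff_eq_rem[OF assms(2,3)] ..
  also have "norm \<dots> \<le> norm x' * (z ^ (n * r + 1) * (12 * q * (108 * real r ^ 2 * q ^ 2) ^ n)) +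
      norm (y' - \<omega> * x') * (2 * (4 * real r ^ 2) ^ n * z ^ (n * r + 1))"
    unfolding norm_mult norm_power
    apply (rule order.trans[OF norm_triangle_ineq4])
    unfolding norm_mult norm_power w mult_1
    by (intro add_mono mult_mono order_refl power_mono norm_pade_rem_le' norm_pade_form_le assms) (use z in auto)
  finally show ?thesis by (simp add: algebra_simps)
qed

section \<open>Independence of consecutive approximants\<close>

lemma pade_rem_tendsto_0:
  assumes "r \<ge> 2"
  shows "((\<lambda>l. pade_rem r n (of_real l) / of_real l ^ (2 * n)) \<longlongrightarrow> 0) (at_right 0)"
proof (rule Lim_null_comparison)
  define E where "E = real (n * r + 1)"
  define c where "c = 4 * (4 * real r ^ 2) ^ n * E ^ (2 * n + 1) / fact (2 * n)"
  show "\<forall>\<^sub>F l in at_right 0. norm (pade_rem r n (of_real l) / of_real l ^ (2 * n)) \<le> c * exp (E * l) * l"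
    using eventually_at_right_less[of 0]
  proof eventually_elim
    case (elim l)
    have "norm (pade_rem r n (of_real l)) \<le> 4 * (4 * real r ^ 2) ^ n *
        (exp (E * l) * (E * l) ^ (2 * n + 1) / fact (2 * n))"
      using norm_pade_rem_le[OF assms, of n "of_real l"] elim by (simp add: E_def)
    also have "\<dots> = c * exp (E * l) * l * l ^ (2 * n)"
      by (simp add: c_def power_mult_distrib)
    finally show ?case using elim by (simp add: norm_divide norm_power divide_simps)
  qed
  show "((\<lambda>l. c * exp (E * l) * l) \<longlongrightarrow> 0) (at_right 0)"
    by (rule tendsto_eq_intros refl | simp)+
qed

text \<open>The determinant is a polynomial of degree at most
  \<open>2 n + 1\<close> in \<open>t = (y / x) ^ r\<close> which vanishes to order \<open>2 n + 1\<close> at \<open>t = 1\<close>.\<close>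

lemma pade_form_independent:
  assumes r: "r \<ge> 2" and xy: "x \<noteq> 0" "y \<noteq> 0" "x ^ r \<noteq> y ^ r"
  shows "pade_form r n x y * pade_form r (Suc n) y x \<noteq> pade_form r (Suc n) x y * pade_form r n y x"
proof -
  define P where "P n = (\<Sum>k\<le>n. monom (complex_of_real (pade r n (n - k))) k)" for n
  define Q where "Q n = (\<Sum>k\<le>n. monom (complex_of_real (pade r n k)) k)" for n
  define R where "R = P n * Q (Suc n) - P (Suc n) * Q n"
  have degP: "degree (P n) \<le> n" and degQ: "degree (Q n) \<le> n" for n
    unfolding P_def Q_def by (intro degree_sum_le; force intro: order.trans[OF degree_monom_le])+
  have cP: "coeff (P n) n = of_real (pade r n 0)" and cQ: "coeff (Q n) n = of_real (pade r n n)" for n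
    by (simp_all add: P_def Q_def coeff_sum)
  \<comment> \<open>The two contributions to the top coefficient of \<open>R\<close> are in the
    ratio \<open>(n+1) r + 1\<close> to \<open>(n+1) r - 1\<close>, so they do not cancel.\<close>
  have *: "pade r n 0 * pade r (Suc n) (Suc n) - pade r (Suc n) 0 * pade r n n =
      2 * real r / real (Suc n) * (pade r n 0 * pade r n n)"
  proof -
    have "{0<..Suc n} = insert (Suc n) {0<..n}" by auto
    then show ?thesis unfolding pade_def by (simp add: divide_simps) (simp add: algebra_simps)
  qed
  have **: "2 * real r / real (Suc n) * (pade r n 0 * pade r n n) \<noteq> 0"
    using r pade_pos[OF r, of n 0] pade_pos[OF r, of n n] by simp
  have lead: "coeff R (2 * n + 1) \<noteq> 0"
  proof -
    have dP: "degree (P n) = n" and dQ: "degree (Q n) = n" for n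
      using degP[of n] degQ[of n] le_degree[of "P n" n] le_degree[of "Q n" n]
        pade_pos[OF r, of n 0] pade_pos[OF r, of n n] by (auto simp: cP cQ)
    have "coeff R (2 * n + 1) = coeff (P n * Q (Suc n)) (n + Suc n) - coeff (P (Suc n) * Q n) (Suc n + n)"
      by (simp add: R_def mult_2)
    also have "\<dots> = of_real (pade r n 0 * pade r (Suc n) (Suc n) - pade r (Suc n) 0 * pade r n n)"
      using coeff_mult_degree_sum[of "P n" "Q (Suc n)"] coeff_mult_degree_sum[of "P (Suc n)" "Q n"]
      by (simp only: dP dQ cP cQ of_real_diff of_real_mult)
    finally show ?thesis using * ** by (metis of_real_eq_0_iff)
  qed
  then have R0: "R \<noteq> 0" by auto
  have degR: "degree R \<le> 2 * n + 1"
    unfolding R_def using degree_mult_le[of "P n" "Q (Suc n)"] degree_mult_le[of "P (Suc n)" "Q n"]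
      degP[of n] degQ[of n] degP[of "Suc n"] degQ[of "Suc n"]
    by (intro degree_diff_le) auto
  \<comment> \<open>Eliminating the common products of denominators expresses the determinant by
    remainders, which are small at \<open>l = 0\<close>.\<close>
  have ex: "poly R (exp (of_nat r * l)) * exp l =
      pade_rem r n l * poly (Q (Suc n)) (exp (of_nat r * l)) - pade_rem r (Suc n) l * poly (Q n) (exp (of_nat r * l))"
    for l
  proof -
    have rem: "pade_rem r n l = exp l * poly (P n) (exp (of_nat r * l)) - poly (Q n) (exp (of_nat r * l))" for n
    proof -
      have e: "exp (of_nat r * l) ^ k = exp (of_nat (k * r) * l)" for k
        by (simp add: exp_of_nat_mult[symmetric] mult.assoc)
      show ?thesis
        unfolding P_def Q_def poly_sum poly_monom e pade_rem_def sum_subtractf sum_distrib_left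
        by (simp add: exp_add ring_distribs mult_ac)
    qed
    show ?thesis unfolding rem R_def by (simp add: algebra_simps)
  qed
  define k where "k = order 1 R"
  obtain R1 where R1: "R = [:-1, 1:] ^ k * R1" and "poly R1 1 \<noteq> 0"
    using order_decomp[OF R0, of 1] unfolding k_def poly_eq_0_iff_dvd by blast
  \<comment> \<open>If the order \<open>k\<close> at 1 were at most \<open>2 n\<close>, then
    division by \<open>l^(2 n)\<close> would still force the cofactor \<open>R1\<close> to tend to 0
    as \<open>l\<close> tends to 0 from the right, although \<open>R1\<close> does not vanish at
    1.\<close>
  have "k \<ge> 2 * n + 1"
  proof (rule ccontr)
    assume "\<not> k \<ge> 2 * n + 1"
    then have k: "k \<le> 2 * n" by simp
    let ?e = "\<lambda>l. exp (of_nat r * of_real l) :: complex"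
    have ct: "((\<lambda>l. poly S (?e l)) \<longlongrightarrow> poly S (?e 0)) (at_right 0)" for S
      by (intro tendsto_intros)
    have "((\<lambda>l. (pade_rem r n (of_real l) / of_real l ^ (2 * n)) * poly (Q (Suc n)) (?e l)
         - (pade_rem r (Suc n) (of_real l) / of_real l ^ (2 * Suc n)) * of_real l ^ 2 * poly (Q n) (?e l))
         \<longlongrightarrow> 0 * poly (Q (Suc n)) (?e 0) - 0 * of_real 0 ^ 2 * poly (Q n) (?e 0)) (at_right 0)"
      by (intro tendsto_diff tendsto_mult ct pade_rem_tendsto_0 r tendsto_power tendsto_of_real tendsto_ident_at)
    then have lim0: "((\<lambda>l. norm ((pade_rem r n (of_real l) / of_real l ^ (2 * n)) * poly (Q (Suc n)) (?e l)
         - (pade_rem r (Suc n) (of_real l) / of_real l ^ (2 * Suc n)) * of_real l ^ 2 * poly (Q n) (?e l)))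
         \<longlongrightarrow> 0) (at_right 0)" by (simp add: tendsto_norm_zero_iff)
    have "((\<lambda>l. poly R1 (?e l)) \<longlongrightarrow> 0) (at_right 0)"
    proof (rule Lim_null_comparison[OF _ lim0])
      have "eventually (\<lambda>l::real. 0 < l \<and> l < 1) (at_right 0)"
        by (simp add: eventually_at_right_field) (use zero_less_one in blast)
      then show "\<forall>\<^sub>F l in at_right 0. norm (poly R1 (?e l)) \<le>
         norm ((pade_rem r n (of_real l) / of_real l ^ (2 * n)) * poly (Q (Suc n)) (?e l)
         - (pade_rem r (Suc n) (of_real l) / of_real l ^ (2 * Suc n)) * of_real l ^ 2 * poly (Q n) (?e l))"
      proof eventually_elim
        case (elim l)
        have "1 * l \<le> real r * l" using elim r by (intro mult_right_mono) auto
        also have "\<dots> \<le> exp (real r * l) - 1" using exp_ge_add_one_self[of "real r * l"] by linarith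
        finally have "l \<le> exp (real r * l) - 1" by simp
        also have "\<dots> \<le> norm (?e l - 1)"
        proof -
          have "?e l - 1 = of_real (exp (real r * l) - 1)" by (simp flip: exp_of_real)
          then show ?thesis by (metis abs_ge_self norm_of_real)
        qed
        finally have le: "l \<le> norm (?e l - 1)" .
        have "l ^ (2 * n) \<le> l ^ k" using elim k by (intro power_decreasing) auto
        also have "\<dots> \<le> norm (?e l - 1) ^ k" using le elim by (intro power_mono) auto
        finally have lk: "l ^ (2 * n) \<le> norm (?e l - 1) ^ k" .
        have "norm (poly R1 (?e l)) * l ^ (2 * n) \<le> norm (poly R1 (?e l)) * norm (?e l - 1) ^ k"
          using lk by (intro mult_left_mono) auto
        also have "\<dots> = norm (poly R (?e l))"
          unfolding R1 by (simp add: norm_mult norm_power poly_power)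
        also have "\<dots> * 1 \<le> norm (poly R (?e l)) * norm (exp (of_real l :: complex))"
          using elim by (intro mult_left_mono) auto
        also have "\<dots> = norm (poly R (?e l) * exp (of_real l))" by (simp add: norm_mult)
        also have "\<dots> = norm ((pade_rem r n (of_real l) / of_real l ^ (2 * n)) * poly (Q (Suc n)) (?e l)
         - (pade_rem r (Suc n) (of_real l) / of_real l ^ (2 * Suc n)) * of_real l ^ 2 * poly (Q n) (?e l)) * l ^ (2 * n)"
        proof -
          have "poly R (?e l) * exp (of_real l) = ((pade_rem r n (of_real l) / of_real l ^ (2 * n)) * poly (Q (Suc n)) (?e l)
            - (pade_rem r (Suc n) (of_real l) / of_real l ^ (2 * Suc n)) * of_real l ^ 2 * poly (Q n) (?e l)) * of_real l ^ (2 * n)"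
            unfolding ex using elim by (simp add: field_simps power2_eq_square)
          then show ?thesis using elim by (simp add: norm_mult norm_power)
        qed
        finally show ?case using elim by simp
      qed
    qed
    moreover have "((\<lambda>l. poly R1 (?e l)) \<longlongrightarrow> poly R1 (?e 0)) (at_right 0)" by (rule ct)
    ultimately have "poly R1 (?e 0) = 0" using tendsto_unique trivial_limit_at_right_real by blast
    then show False using \<open>poly R1 1 \<noteq> 0\<close> by simp
  qed
  have "degree R1 = 0"
  proof -
    have "R1 \<noteq> 0" using R0 R1 by auto
    then have "degree R = k + degree R1"
      unfolding R1 by (subst degree_mult_eq) (auto simp: degree_power_eq)
    then show ?thesis using degR \<open>k \<ge> 2 * n + 1\<close> by simp
  qed
  then obtain c where c: "R1 = [:c:]" by (rule degree_eq_zeroE)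
  define t where "t = (y / x) ^ r"
  have "t \<noteq> 1" using xy unfolding t_def by (simp add: power_divide)
  then have Rt: "poly R t \<noteq> 0" using \<open>poly R1 1 \<noteq> 0\<close> unfolding R1 c by (simp add: poly_power)
  have yt: "y ^ (m * r) = x ^ (m * r) * t ^ m" for m
    using xy by (simp add: t_def power_divide power_mult mult.commute[of m r])
  have F1: "pade_form r n x y = x ^ (n * r) * y * poly (P n) t" for n
  proof -
    have "pade_form r n x y = (\<Sum>k\<le>n. of_real (pade r n (n - k)) * (x ^ ((n - k) * r) * y ^ (k * r + 1)))"
      unfolding pade_form_def
      by (rule sum.reindex_bij_witness[of _ "\<lambda>k. n - k" "\<lambda>k. n - k"]) auto
    also have "\<dots> = (\<Sum>k\<le>n. x ^ (n * r) * y * (of_real (pade r n (n - k)) * t ^ k))"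
    proof (intro sum.cong refl)
      fix k assume "k \<in> {..n}"
      then have "x ^ (n * r) = x ^ ((n - k) * r) * x ^ (k * r)"
        by (simp add: power_add[symmetric] add_mult_distrib[symmetric])
      then show "of_real (pade r n (n - k)) * (x ^ ((n - k) * r) * y ^ (k * r + 1)) =
          x ^ (n * r) * y * (of_real (pade r n (n - k)) * t ^ k)"
        by (simp add: yt mult_ac)
    qed
    finally show ?thesis by (simp add: P_def poly_sum poly_monom sum_distrib_left)
  qed
  have F2: "pade_form r n y x = x ^ (n * r) * x * poly (Q n) t" for n
  proof -
    have "pade_form r n y x = (\<Sum>k\<le>n. x ^ (n * r) * x * (of_real (pade r n k) * t ^ k))"
      unfolding pade_form_def
    proof (intro sum.cong refl)
      fix k assume "k \<in> {..n}"
      then have "x ^ (n * r) = x ^ ((n - k) * r) * x ^ (k * r)"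
        by (simp add: power_add[symmetric] add_mult_distrib[symmetric])
      then show "of_real (pade r n k) * (y ^ (k * r) * x ^ ((n - k) * r + 1)) =
          x ^ (n * r) * x * (of_real (pade r n k) * t ^ k)"
        by (simp add: yt mult_ac)
    qed
    then show ?thesis by (simp add: Q_def poly_sum poly_monom sum_distrib_left)
  qed
  have "pade_form r n x y * pade_form r (Suc n) y x - pade_form r (Suc n) x y * pade_form r n y x =
      x ^ (n * r) * x ^ (Suc n * r) * x * y * poly R t"
    unfolding F1 F2 R_def by (simp add: algebra_simps)
  also have "\<dots> \<noteq> 0" using xy Rt by simp
  finally show ?thesis by simp
qed

subsection \<open>Arithmetic of diagonal forms\<close>

text \<open>Pairs of conjugates in the ring generated by \<open>s = \<surd>D\<close>, as pairs of complex numbers, so that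
  \<open>D\<close> may be a square.\<close>

definition conj_pair :: "complex \<Rightarrow> complex \<Rightarrow> complex \<Rightarrow> bool" where
  "conj_pair s w w' \<longleftrightarrow> (\<exists>p q :: int. w = of_int p + of_int q * s \<and> w' = of_int p - of_int q * s)"

lemma conj_pair_of_int: "conj_pair s (of_int p) (of_int p)"
  unfolding conj_pair_def by (rule exI[of _ p], rule exI[of _ 0]) simp

lemma conj_pair_mult:
  assumes "conj_pair s v v'" "conj_pair s w w'" "s ^ 2 = of_int D"
  shows "conj_pair s (v * w) (v' * w')"
proof -
  obtain p q p' q' where vw: "v = of_int p + of_int q * s" "v' = of_int p - of_int q * s"
    "w = of_int p' + of_int q' * s" "w' = of_int p' - of_int q' * s"
    using assms(1,2) unfolding conj_pair_def by blast
  have s: "s * (s * z) = of_int D * z" for z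
    using assms(3) by (metis mult.assoc power2_eq_square)
  have s': "s * s = of_int D" using assms(3) by (simp add: power2_eq_square)
  show ?thesis unfolding conj_pair_def vw
    by (rule exI[of _ "p * p' + q * q' * D"], rule exI[of _ "p * q' + q * p'"])
       (simp add: algebra_simps s s')
qed

lemma conj_pair_power:
  assumes "conj_pair s v v'" "s ^ 2 = of_int D"
  shows "conj_pair s (v ^ n) (v' ^ n)"
  using conj_pair_of_int[of s 1] conj_pair_mult[OF assms(1) _ assms(2)] by (induction n) auto

lemma conj_pair_sum:
  assumes "\<And>k. k \<in> K \<Longrightarrow> conj_pair s (f k) (g k)"
  shows "conj_pair s (sum f K) (sum g K)"
proof -
  obtain p q :: "_ \<Rightarrow> int" where pq: "\<And>k. k \<in> K \<Longrightarrow> f k = of_int (p k) + of_int (q k) * s"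
    "\<And>k. k \<in> K \<Longrightarrow> g k = of_int (p k) - of_int (q k) * s"
    using assms unfolding conj_pair_def by metis
  show ?thesis unfolding conj_pair_def
    by (rule exI[of _ "sum p K"], rule exI[of _ "sum q K"])
       (simp add: pq sum.distrib sum_subtractf sum_distrib_right)
qed

text \<open>The last assumption amounts to coprimality of \<open>A, B, C\<close>. It is phrased by
  the values of the quadratic form at \<open>(1, 0)\<close>, \<open>(0, 1)\<close>,
  \<open>(1, 1)\<close>, to which Bezout is applied in \<open>\<sigma>_le\<close>.\<close>

locale diag_form =
  fixes r :: nat and a :: "nat \<Rightarrow> int" and \<alpha> \<beta> \<gamma> \<delta> \<kappa> :: complex and A B C :: int
  assumes r: "r \<ge> 5"
    and diag: "diagonalization r a \<alpha> \<beta> \<gamma> \<delta>"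
    and quad: "\<And>x y. (\<alpha> * x + \<beta> * y) * (\<gamma> * x + \<delta> * y) =
                \<kappa> * (of_int A * x\<^sup>2 + of_int B * x * y + of_int C * y\<^sup>2)"
    and primitive: "gcd (gcd A C) (A + B + C) = 1"
begin

definition "j = \<alpha> * \<delta> - \<beta> * \<gamma>"
definition "J = cmod j"
definition "D = B\<^sup>2 - 4 * A * C"
text \<open>The square root of \<open>D\<close> with the sign for which changing \<open>s\<close> to
  \<open>- s\<close> swaps the roles of \<xi> and \<eta> in
  \<open>conj_pair_bilinear\<close>.\<close>

definition "s = j / \<kappa>"
definition "\<sigma> = cmod s"

definition \<xi> :: "int \<times> int \<Rightarrow> complex" where "\<xi> v = \<alpha> * of_int (fst v) + \<beta> * of_int (snd v)"
definition \<eta> :: "int \<times> int \<Rightarrow> complex" where "\<eta> v = \<gamma> * of_int (fst v) + \<delta> * of_int (snd v)"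
definition F :: "int \<times> int \<Rightarrow> int" where "F v = form_eval r a (fst v) (snd v)"
definition det :: "int \<times> int \<Rightarrow> int \<times> int \<Rightarrow> int" where "det v w = fst v * snd w - fst w * snd v"

lemma j_nonzero: "j \<noteq> 0" and J_pos: "J > 0"
  using diag by (auto simp: diagonalization_def j_def J_def)

lemma form_eval_diag: "form_eval r a x y = (\<alpha> * x + \<beta> * y) ^ r - (\<gamma> * x + \<delta> * y) ^ r"
  using diag by (simp add: diagonalization_def)

lemma F_eq: "of_int (F v) = \<xi> v ^ r - \<eta> v ^ r"
proof -
  have "of_int (F v) = (form_eval r a (of_int (fst v)) (of_int (snd v)) :: complex)"
    by (simp add: F_def form_eval_def)
  then show ?thesis by (simp add: form_eval_diag \<xi>_def \<eta>_def)
qed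

lemma det_eq: "\<xi> v * \<eta> w - \<xi> w * \<eta> v = j * of_int (det v w)"
  by (simp add: \<xi>_def \<eta>_def j_def det_def algebra_simps)

lemma quad_coeffs: "\<alpha> * \<gamma> = \<kappa> * of_int A" "\<beta> * \<delta> = \<kappa> * of_int C" "\<alpha> * \<delta> + \<beta> * \<gamma> = \<kappa> * of_int B"
proof -
  show 1: "\<alpha> * \<gamma> = \<kappa> * of_int A" using quad[of 1 0] by simp
  show 3: "\<beta> * \<delta> = \<kappa> * of_int C" using quad[of 0 1] by simp
  show "\<alpha> * \<delta> + \<beta> * \<gamma> = \<kappa> * of_int B" using quad[of 1 1] 1 3 by (simp add: algebra_simps)
qed

lemma \<kappa>_nonzero: "\<kappa> \<noteq> 0"
proof
  assume "\<kappa> = 0"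
  then have "\<alpha> * \<gamma> = 0" "\<beta> * \<delta> = 0" "\<alpha> * \<delta> + \<beta> * \<gamma> = 0" using quad_coeffs by auto
  then have "\<alpha> * \<delta> - \<beta> * \<gamma> = 0" by auto
  then show False using j_nonzero by (simp add: j_def)
qed

lemma s_square: "s ^ 2 = of_int D"
proof -
  have "j ^ 2 = (\<alpha> * \<delta> + \<beta> * \<gamma>) ^ 2 - 4 * (\<alpha> * \<gamma>) * (\<beta> * \<delta>)"
    by (simp add: j_def power2_eq_square algebra_simps)
  also have "\<dots> = \<kappa> ^ 2 * of_int D"
    unfolding quad_coeffs D_def by (simp add: power2_eq_square algebra_simps)
  finally show ?thesis using \<kappa>_nonzero by (simp add: s_def power_divide)
qed

lemma s_nonzero: "s \<noteq> 0"
  using j_nonzero \<kappa>_nonzero by (simp add: s_def)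

lemma D_nonzero: "D \<noteq> 0"
  using s_square s_nonzero by auto

lemma \<sigma>_square: "\<sigma> ^ 2 = \<bar>of_int D\<bar>"
  unfolding \<sigma>_def norm_power[symmetric] s_square by simp

lemma \<sigma>_ge_1: "\<sigma> \<ge> 1"
proof -
  have "\<bar>D\<bar> \<ge> 1" using D_nonzero by simp
  then have "\<bar>of_int D\<bar> \<ge> (1 :: real)" by linarith
  then have "\<sigma> ^ 2 \<ge> 1 ^ 2" by (simp add: \<sigma>_square)
  then show ?thesis by (rule power2_le_imp_le) (simp add: \<sigma>_def)
qed

text \<open>The partial derivatives of \<open>F\<close>, again with integer values. Where the
  exponent is truncated to 0, at \<open>i = r\<close> here and at \<open>i = 0\<close> in
  \<open>Fy\<close>, the numerical factor is 0.\<close>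

definition Fx :: "int \<times> int \<Rightarrow> int" where
  "Fx v = (\<Sum>i\<le>r. a i * (int (r - i) * fst v ^ (r - i - 1)) * snd v ^ i)"
definition Fy :: "int \<times> int \<Rightarrow> int" where
  "Fy v = (\<Sum>i\<le>r. a i * fst v ^ (r - i) * (int i * snd v ^ (i - 1)))"

lemma Fx_eq: "of_int (Fx v) = of_nat r * (\<alpha> * \<xi> v ^ (r - 1) - \<gamma> * \<eta> v ^ (r - 1))"
proof (rule DERIV_unique)
  let ?x = "of_int (fst v) :: complex" and ?y = "of_int (snd v) :: complex"
  show "((\<lambda>x. form_eval r a x ?y) has_field_derivative of_int (Fx v)) (at ?x)"
    unfolding form_eval_def Fx_def of_int_sum
    by (rule derivative_eq_intros refl | simp)+ (simp add: mult_ac)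
  show "((\<lambda>x. form_eval r a x ?y) has_field_derivative
      of_nat r * (\<alpha> * \<xi> v ^ (r - 1) - \<gamma> * \<eta> v ^ (r - 1))) (at ?x)"
    unfolding form_eval_diag \<xi>_def \<eta>_def
    by (rule derivative_eq_intros refl | simp add: algebra_simps)+
qed

lemma Fy_eq: "of_int (Fy v) = of_nat r * (\<beta> * \<xi> v ^ (r - 1) - \<delta> * \<eta> v ^ (r - 1))"
proof (rule DERIV_unique)
  let ?x = "of_int (fst v) :: complex" and ?y = "of_int (snd v) :: complex"
  show "((\<lambda>y. form_eval r a ?x y) has_field_derivative of_int (Fy v)) (at ?y)"
    unfolding form_eval_def Fy_def of_int_sum
    by (rule derivative_eq_intros refl | simp)+ (simp add: mult_ac)
  show "((\<lambda>y. form_eval r a ?x y) has_field_derivative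
      of_nat r * (\<beta> * \<xi> v ^ (r - 1) - \<delta> * \<eta> v ^ (r - 1))) (at ?y)"
    unfolding form_eval_diag \<xi>_def \<eta>_def
    by (rule derivative_eq_intros refl | simp add: algebra_simps)+
qed

text \<open>The Jacobian covariant of \<open>F\<close> and the quadratic form supplies the rational part of \<open>\<xi> ^ r\<close>.\<close>

lemma conj_pair_power_r:
  "conj_pair s (2 * of_nat r * s * \<xi> v ^ r) (2 * of_nat r * s * \<eta> v ^ r)"
proof -
  define Q1 where "Q1 = 2 * A * fst v + B * snd v"
  define Q2 where "Q2 = B * fst v + 2 * C * snd v"
  define G where "G = Fx v * Q2 - Fy v * Q1"
  have Q: "\<kappa> * of_int Q1 = \<alpha> * \<eta> v + \<gamma> * \<xi> v" "\<kappa> * of_int Q2 = \<beta> * \<eta> v + \<delta> * \<xi> v"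
  proof -
    have "\<kappa> * of_int Q1 = 2 * (\<kappa> * of_int A) * of_int (fst v) + \<kappa> * of_int B * of_int (snd v)"
      "\<kappa> * of_int Q2 = \<kappa> * of_int B * of_int (fst v) + 2 * (\<kappa> * of_int C) * of_int (snd v)"
      by (simp_all add: Q1_def Q2_def algebra_simps)
    then show "\<kappa> * of_int Q1 = \<alpha> * \<eta> v + \<gamma> * \<xi> v" "\<kappa> * of_int Q2 = \<beta> * \<eta> v + \<delta> * \<xi> v"
      unfolding quad_coeffs[symmetric] by (simp_all add: \<xi>_def \<eta>_def algebra_simps)
  qed
  have r1: "\<xi> v ^ r = \<xi> v * \<xi> v ^ (r - 1)" "\<eta> v ^ r = \<eta> v * \<eta> v ^ (r - 1)"
    using r by (simp_all add: power_eq_if[of _ r])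
  have "\<kappa> * of_int G = of_int (Fx v) * (\<kappa> * of_int Q2) - of_int (Fy v) * (\<kappa> * of_int Q1)"
    by (simp add: G_def algebra_simps)
  also have "\<dots> = of_nat r * j * (\<xi> v ^ r + \<eta> v ^ r)"
    unfolding Fx_eq Fy_eq Q r1 j_def by (simp add: algebra_simps)
  finally have G: "of_int G = of_nat r * s * (\<xi> v ^ r + \<eta> v ^ r)"
    using \<kappa>_nonzero by (simp add: s_def field_simps)
  \<comment> \<open>\<open>G\<close> and \<open>r s F\<close> are the sum and the difference of
    \<open>r s \<xi>^r\<close> and \<open>r s \<eta>^r\<close>, which gives the integers
    \<open>G\<close> and \<open>r F\<close>.\<close>
  show ?thesis unfolding conj_pair_def
    by (rule exI[of _ G], rule exI[of _ "int r * F v"])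
       (simp add: G F_eq algebra_simps)
qed

text \<open>The sum of \<open>\<xi> v * \<eta> w\<close> and \<open>\<eta> v * \<xi> w\<close> is
  \<kappa> times the polarised quadratic form, their difference is \<open>j\<close> times a
  determinant, and \<open>j = \<kappa> s\<close>.\<close>

lemma conj_pair_bilinear: "conj_pair s (2 * \<xi> v * \<eta> w / \<kappa>) (2 * \<eta> v * \<xi> w / \<kappa>)"
proof -
  define p where "p = 2 * A * fst v * fst w + B * (fst v * snd w + snd v * fst w) + 2 * C * snd v * snd w"
  have "\<xi> v * \<eta> w + \<eta> v * \<xi> w = 2 * (\<alpha> * \<gamma>) * of_int (fst v * fst w) +
      (\<alpha> * \<delta> + \<beta> * \<gamma>) * of_int (fst v * snd w + snd v * fst w) + 2 * (\<beta> * \<delta>) * of_int (snd v * snd w)"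
    by (simp add: \<xi>_def \<eta>_def algebra_simps)
  also have "\<dots> = \<kappa> * of_int p" unfolding quad_coeffs by (simp add: p_def algebra_simps)
  finally have 1: "\<xi> v * \<eta> w + \<eta> v * \<xi> w = \<kappa> * of_int p" .
  have 2: "\<xi> v * \<eta> w - \<eta> v * \<xi> w = \<kappa> * (of_int (det v w) * s)"
    using det_eq[of v w] \<kappa>_nonzero by (simp add: s_def mult_ac)
  have "2 * \<xi> v * \<eta> w = \<kappa> * (of_int p + of_int (det v w) * s)"
    "2 * \<eta> v * \<xi> w = \<kappa> * (of_int p - of_int (det v w) * s)"
    using 1 2 by (simp_all add: algebra_simps)
  then show ?thesis unfolding conj_pair_def using \<kappa>_nonzero by auto
qed

text \<open>It measures how far the slope \<open>\<eta> w / \<xi> w\<close> is from the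
  approximation to \<omega> that the approximant of index \<open>n\<close> produces from
  \<open>v\<close>.\<close>

definition S :: "nat \<Rightarrow> int \<times> int \<Rightarrow> int \<times> int \<Rightarrow> complex" where
  "S n v w = \<xi> w * pade_form r n (\<xi> v) (\<eta> v) - \<eta> w * pade_form r n (\<eta> v) (\<xi> v)"

text \<open>After multiplication by \<open>(2 r s)^n * 2 / \<kappa>\<close>, the two halves of
  \<open>S\<close> are conjugate term by term. Their difference is therefore \<open>2 q s\<close>
  with an integer \<open>q\<close>, and \<open>2 s / (2 / \<kappa>) = j\<close>.\<close>

lemma S_lower:
  assumes "S n v w \<noteq> 0"
  shows "J \<le> cmod (S n v w) * (2 * real r * \<sigma>) ^ n"
proof -
  define t where "t = 2 * of_nat r * s"
  have "\<exists>c. \<forall>k\<in>{..n}. pade r n k = real_of_int (c k)"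
    by (rule bchoice) (use pade_Ints[of r _ n] r in \<open>auto elim!: Ints_cases\<close>)
  then obtain c :: "nat \<Rightarrow> int" where c: "\<And>k. k \<le> n \<Longrightarrow> pade r n k = real_of_int (c k)" by auto
  define f where "f k = of_int (c k) * ((t * \<xi> v ^ r) ^ k * (t * \<eta> v ^ r) ^ (n - k) * (2 * \<eta> v * \<xi> w / \<kappa>))" for k
  define g where "g k = of_int (c k) * ((t * \<eta> v ^ r) ^ k * (t * \<xi> v ^ r) ^ (n - k) * (2 * \<xi> v * \<eta> w / \<kappa>))" for k
  have swap: "conj_pair s x y \<Longrightarrow> conj_pair s y x" for x y
    unfolding conj_pair_def by (metis add_uminus_conv_diff diff_minus_eq_add mult_minus_left of_int_minus)
  have "conj_pair s (f k) (g k)" for k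
    unfolding f_def g_def
    by (intro conj_pair_mult[OF _ _ s_square] conj_pair_power[OF _ s_square] conj_pair_of_int
        conj_pair_power_r[folded t_def] conj_pair_bilinear swap[OF conj_pair_power_r[folded t_def]] swap[OF conj_pair_bilinear])
  then have "conj_pair s (\<Sum>k\<le>n. f k) (\<Sum>k\<le>n. g k)" by (intro conj_pair_sum)
  then obtain p q :: int where "(\<Sum>k\<le>n. f k) = of_int p + of_int q * s" "(\<Sum>k\<le>n. g k) = of_int p - of_int q * s"
    unfolding conj_pair_def by blast
  then have q: "(\<Sum>k\<le>n. f k) - (\<Sum>k\<le>n. g k) = 2 * of_int q * s" by simp
  have tn: "t ^ n = t ^ k * t ^ (n - k)" if "k \<le> n" for k using that by (simp flip: power_add)
  have pr: "x ^ (k * r) = (x ^ r) ^ k" for x :: complex and k by (simp add: power_mult mult.commute[of k r])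
  have fk: "f k = t ^ n * (2 / \<kappa>) * (\<xi> w * (of_real (pade r n k) * (\<xi> v ^ (k * r) * \<eta> v ^ ((n - k) * r + 1))))"
    and gk: "g k = t ^ n * (2 / \<kappa>) * (\<eta> w * (of_real (pade r n k) * (\<eta> v ^ (k * r) * \<xi> v ^ ((n - k) * r + 1))))"
    if "k \<le> n" for k
    unfolding f_def g_def tn[OF that] c[OF that] power_add pr power_mult_distrib by simp_all
  have "(\<Sum>k\<le>n. f k) = t ^ n * (2 / \<kappa>) * (\<xi> w * pade_form r n (\<xi> v) (\<eta> v))"
    "(\<Sum>k\<le>n. g k) = t ^ n * (2 / \<kappa>) * (\<eta> w * pade_form r n (\<eta> v) (\<xi> v))"
    unfolding pade_form_def sum_distrib_left by (intro sum.cong refl; use fk gk in simp)+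
  then have "t ^ n * (2 / \<kappa>) * S n v w = 2 * of_int q * s"
    using q by (simp add: S_def algebra_simps)
  then have eq: "t ^ n * S n v w = of_int q * j" using \<kappa>_nonzero by (simp add: s_def field_simps)
  then have "q \<noteq> 0" using assms s_nonzero r by (auto simp: t_def)
  then have "1 \<le> \<bar>real_of_int q\<bar>" by linarith
  then have "J \<le> cmod (of_int q * j)"
    unfolding J_def norm_mult by (simp add: mult_le_cancel_right1)
  also have "\<dots> = cmod (t ^ n * S n v w)" unfolding eq ..
  also have "\<dots> = cmod (S n v w) * (2 * real r * \<sigma>) ^ n"
    by (simp add: norm_mult norm_power \<sigma>_def t_def)
  finally show ?thesis .
qed

text \<open>The product of the conjugates \<open>2 r s \<xi>^r\<close> and
  \<open>2 r s \<eta>^r\<close> is an integer, and it is \<rho> times the \<open>r\<close>-th power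
  of a value of the quadratic form. Coprime values make \<rho> itself a nonzero integer, so
  \<open>\<bar>\<rho>\<bar> \<ge> 1\<close>, where
  \<open>\<bar>\<kappa>\<bar> = J / \<sigma>\<close>.\<close>

lemma \<sigma>_le: "\<sigma> ^ (r - 2) \<le> 4 * real r ^ 2 * J ^ r"
proof -
  define \<rho> where "\<rho> = 4 * of_nat r ^ 2 * of_int D * \<kappa> ^ r"
  have val: "\<rho> * of_int ((A * fst v ^ 2 + B * fst v * snd v + C * snd v ^ 2) ^ r) \<in> \<int>" for v
  proof -
    obtain p q :: int where pq: "2 * of_nat r * s * \<xi> v ^ r = of_int p + of_int q * s"
      "2 * of_nat r * s * \<eta> v ^ r = of_int p - of_int q * s"
      using conj_pair_power_r[of v] unfolding conj_pair_def by blast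
    have "\<xi> v * \<eta> v = \<kappa> * of_int (A * fst v ^ 2 + B * fst v * snd v + C * snd v ^ 2)"
      unfolding \<xi>_def \<eta>_def quad by simp
    then have "\<rho> * of_int ((A * fst v ^ 2 + B * fst v * snd v + C * snd v ^ 2) ^ r) =
        4 * of_nat r ^ 2 * of_int D * (\<xi> v * \<eta> v) ^ r"
      unfolding \<rho>_def by (simp add: power_mult_distrib)
    also have "\<dots> = (2 * of_nat r * s * \<xi> v ^ r) * (2 * of_nat r * s * \<eta> v ^ r)"
      unfolding s_square[symmetric] by (simp add: power2_eq_square power_mult_distrib)
    also have "\<dots> = of_int (p ^ 2) - of_int (q ^ 2) * s ^ 2"
      unfolding pq by (simp add: power2_eq_square algebra_simps)
    also have "\<dots> = of_int (p ^ 2 - q ^ 2 * D)" unfolding s_square by simp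
    finally show ?thesis by simp
  qed
  have "gcd (gcd (A ^ r) (C ^ r)) ((A + B + C) ^ r) = 1"
    using primitive by (simp add: gcd_exp)
  then obtain u v w where uvw: "u * A ^ r + v * C ^ r + w * (A + B + C) ^ r = 1"
  proof -
    obtain x y where 1: "x * A ^ r + y * C ^ r = gcd (A ^ r) (C ^ r)" using bezout_int by blast
    obtain x' y' where "x' * gcd (A ^ r) (C ^ r) + y' * (A + B + C) ^ r = 1"
      using bezout_int \<open>gcd (gcd (A ^ r) (C ^ r)) ((A + B + C) ^ r) = 1\<close> by metis
    then have "x' * x * A ^ r + x' * y * C ^ r + y' * (A + B + C) ^ r = 1"
      unfolding 1[symmetric] by (simp add: algebra_simps)
    then show ?thesis by (rule that)
  qed
  have "\<rho> = \<rho> * of_int (u * A ^ r + v * C ^ r + w * (A + B + C) ^ r)" by (simp add: uvw)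
  also have "\<dots> = of_int u * (\<rho> * of_int (A ^ r)) + of_int v * (\<rho> * of_int (C ^ r)) +
      of_int w * (\<rho> * of_int ((A + B + C) ^ r))" by (simp add: algebra_simps)
  also have "\<dots> \<in> \<int>"
  proof -
    have "\<rho> * of_int (A ^ r) \<in> \<int>" "\<rho> * of_int (C ^ r) \<in> \<int>" "\<rho> * of_int ((A + B + C) ^ r) \<in> \<int>"
      using val[of "(1, 0)"] val[of "(0, 1)"] val[of "(1, 1)"] by simp_all
    then show ?thesis by (intro Ints_add Ints_mult[OF Ints_of_int])
  qed
  finally obtain z where z: "\<rho> = of_int z" by (auto elim: Ints_cases)
  have "\<rho> \<noteq> 0" unfolding \<rho>_def using D_nonzero \<kappa>_nonzero r by auto
  then have "z \<noteq> 0" using z by auto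
  then have "1 \<le> \<bar>real_of_int z\<bar>" by linarith
  also have "\<dots> = cmod \<rho>" by (simp add: z)
  also have "\<dots> = 4 * real r ^ 2 * \<sigma> ^ 2 * cmod \<kappa> ^ r"
    by (simp add: \<rho>_def norm_mult norm_power \<sigma>_square)
  also have "cmod \<kappa> = J / \<sigma>"
    using s_nonzero \<kappa>_nonzero j_nonzero by (simp add: J_def \<sigma>_def s_def norm_divide)
  finally have "\<sigma> ^ r \<le> 4 * real r ^ 2 * \<sigma> ^ 2 * J ^ r"
    using \<sigma>_ge_1 by (simp add: power_divide field_simps)
  moreover have "\<sigma> ^ r = \<sigma> ^ (r - 2) * \<sigma> ^ 2"
    unfolding power_add[symmetric] using r by (intro arg_cong[of _ _ "power \<sigma>"]) simp
  ultimately have "\<sigma> ^ 2 * \<sigma> ^ (r - 2) \<le> \<sigma> ^ 2 * (4 * real r ^ 2 * J ^ r)" by (simp add: mult_ac)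
  then show ?thesis using \<sigma>_ge_1 by (subst (asm) mult_le_cancel_left_pos) auto
qed
end

subsection \<open>The discriminant\<close>

lemma prod_roots_unity:
  fixes z w :: complex
  assumes "n > 0"
  shows "z ^ n - w ^ n = (\<Prod>i<n. z - cis (2 * pi * real i / real n) * w)"
proof -
  let ?\<zeta> = "\<lambda>i. cis (2 * pi * real i / real n)"
  have inj: "inj_on ?\<zeta> {..<n}" and im: "?\<zeta> ` {..<n} = {z. z ^ n = 1}"
    using Complex.bij_betw_roots_unity[OF assms] by (auto simp: bij_betw_def)
  have mon: "degree (\<Prod>i<n. [:- ?\<zeta> i, 1:]) = n" "lead_coeff (\<Prod>i<n. [:- ?\<zeta> i, 1:]) = 1"
    by (subst degree_prod_eq_sum_degree) (auto simp: lead_coeff_prod)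
  have eq: "monom 1 n - 1 = (\<Prod>i<n. [:- ?\<zeta> i, 1:])"
  proof (rule poly_eqI_degree_lead_coeff)
    show "degree (monom 1 n - 1 :: complex poly) \<le> n"
      by (intro degree_diff_le degree_monom_le) auto
    show "degree (\<Prod>i<n. [:- ?\<zeta> i, 1:]) \<le> n" using mon by simp
    show "coeff (monom 1 n - 1) n = coeff (\<Prod>i<n. [:- ?\<zeta> i, 1:]) n"
      using mon assms by simp
    show "card ({z::complex. z ^ n = 1}) \<ge> n" unfolding im[symmetric] using inj by (simp add: card_image)
    fix z :: complex assume "z \<in> {z. z ^ n = 1}"
    then have z: "z ^ n = 1" "z \<in> ?\<zeta> ` {..<n}" using im by auto
    then show "poly (monom 1 n - 1) z = poly (\<Prod>i<n. [:- ?\<zeta> i, 1:]) z"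
      by (auto simp: poly_monom poly_prod prod_zero_iff)
  qed
  have eq': "x ^ n - 1 = (\<Prod>i<n. x - ?\<zeta> i)" for x
    using arg_cong[OF eq, of "\<lambda>p. poly p x"] by (simp add: poly_monom poly_prod)
  show ?thesis
  proof (cases "w = 0")
    case False
    have "z ^ n - w ^ n = w ^ n * ((z / w) ^ n - 1)"
      using False by (simp add: power_divide field_simps)
    also have "\<dots> = (\<Prod>i<n. w * (z / w - ?\<zeta> i))"
      unfolding eq' by (simp add: prod.distrib)
    also have "\<dots> = (\<Prod>i<n. z - ?\<zeta> i * w)"
      using False by (simp add: algebra_simps)
    finally show ?thesis .
  qed (use assms in simp)
qed

text \<open>The product is the derivative \<open>n x^(n-1)\<close> of \<open>x^n - 1\<close> at a
  root of unity.\<close>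

lemma prod_roots_unity_diff:
  assumes "j < n"
  shows "cmod (\<Prod>i\<in>{..<n} - {j}. cis (2 * pi * real j / real n) - cis (2 * pi * real i / real n)) = real n"
proof -
  let ?\<zeta> = "\<lambda>i. cis (2 * pi * real i / real n)"
  have n: "n > 0" using assms by simp
  have "poly (monom 1 n - 1) x = poly ([:- ?\<zeta> j, 1:] * (\<Prod>i\<in>{..<n} - {j}. [:- ?\<zeta> i, 1:])) x" for x
  proof -
    have "(\<Prod>i<n. x - ?\<zeta> i * 1) = (x - ?\<zeta> j) * (\<Prod>i\<in>{..<n} - {j}. x - ?\<zeta> i)"
      using assms by (subst prod.remove[of _ j]) auto
    then show ?thesis using prod_roots_unity[OF n, of x 1] by (simp add: poly_monom poly_prod algebra_simps)
  qed
  then have eq: "monom 1 n - 1 = [:- ?\<zeta> j, 1:] * (\<Prod>i\<in>{..<n} - {j}. [:- ?\<zeta> i, 1:])"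
    by (intro poly_eq_poly_eq_iff[THEN iffD1] ext)
  have "poly (pderiv (monom 1 n - 1)) (?\<zeta> j) = (\<Prod>i\<in>{..<n} - {j}. ?\<zeta> j - ?\<zeta> i)"
    unfolding eq pderiv_mult by (simp add: poly_prod pderiv_pCons)
  moreover have "poly (pderiv (monom 1 n - 1)) (?\<zeta> j) = of_nat n * ?\<zeta> j ^ (n - 1)"
    by (simp add: pderiv_diff pderiv_monom poly_monom)
  ultimately show ?thesis by (metis norm_cis norm_mult norm_of_nat norm_power power_one mult.right_neutral)
qed

lemma prod_pairs_sym:
  fixes f :: "nat \<Rightarrow> nat \<Rightarrow> real"
  assumes "\<And>i j. f i j = f j i"
  shows "(\<Prod>j<n. \<Prod>i<j. f i j ^ 2) = (\<Prod>j<n. \<Prod>i\<in>{..<n} - {j}. f j i)"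
proof (induction n)
  case (Suc n)
  have "(\<Prod>i\<in>{..<Suc n} - {j}. f j i) = f j n * (\<Prod>i\<in>{..<n} - {j}. f j i)" if "j < n" for j
  proof -
    have "{..<Suc n} - {j} = insert n ({..<n} - {j})" using that by auto
    then show ?thesis by simp
  qed
  then have "(\<Prod>j<n. \<Prod>i\<in>{..<Suc n} - {j}. f j i) = (\<Prod>j<n. f j n) * (\<Prod>j<n. \<Prod>i\<in>{..<n} - {j}. f j i)"
    by (simp add: prod.distrib)
  moreover have "{..<Suc n} - {n} = {..<n}" by auto
  moreover have "(\<Prod>i<n. f n i) = (\<Prod>i<n. f i n)" using assms by simp
  ultimately show ?case
    using Suc by (simp add: prod_power_distrib power2_eq_square prod.distrib)
qed simp

context diag_form
begin

text \<open>The linear factors are \<open>\<xi> - \<zeta> \<eta>\<close> for the roots of unity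
  \<zeta>, and two of them have determinant \<open>j\<close> times the difference of their \<zeta>,
  up to sign.\<close>

lemma norm_form_disc: "cmod (form_disc r a) = real r ^ r * J ^ (r * (r - 1))"
proof -
  let ?\<zeta> = "\<lambda>i. cis (2 * pi * real i / real r)"
  define p where "p i = \<alpha> - ?\<zeta> i * \<gamma>" for i
  define q where "q i = ?\<zeta> i * \<delta> - \<beta>" for i
  have r0: "r > 0" using r by simp
  have "form_disc r a = (\<Prod>j<r. \<Prod>i<j. (p i * q j - p j * q i)\<^sup>2)"
  proof (rule form_disc_eqI)
    fix x y :: complex
    show "form_eval r a x y = (\<Prod>i<r. p i * x - q i * y)"
      unfolding form_eval_diag prod_roots_unity[OF r0] p_def q_def
      by (intro prod.cong refl) (simp add: algebra_simps)
  qed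
  also have "cmod \<dots> = (\<Prod>j<r. \<Prod>i<j. (J * cmod (?\<zeta> i - ?\<zeta> j)) ^ 2)"
  proof -
    have "p i * q k - p k * q i = - j * (?\<zeta> i - ?\<zeta> k)" for i k
      unfolding p_def q_def j_def by (simp add: algebra_simps)
    then show ?thesis unfolding prod_norm[symmetric] norm_power by (simp add: norm_mult J_def)
  qed
  also have "\<dots> = (\<Prod>j<r. \<Prod>i\<in>{..<r} - {j}. J * cmod (?\<zeta> j - ?\<zeta> i))"
    by (rule prod_pairs_sym) (simp add: norm_minus_commute)
  also have "\<dots> = (\<Prod>j<r. J ^ (r - 1) * real r)"
  proof (intro prod.cong refl)
    fix j assume j: "j \<in> {..<r}"
    then show "(\<Prod>i\<in>{..<r} - {j}. J * cmod (?\<zeta> j - ?\<zeta> i)) = J ^ (r - 1) * real r"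
      using prod_roots_unity_diff[of j r] by (simp add: prod.distrib prod_norm)
  qed
  finally show ?thesis by (simp add: power_mult_distrib power_mult[symmetric] mult.commute)
qed

end

subsection \<open>The inequalities between the parameters\<close>

lemmas power_expand = power_mult_distrib power_mult[symmetric] power_add add_mult_distrib
  add_mult_distrib2 mult_ac

text \<open>Supplies the two inequalities \<open>B\<close> and \<open>A\<close> of
  \<open>no_far_pair\<close>, with \<open>H = h\<close>, \<open>X = Z v ^ r\<close> and
  \<open>\<Phi>\<close> the bound reached after the gaps. Fractional exponents are avoided by
  comparing suitable powers of both sides.\<close>

lemma size_conditions:
  fixes r :: nat and J H \<sigma> X \<Phi> \<Psi> :: real
  assumes r: "r \<ge> 5" and J: "J \<ge> 1" and H: "H > 0" "H ^ 2 \<le> J ^ r"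
    and \<sigma>: "\<sigma> \<ge> 1" "\<sigma> ^ (r - 2) \<le> 4 * real r ^ 2 * J ^ r"
    and \<Psi>: "\<Psi> > 0" "J ^ (r * (r + 2)) \<le> \<Psi> ^ 4"
    and \<Phi>: "real r ^ (6 * (r - 1)) * \<Psi> \<le> \<Phi>"
    and X: "X > 0" "(8 * H * \<Phi>) ^ r \<le> (real r * J) ^ r * X ^ (r - 2)"
  defines "G \<equiv> 216 * real r ^ 3 * \<sigma>"
  shows "G ^ r * H ^ (2 * (r - 1)) \<le> X ^ (r - 2)"
    and "16 * 24 ^ (r - 1) * H ^ r * G ^ 2 < real r * J ^ r * X ^ (r - 4)"
proof -
  obtain p where p: "r = p + 5" using r by (metis add.commute le_Suc_ex)
  have r2: "r - 2 = p + 3" and r4: "r - 4 = p + 1" and r1: "r - 1 = p + 4" using p by simp_all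
  define R where "R = real r"
  have R5: "R \<ge> 5" using r by (simp add: R_def)
  then have R1: "R \<ge> 1" by simp
  have \<Phi>0: "\<Phi> > 0" using \<Phi> \<Psi>(1) R5 unfolding R_def[symmetric]
    by (smt (verit) mult_pos_pos zero_less_power)
  have G0: "G \<ge> 1"
  proof -
    have "1 \<le> R ^ 3" using R1 by simp
    then have "1 \<le> 216 * R ^ 3" by linarith
    then have "1 * 1 \<le> (216 * R ^ 3) * \<sigma>" using \<sigma>(1) R1 by (intro mult_mono) auto
    then show ?thesis by (simp add: G_def R_def)
  qed
  have mono: "R ^ a \<le> R ^ b" if "a \<le> b" for a b using that R1 by (rule power_increasing)
  have monoJ: "J ^ a \<le> J ^ b" if "a \<le> b" for a b using that J by (rule power_increasing)
  have G: "G ^ (r - 2) \<le> R ^ (7 * (r - 2) + 3) * J ^ r"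
  proof -
    have "216 * R ^ 3 \<le> R ^ 4 * R ^ 3"
    proof (rule mult_right_mono)
      have "(5::real) ^ 4 \<le> R ^ 4" using R5 by (intro power_mono) auto
      then show "216 \<le> R ^ 4" by simp
    qed (use R1 in simp)
    then have "(216 * R ^ 3) ^ (r - 2) \<le> (R ^ 7) ^ (r - 2)"
      using R1 by (intro power_mono) (auto simp flip: power_add)
    moreover
    have "4 * R ^ 2 * J ^ r \<le> R ^ 3 * J ^ r"
      using R5 J by (intro mult_right_mono) (auto simp: power2_eq_square power3_eq_cube)
    then have "\<sigma> ^ (r - 2) \<le> R ^ 3 * J ^ r" using \<sigma>(2) unfolding R_def by linarith
    ultimately have "(216 * R ^ 3) ^ (r - 2) * \<sigma> ^ (r - 2) \<le> (R ^ 7) ^ (r - 2) * (R ^ 3 * J ^ r)"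
      using \<sigma>(1) R1 J by (intro mult_mono) auto
    then show ?thesis unfolding G_def R_def[symmetric] by (simp add: power_mult_distrib power_add power_mult mult_ac)
  qed
  \<comment> \<open>\<open>J^(r (r+2)) \<le> \<Psi>^4\<close> raised to the power \<open>c\<close>,
    followed by a square root; \<open>2 c\<close> is the exponent wanted for
    \<open>\<Psi>\<close>.\<close>
  have \<Psi>J: "J ^ b \<le> \<Psi> ^ a" if "2 * b \<le> r * (r + 2) * c" "a = 2 * c" for a b c
  proof (rule power_le_imp_le_base[of _ 1])
    have "(J ^ b) ^ 2 \<le> (J ^ (r * (r + 2))) ^ c"
      unfolding power_mult[symmetric] using that(1) by (intro monoJ) simp
    also have "\<dots> \<le> (\<Psi> ^ 4) ^ c" using \<Psi> J by (intro power_mono) auto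
    also have "\<dots> = (\<Psi> ^ a) ^ 2" unfolding that(2) by (simp flip: power_mult add: mult_ac)
    finally have "J ^ b \<le> \<Psi> ^ a" by (rule power2_le_imp_le) (use \<Psi> in auto)
    then show "(J ^ b) ^ Suc 1 \<le> (\<Psi> ^ a) ^ Suc 1" using J by (intro power_mono) auto
  qed (use \<Psi> in auto)
  have \<Phi>p: "R ^ (6 * (r - 1) * a) * \<Psi> ^ a \<le> \<Phi> ^ a" for a
  proof -
    have "(R ^ (6 * (r - 1)) * \<Psi>) ^ a \<le> \<Phi> ^ a"
      using \<Phi> \<Psi>(1) R1 unfolding R_def[symmetric] by (intro power_mono) auto
    then show ?thesis by (simp add: power_mult_distrib power_mult)
  qed
  \<comment> \<open>\<open>G\<close> contains \<sigma>, which is controlled only through its power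
    \<open>r - 2\<close>.\<close>
  have "(G ^ 2 * R ^ 2 * J ^ r) ^ (r - 2) \<le> ((8 * \<Phi>) ^ 2) ^ (r - 2)"
  proof -
    have "(G ^ 2 * R ^ 2 * J ^ r) ^ (r - 2) = (G ^ (r - 2)) ^ 2 * R ^ (2 * (r - 2)) * J ^ (r * (r - 2))"
      by (simp only: power_expand)
    also have "\<dots> \<le> (R ^ (7 * (r - 2) + 3) * J ^ r) ^ 2 * R ^ (2 * (r - 2)) * J ^ (r * (r - 2))"
      using G G0 R1 J by (intro mult_right_mono power_mono) auto
    also have "\<dots> = R ^ (2 * (7 * (r - 2) + 3) + 2 * (r - 2)) * J ^ (2 * r + r * (r - 2))"
      by (simp only: power_expand)
    also have "\<dots> \<le> R ^ (6 * (r - 1) * (2 * (r - 2))) * \<Psi> ^ (2 * (r - 2))"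
    proof (intro mult_mono)
      have "2 * (7 * (p + 3) + 3) + 2 * (p + 3) \<le> 6 * (p + 4) * (2 * (p + 3))"
        by (simp add: algebra_simps)
      then show "R ^ (2 * (7 * (r - 2) + 3) + 2 * (r - 2)) \<le> R ^ (6 * (r - 1) * (2 * (r - 2)))"
        unfolding r1 r2 by (rule mono)
      have "2 * (2 * (p + 5) + (p + 5) * (p + 3)) \<le> (p + 5) * (p + 5 + 2) * (p + 3)"
        by (simp add: algebra_simps)
      then show "J ^ (2 * r + r * (r - 2)) \<le> \<Psi> ^ (2 * (r - 2))"
        unfolding r2 by (intro \<Psi>J[where c = "p + 3"]) (simp_all add: p)
    qed (use R1 J in auto)
    also have "\<dots> \<le> \<Phi> ^ (2 * (r - 2))" by (rule \<Phi>p)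
    also have "\<dots> \<le> (8 * \<Phi>) ^ (2 * (r - 2))" using \<Phi>0 by (intro power_mono) auto
    finally show ?thesis by (simp only: power_mult)
  qed
  then have i: "G ^ 2 * R ^ 2 * J ^ r \<le> (8 * \<Phi>) ^ 2"
    using power_mono_iff[of "G ^ 2 * R ^ 2 * J ^ r" "(8 * \<Phi>) ^ 2" "r - 2"] J r by simp
  have ii: "(G * (R * J)) ^ (2 * r) * J ^ (r * (r - 2)) \<le> (8 * \<Phi>) ^ (2 * r)"
  proof -
    have "J ^ r = J ^ 2 * J ^ (r - 2)" unfolding power_add[symmetric] r2 by (simp add: p add.commute)
    then have "(G * (R * J)) ^ (2 * r) * J ^ (r * (r - 2)) = (G ^ 2 * R ^ 2 * J ^ r) ^ r"
      by (simp only: power_expand)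
    also have "\<dots> \<le> ((8 * \<Phi>) ^ 2) ^ r" using i G0 R1 J by (intro power_mono) auto
    finally show ?thesis by (simp add: power_mult)
  qed
  \<comment> \<open>The factor \<open>(R J)^r\<close> prepares for \<open>X(2)\<close>. The square
    lets \<open>H\<close> be split: \<open>H^(2 r)\<close> stays with \<open>\<Phi>\<close>, and the
    rest is a power of \<open>H^2 \<le> J^r\<close>.\<close>
  have "(G ^ r * H ^ (2 * (r - 1)) * (R * J) ^ r) ^ 2 = (G * (R * J)) ^ (2 * r) * H ^ (2 * r) * (H ^ 2) ^ (r - 2)"
  proof -
    have "H ^ (2 * (2 * (r - 1))) = H ^ (2 * r) * (H ^ 2) ^ (r - 2)"
      unfolding power_mult[symmetric] power_add[symmetric] r1 r2 by (simp add: p algebra_simps)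
    then show ?thesis by (simp only: power_expand)
  qed
  also have "\<dots> \<le> (G * (R * J)) ^ (2 * r) * H ^ (2 * r) * (J ^ r) ^ (r - 2)"
    using H G0 R1 J by (intro mult_left_mono power_mono) auto
  also have "\<dots> = ((G * (R * J)) ^ (2 * r) * J ^ (r * (r - 2))) * H ^ (2 * r)"
    by (simp only: power_expand)
  also have "\<dots> \<le> (8 * \<Phi>) ^ (2 * r) * H ^ (2 * r)" using ii H by (intro mult_right_mono) auto
  also have "\<dots> = ((8 * H * \<Phi>) ^ r) ^ 2" by (simp only: power_expand)
  also have "\<dots> \<le> ((R * J) ^ r * X ^ (r - 2)) ^ 2"
    using X(2) H \<Phi>0 unfolding R_def by (intro power_mono) auto
  finally have "G ^ r * H ^ (2 * (r - 1)) * (R * J) ^ r \<le> (R * J) ^ r * X ^ (r - 2)"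
    by (rule power2_le_imp_le) (use R1 J X in auto)
  then show "G ^ r * H ^ (2 * (r - 1)) \<le> X ^ (r - 2)"
    using R1 J by (simp add: mult.commute[of "(R * J) ^ r"])
  define L where "L = 16 * 24 ^ (r - 1) * H ^ r * G ^ 2"
  have L0: "L > 0" using H G0 by (simp add: L_def)
  have L: "L \<le> R ^ (2 * r) * H ^ r * G ^ 2"
  proof -
    have "(16::real) * 24 ^ (r - 1) \<le> 25 * 25 ^ (r - 1)" by (intro mult_mono power_mono) auto
    also have "\<dots> = (5 ^ 2) ^ r" using r by (simp add: power_eq_if[of _ r])
    also have "\<dots> \<le> (R ^ 2) ^ r" using R5 by (intro power_mono) auto
    finally show ?thesis unfolding L_def using H by (intro mult_right_mono) (auto simp: power_mult)
  qed
  \<comment> \<open>\<open>X(2)\<close> bounds only \<open>X^(r-2)\<close>. The power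
    \<open>2 (r-2)\<close> turns \<open>X^(r-4)\<close> into a power of it, and
    \<open>(R J)^(2 r (r-4))\<close> is the factor that accompanies it there.\<close>
  have "L ^ (2 * (r - 2)) * (R * J) ^ (2 * r * (r - 4)) \<le>
      (R ^ (2 * r) * H ^ r * G ^ 2) ^ (2 * (r - 2)) * (R * J) ^ (2 * r * (r - 4))"
    using L L0 R1 J by (intro mult_right_mono power_mono) auto
  also have "\<dots> = R ^ (2 * 2 * r * (r - 2) + 2 * r * (r - 4)) * (H ^ (2 * r * (r - 4)) * (H ^ 2) ^ (2 * r)) *
      (G ^ (r - 2)) ^ (2 * 2) * J ^ (2 * r * (r - 4))"
  proof -
    have "2 * r * (r - 2) = 2 * r * (r - 4) + 2 * (2 * r)" by (simp add: p algebra_simps)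
    then have "H ^ (r * (2 * (r - 2))) = H ^ (2 * r * (r - 4)) * (H ^ 2) ^ (2 * r)"
      unfolding power_mult[symmetric] power_add[symmetric] by (simp add: mult_ac)
    then show ?thesis by (simp only: power_expand)
  qed
  also have "\<dots> \<le> R ^ (2 * 2 * r * (r - 2) + 2 * r * (r - 4)) * (H ^ (2 * r * (r - 4)) * (J ^ r) ^ (2 * r)) *
      (R ^ (7 * (r - 2) + 3) * J ^ r) ^ (2 * 2) * J ^ (2 * r * (r - 4))"
    using H G G0 R1 J by (intro mult_right_mono mult_mono mult_left_mono power_mono order_refl) auto
  also have "\<dots> = R ^ (2 * 2 * r * (r - 2) + 2 * r * (r - 4) + 2 * 2 * (7 * (r - 2) + 3)) *
      (J ^ (2 * r * r + 2 * 2 * r + 2 * r * (r - 4)) * H ^ (2 * r * (r - 4)))"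
    by (simp only: power_expand)
  also have "\<dots> \<le> R ^ (6 * (r - 1) * (2 * r * (r - 4))) *
      (J ^ (2 * r * r + 2 * 2 * r + 2 * r * (r - 4)) * H ^ (2 * r * (r - 4)))"
  proof (rule mult_right_mono)
    have "2 * 2 * (p + 5) * (p + 3) + 2 * (p + 5) * (p + 1) + 2 * 2 * (7 * (p + 3) + 3) \<le>
        6 * (p + 4) * (2 * (p + 5) * (p + 1))"
      by (simp add: algebra_simps)
    then show "R ^ (2 * 2 * r * (r - 2) + 2 * r * (r - 4) + 2 * 2 * (7 * (r - 2) + 3)) \<le>
        R ^ (6 * (r - 1) * (2 * r * (r - 4)))"
      unfolding r1 r2 r4 unfolding p by (rule mono)
  qed (use H J in simp)
  \<comment> \<open>The first factor is kept for the target \<open>(J^r)^(2 (r-2))\<close>; the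
    second is absorbed by \<open>\<Psi>\<close>.\<close>
  also have "J ^ (2 * r * r + 2 * 2 * r + 2 * r * (r - 4)) = J ^ (2 * r * (r - 2)) * J ^ (2 * r * r)"
    unfolding power_add[symmetric] r2 r4 by (simp add: p algebra_simps)
  also have "R ^ (6 * (r - 1) * (2 * r * (r - 4))) * (J ^ (2 * r * (r - 2)) * J ^ (2 * r * r) * H ^ (2 * r * (r - 4))) \<le>
     R ^ (6 * (r - 1) * (2 * r * (r - 4))) * (J ^ (2 * r * (r - 2)) * \<Psi> ^ (2 * r * (r - 4)) * H ^ (2 * r * (r - 4)))"
  proof -
    have "2 * (2 * (p + 5) * (p + 5)) \<le> (p + 5) * (p + 5 + 2) * ((p + 5) * (p + 1))"
      by (simp add: algebra_simps)
    then have "J ^ (2 * r * r) \<le> \<Psi> ^ (2 * r * (r - 4))"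
      unfolding r4 by (intro \<Psi>J[where c = "r * (p + 1)"]) (simp_all add: p)
    then show ?thesis using R1 J H by (intro mult_left_mono mult_right_mono) auto
  qed
  also have "\<dots> = J ^ (2 * r * (r - 2)) * (R ^ (6 * (r - 1) * (2 * r * (r - 4))) * \<Psi> ^ (2 * r * (r - 4))) * H ^ (2 * r * (r - 4))"
    by (simp only: mult_ac)
  also have "\<dots> \<le> J ^ (2 * r * (r - 2)) * \<Phi> ^ (2 * r * (r - 4)) * H ^ (2 * r * (r - 4))"
    using J H by (intro mult_left_mono mult_right_mono \<Phi>p) auto
  also have "\<dots> < J ^ (2 * r * (r - 2)) * (8 * \<Phi>) ^ (2 * r * (r - 4)) * H ^ (2 * r * (r - 4))"
    using J H \<Phi>0 unfolding r4 by (intro mult_strict_right_mono mult_strict_left_mono power_strict_mono) (auto simp: p)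
  also have "\<dots> = J ^ (2 * r * (r - 2)) * ((8 * H * \<Phi>) ^ r) ^ (2 * (r - 4))"
    by (simp only: power_expand)
  also have "\<dots> \<le> J ^ (2 * r * (r - 2)) * ((R * J) ^ r * X ^ (r - 2)) ^ (2 * (r - 4))"
    using X(2) H \<Phi>0 J unfolding R_def by (intro mult_left_mono power_mono) auto
  also have "\<dots> = (J ^ r * X ^ (r - 4)) ^ (2 * (r - 2)) * (R * J) ^ (2 * r * (r - 4))"
    by (simp only: power_expand)
  finally have "L ^ (2 * (r - 2)) < (J ^ r * X ^ (r - 4)) ^ (2 * (r - 2))"
    using R1 J by (simp add: mult_less_cancel_right)
  then have "L < J ^ r * X ^ (r - 4)"
    by (rule power_less_imp_less_base) (use J X in auto)
  also have "\<dots> \<le> R * (J ^ r * X ^ (r - 4))"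
    using mult_right_mono[OF R1, of "J ^ r * X ^ (r - 4)"] J X by simp
  finally show "16 * 24 ^ (r - 1) * H ^ r * G ^ 2 < real r * J ^ r * X ^ (r - 4)"
    by (simp add: L_def R_def mult.assoc)
qed

subsection \<open>Solutions near a root of unity\<close>

text \<open>\<open>l\<close> is the principal logarithm of \<open>(y / x)^r\<close> divided by
  \<open>r\<close>, and \<omega> is what remains of \<open>y / x\<close>. The principal branch is
  real on the positive reals, which gives the last clause; it is used for
  \<open>D > 0\<close>.\<close>

lemma nearby_root_of_unity_aux:
  fixes x y :: complex
  assumes "r > 0" "x \<noteq> 0" "2 * cmod (x ^ r - y ^ r) < cmod x ^ r"
  obtains \<omega> l where "\<omega> ^ r = 1" "y = \<omega> * x * exp l"
    "real r * cmod l \<le> 2 * (cmod (x ^ r - y ^ r) / cmod x ^ r)" "(y / x) ^ r \<in> \<real> \<longrightarrow> l \<in> \<real>"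
proof -
  define w where "w = (y / x) ^ r - 1"
  have w: "cmod w = cmod (x ^ r - y ^ r) / cmod x ^ r"
  proof -
    have "w = - ((x ^ r - y ^ r) / x ^ r)" using assms by (simp add: w_def power_divide field_simps)
    then show ?thesis by (simp add: norm_divide norm_power)
  qed
  have w2: "cmod w < 1 / 2" unfolding w using assms by (simp add: divide_simps)
  have w1: "1 + w \<noteq> 0"
  proof
    assume "1 + w = 0"
    then have "w = -1" by (simp add: add_eq_0_iff)
    then show False using w2 by simp
  qed
  define l where "l = Ln (1 + w) / of_nat r"
  have el: "exp l ^ r = 1 + w"
  proof -
    have "exp l ^ r = exp (of_nat r * l)" by (simp add: exp_of_nat_mult)
    then show ?thesis using assms(1) w1 by (simp add: l_def)
  qed
  show thesis
  proof (rule that[of "y / x / exp l" l])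
    show "(y / x / exp l) ^ r = 1" unfolding power_divide[of _ "exp l"] el
      using w1 by (simp add: w_def)
    show "y = y / x / exp l * x * exp l" using assms by simp
    have "real r * cmod l = cmod (Ln (1 + w))" using assms(1) by (simp add: l_def norm_divide)
    then show "real r * cmod l \<le> 2 * (cmod (x ^ r - y ^ r) / cmod x ^ r)"
      using norm_Ln_le[OF w2] w by simp
    show "(y / x) ^ r \<in> \<real> \<longrightarrow> l \<in> \<real>"
    proof
      assume "(y / x) ^ r \<in> \<real>"
      then obtain t where t: "1 + w = complex_of_real t" by (auto simp: w_def elim: Reals_cases)
      have "\<bar>Re w\<bar> \<le> cmod w" by (rule abs_Re_le_cmod)
      then have "Re (1 + w) > 0" using w2 by simp
      then have "t > 0" using t by simp
      then have "Ln (1 + w) = of_real (ln t)" unfolding t by (simp add: Ln_of_real)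
      then show "l \<in> \<real>" by (simp add: l_def)
    qed
  qed
qed

lemma nearby_root_of_unity:
  fixes x y :: complex
  assumes "r > 0" "cmod (x ^ r - y ^ r) \<le> h" "2 * h < max (cmod x) (cmod y) ^ r"
  obtains \<omega> l where "x \<noteq> 0" "y \<noteq> 0" "\<omega> ^ r = 1" "y = \<omega> * x * exp l"
    "real r * cmod l \<le> 2 * (h / max (cmod x) (cmod y) ^ r)" "(y / x) ^ r \<in> \<real> \<longrightarrow> l \<in> \<real>"
proof (cases "cmod y \<le> cmod x")
  case True
  then have m: "max (cmod x) (cmod y) = cmod x" by simp
  have h0: "h \<ge> 0" using assms(2) norm_ge_zero order.trans by blast
  then have x: "x \<noteq> 0" using assms unfolding m by (auto simp: power_0_left)
  have less: "2 * cmod (x ^ r - y ^ r) < cmod x ^ r" using assms unfolding m by linarith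
  obtain \<omega> l where *: "\<omega> ^ r = 1" "y = \<omega> * x * exp l"
    "real r * cmod l \<le> 2 * (cmod (x ^ r - y ^ r) / cmod x ^ r)" "(y / x) ^ r \<in> \<real> \<longrightarrow> l \<in> \<real>"
    using nearby_root_of_unity_aux[OF assms(1) x less] .
  have "\<omega> \<noteq> 0" using *(1) assms(1) by (auto simp: power_0_left)
  moreover have "real r * cmod l \<le> 2 * (h / cmod x ^ r)"
    using *(3) divide_right_mono[OF assms(2), of "cmod x ^ r"] by simp
  ultimately show thesis using that[OF x _ *(1,2) _ *(4)] x *(2) m by auto
next
  case False
  then have m: "max (cmod x) (cmod y) = cmod y" by simp
  have y: "y \<noteq> 0" using False by auto
  have less: "2 * cmod (y ^ r - x ^ r) < cmod y ^ r"
    using assms unfolding m by (subst norm_minus_commute) linarith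
  obtain \<omega> l where *: "\<omega> ^ r = 1" "x = \<omega> * y * exp l"
    "real r * cmod l \<le> 2 * (cmod (y ^ r - x ^ r) / cmod y ^ r)" "(x / y) ^ r \<in> \<real> \<longrightarrow> l \<in> \<real>"
    using nearby_root_of_unity_aux[OF assms(1) y less] .
  have w0: "\<omega> \<noteq> 0" using *(1) assms(1) by (auto simp: power_0_left)
  show thesis
  proof (rule that[of "1 / \<omega>" "- l"])
    show "x \<noteq> 0" using *(2) y w0 by simp
    show "y \<noteq> 0" by (rule y)
    show "(1 / \<omega>) ^ r = 1" using *(1) by (simp add: power_divide)
    have "1 / \<omega> * x * exp (- l) = (\<omega> / \<omega>) * y * (exp l * exp (- l))" by (simp add: *(2))
    also have "\<dots> = y" using w0 by (simp flip: exp_add)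
    finally show "y = 1 / \<omega> * x * exp (- l)" ..
    show "real r * cmod (- l) \<le> 2 * (h / max (cmod x) (cmod y) ^ r)"
      using *(3) divide_right_mono[OF assms(2), of "cmod y ^ r"] unfolding m
      by (simp add: norm_minus_commute)
    show "(y / x) ^ r \<in> \<real> \<longrightarrow> - l \<in> \<real>"
    proof
      assume "(y / x) ^ r \<in> \<real>"
      then have "inverse ((y / x) ^ r) \<in> \<real>" by (rule Reals_inverse)
      then have "(x / y) ^ r \<in> \<real>" by (simp add: power_divide)
      then show "- l \<in> \<real>" using *(4) by simp
    qed
  qed
qed

context diag_form
begin

definition Z :: "int \<times> int \<Rightarrow> real" where "Z v = max (cmod (\<xi> v)) (cmod (\<eta> v))"

text \<open>The logarithm \<open>l\<close> is kept because the Pade remainder is estimated in terms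
  of it; its reality decides how many \<omega> occur when \<open>D > 0\<close>.\<close>

definition near :: "real \<Rightarrow> complex \<Rightarrow> int \<times> int \<Rightarrow> bool" where
  "near h \<omega> v \<longleftrightarrow> \<omega> ^ r = 1 \<and> Z v > 0 \<and> (\<exists>l. \<eta> v = \<omega> * \<xi> v * exp l \<and> real r * cmod l \<le> 2 * (h / Z v ^ r) \<and>
       ((\<eta> v / \<xi> v) ^ r \<in> \<real> \<longrightarrow> l \<in> \<real>))"

lemma norm_xi_eta_le: "cmod (\<xi> v) \<le> Z v" "cmod (\<eta> v) \<le> Z v"
  by (simp_all add: Z_def)

lemma J_le_norm_det:
  assumes "det v w \<noteq> 0"
  shows "J \<le> cmod (\<xi> v * \<eta> w - \<xi> w * \<eta> v)"
proof -
  have "1 \<le> \<bar>real_of_int (det v w)\<bar>" using assms by linarith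
  then show ?thesis unfolding det_eq norm_mult J_def
    by (simp add: mult_le_cancel_left1 flip: of_int_abs)
qed

lemma near_diff_le:
  assumes "near h \<omega> v" "2 * h \<le> Z v ^ r"
  shows "cmod (\<eta> v - \<omega> * \<xi> v) \<le> 4 * h / (real r * Z v ^ (r - 1))"
proof -
  obtain l where l: "\<omega> ^ r = 1" "Z v > 0" "\<eta> v = \<omega> * \<xi> v * exp l" "real r * cmod l \<le> 2 * (h / Z v ^ r)"
    using assms(1) unfolding near_def by blast
  have "cmod \<omega> ^ r = 1 ^ r" using l(1) by (simp flip: norm_power)
  then have w: "cmod \<omega> = 1" using r by (intro power_eq_imp_eq_base[of "cmod \<omega>" r 1]) auto
  have "real r * cmod l \<le> 1"
  proof -
    have "2 * (h / Z v ^ r) \<le> 1" using assms(2) l(2) by (simp add: divide_simps)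
    then show ?thesis using l(4) by linarith
  qed
  moreover have "2 * cmod l \<le> real r * cmod l" using r by (intro mult_right_mono) auto
  ultimately have "cmod l \<le> 1 / 2" by simp
  then have "exp (cmod l) \<le> 2" using exp_bound_half[of "cmod l"] by simp
  then have "exp (cmod l) * cmod l \<le> 2 * cmod l" by (intro mult_right_mono) auto
  then have "cmod (exp l - 1) \<le> 2 * cmod l" using Taylor_exp_field[of l 0] by simp
  moreover have "\<eta> v - \<omega> * \<xi> v = \<omega> * \<xi> v * (exp l - 1)" by (simp add: l(3) algebra_simps)
  ultimately have "cmod (\<eta> v - \<omega> * \<xi> v) \<le> Z v * (2 * cmod l)"
    using norm_xi_eta_le(1)[of v] w l(2) by (simp add: norm_mult mult_mono)
  also have "\<dots> \<le> Z v * (2 * (2 * (h / Z v ^ r) / real r))"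
    using l(2,4) r by (intro mult_left_mono) (auto simp: field_simps)
  also have "\<dots> = 4 * h / (real r * Z v ^ (r - 1))"
    using l(2) r by (simp add: power_eq_if[of _ r] field_simps)
  finally show ?thesis .
qed

lemma gap:
  assumes near: "near h \<omega> v" "near h \<omega> w" and d: "det v w \<noteq> 0" and Z: "Z v \<le> Z w"
    and h: "h > 0" "2 * h \<le> Z v ^ r"
  shows "real r * J * Z v ^ (r - 1) \<le> 8 * h * Z w"
proof -
  have Zv: "Z v > 0" using near unfolding near_def by blast
  then have Zw: "Z w > 0" using Z by simp
  have pw: "Z v ^ k \<le> Z w ^ k" for k using Z Zv by (intro power_mono) auto
  have h2: "2 * h \<le> Z w ^ r" using h(2) pw[of r] by simp
  \<comment> \<open>Both slopes are close to the same \<omega>, so the main terms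
    \<open>\<omega> * \<xi> v * \<xi> w\<close> cancel and only the two errors remain.\<close>
  have "\<xi> v * \<eta> w - \<xi> w * \<eta> v = \<xi> v * (\<eta> w - \<omega> * \<xi> w) - \<xi> w * (\<eta> v - \<omega> * \<xi> v)"
    by (simp add: algebra_simps)
  then have "J \<le> cmod (\<xi> v * (\<eta> w - \<omega> * \<xi> w) - \<xi> w * (\<eta> v - \<omega> * \<xi> v))"
    using J_le_norm_det[OF d] by simp
  also have "\<dots> \<le> Z v * (4 * h / (real r * Z w ^ (r - 1))) + Z w * (4 * h / (real r * Z v ^ (r - 1)))"
    apply (rule order.trans[OF norm_triangle_ineq4])
    unfolding norm_mult
    by (intro add_mono mult_mono near_diff_le near h h2 norm_xi_eta_le) (use Zv Zw h in auto)
  also have "\<dots> \<le> Z w * (4 * h / (real r * Z v ^ (r - 1))) + Z w * (4 * h / (real r * Z v ^ (r - 1)))"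
    using Zv Zw h r Z pw[of "r - 1"]
    by (intro add_right_mono mult_mono divide_left_mono mult_left_mono) auto
  also have "\<dots> = 8 * h * Z w / (real r * Z v ^ (r - 1))" by simp
  finally show ?thesis using Zv r by (simp add: field_simps)
qed

text \<open>If \<open>Z w\<close> lies between \<open>u N ^ (n - 1)\<close> and \<open>u N ^ n\<close>, then \<open>S n v w\<close> and \<open>S (n + 1) v w\<close>, of which
  one is nonzero, are both too small.\<close>

lemma no_far_pair:
  assumes near: "near h \<omega> v" "near h \<omega> w" and d: "det v w \<noteq> 0" and Zvw: "Z v \<le> Z w"
    and h: "h > 0" "100 * h \<le> Z v ^ r" and F: "F v \<noteq> 0" and Z1: "Z v \<ge> 1"
  defines "X \<equiv> Z v ^ r" and "G \<equiv> 216 * real r ^ 3 * \<sigma>"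
  assumes B: "G ^ r * h ^ (2 * (r - 1)) \<le> X ^ (r - 2)"
    and A: "16 * 24 ^ (r - 1) * h ^ r * G ^ 2 < real r * J ^ r * X ^ (r - 4)"
  shows False
proof -
  \<comment> \<open>In the estimate of \<open>S m v w\<close>, the remainder term is below
    \<open>J / 2\<close> exactly when \<open>t < u N^m\<close>, and the other one is below
    \<open>J / 2\<close> if \<open>16 h Z v P^(n+1) < r J t^(r-1)\<close>. Hypothesis
    \<open>B\<close> is \<open>P \<le> N^(r-1)\<close>; hypothesis \<open>A\<close> is the second
    condition for \<open>n = 1\<close> and \<open>t = u\<close>.\<close>
  define P where "P = G * X"
  define N where "N = X / (G * h ^ 2)"
  define u where "u = J * X / (24 * h * Z v)"
  define t where "t = Z w"
  have r3: "real r ^ 3 \<ge> 1" using r by (intro one_le_power) auto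
  have G1: "G \<ge> 216"
  proof -
    have "216 * 1 * 1 \<le> 216 * real r ^ 3 * \<sigma>" using r3 \<sigma>_ge_1 by (intro mult_mono) auto
    then show ?thesis by (simp add: G_def)
  qed
  have X1: "X \<ge> 1" using Z1 by (simp add: X_def)
  have P1: "P > 1"
  proof -
    have "216 * 1 \<le> G * X" using G1 X1 by (intro mult_mono) auto
    then show ?thesis by (simp add: P_def)
  qed
  have u0: "u > 0" using J_pos X1 h Z1 by (simp add: u_def)
  have N0: "N > 0" using X1 G1 h by (simp add: N_def)
  have t0: "t > 0" using Zvw Z1 by (simp add: t_def)
  have NP: "P \<le> N ^ (r - 1)"
  proof -
    have "P * (G ^ (r - 1) * h ^ (2 * (r - 1))) = (G ^ r * h ^ (2 * (r - 1))) * X"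
      unfolding P_def using r by (simp add: power_eq_if[of G r] mult_ac)
    also have "\<dots> \<le> X ^ (r - 2) * X" using B X1 by (intro mult_right_mono) auto
    also have "\<dots> = X ^ (r - 1)"
      using r power_Suc2[of X "r - 2"] by (simp add: Suc_diff_le numeral_2_eq_2 Suc_diff_Suc)
    finally have "P \<le> X ^ (r - 1) / (G ^ (r - 1) * h ^ (2 * (r - 1)))"
      using G1 h by (simp add: field_simps)
    also have "\<dots> = N ^ (r - 1)" by (simp add: N_def power_divide power_mult_distrib power_mult)
    finally show ?thesis .
  qed
  then have N1: "N > 1" using P1 N0
    by (metis less_le_trans linorder_not_less less_imp_le power_le_one order.strict_trans2 order.strict_iff_not)
  have uA: "16 * h * Z v * P ^ 2 < real r * J * u ^ (r - 1)"
  proof -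
    have Zr: "Z v * Z v ^ (r - 1) = X" using r by (simp add: X_def power_eq_if[of _ r])
    have JJ: "J * J ^ (r - 1) = J ^ r" "h * h ^ (r - 1) = h ^ r" using r by (simp_all add: power_eq_if[of _ r])
    have X4: "X ^ (r - 1) = X ^ (r - 4) * X ^ 3" using r by (simp flip: power_add)
    have "16 * h * Z v * P ^ 2 * (24 * h * Z v) ^ (r - 1) =
        16 * 24 ^ (r - 1) * (h * h ^ (r - 1)) * (Z v * Z v ^ (r - 1)) * G ^ 2 * X ^ 2"
      by (simp add: P_def power_mult_distrib mult_ac)
    also have "\<dots> = (16 * 24 ^ (r - 1) * h ^ r * G ^ 2) * X ^ 3"
      unfolding JJ Zr by (simp add: power2_eq_square power3_eq_cube mult_ac)
    also have "\<dots> < (real r * J ^ r * X ^ (r - 4)) * X ^ 3"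
      using A X1 by (intro mult_strict_right_mono) auto
    also have "\<dots> = real r * J * (J * X) ^ (r - 1)"
      unfolding JJ(1)[symmetric] power_mult_distrib X4 by (simp add: mult_ac)
    finally show ?thesis
      using h Z1 by (simp add: u_def power_divide field_simps)
  qed
  \<comment> \<open>The gap between \<open>v\<close> and \<open>w\<close> starts the scale at
    \<open>u\<close>, so the index chosen below is at least 1.\<close>
  have tu: "u \<le> t"
  proof -
    have "real r * J * Z v ^ (r - 1) \<le> 8 * h * Z w" using h by (intro gap[OF near d Zvw]) auto
    then have "real r * J * Z v ^ (r - 1) * Z v \<le> 8 * h * Z w * Z v" using Z1 by (intro mult_right_mono) auto
    also have "real r * J * Z v ^ (r - 1) * Z v = real r * J * X"
      using r by (simp add: X_def power_eq_if[of _ r])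
    finally have 1: "real r * (J * X) \<le> 8 * h * Z v * t" by (simp add: t_def mult_ac)
    have "1 * (J * X) \<le> real r * (J * X)" using r J_pos X1 by (intro mult_right_mono) auto
    also note 1
    also have "8 * h * Z v * t \<le> 24 * h * Z v * t" using h Z1 t0 by simp
    finally show ?thesis using h Z1 by (simp add: u_def field_simps)
  qed
  obtain n0 where "t / u < N ^ n0" using real_arch_pow[OF N1] by blast
  then have ex: "t < u * N ^ n0" using u0 by (simp add: field_simps)
  \<comment> \<open>Minimality gives \<open>u N^(n-1) \<le> t\<close>: each step of \<open>n\<close>
    multiplies \<open>t^(r-1)\<close> by at least \<open>N^(r-1) \<ge> P\<close>, which keeps up
    with the power of \<open>P\<close>.\<close>
  define n where "n = (LEAST n. t < u * N ^ n)"
  have n: "t < u * N ^ n" unfolding n_def using ex by (rule LeastI)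
  then have "n \<noteq> 0" using tu by (intro notI) simp
  then obtain k where k: "n = Suc k" by (cases n) auto
  have "\<not> t < u * N ^ k" using not_less_Least[of k "\<lambda>n. t < u * N ^ n"] k unfolding n_def by simp
  then have uk: "u * N ^ k \<le> t" by simp
  have n1: "16 * h * Z v * P ^ (n + 1) < real r * J * t ^ (r - 1)"
  proof -
    have "16 * h * Z v * P ^ (n + 1) = (16 * h * Z v * P ^ 2) * P ^ k"
      by (simp add: k power2_eq_square)
    also have "\<dots> < real r * J * u ^ (r - 1) * P ^ k"
      using uA P1 by (intro mult_strict_right_mono) auto
    also have "\<dots> \<le> real r * J * u ^ (r - 1) * (N ^ (r - 1)) ^ k"
      using NP P1 J_pos u0 by (intro mult_left_mono power_mono) auto
    also have "\<dots> = real r * J * (u * N ^ k) ^ (r - 1)"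
      by (simp add: power_mult_distrib power_mult[symmetric] mult.commute)
    also have "\<dots> \<le> real r * J * t ^ (r - 1)"
      using uk u0 N0 J_pos by (intro mult_left_mono power_mono) auto
    finally show ?thesis .
  qed
  obtain l where l: "\<omega> ^ r = 1" "\<eta> v = \<omega> * \<xi> v * exp l" "real r * cmod l \<le> 2 * (h / X)"
    using near(1) unfolding near_def X_def by blast
  have hX: "h / X \<le> 1 / 100" using h X1 by (simp add: X_def field_simps)
  have Zr1: "Z v ^ (m * r + 1) = X ^ m * Z v" for m by (simp add: X_def power_mult mult.commute[of m])
  have S0: "S m v w = 0" if m: "m = n \<or> m = Suc n" for m
  proof (rule ccontr)
    assume "S m v w \<noteq> 0"
    then have "J \<le> cmod (S m v w) * (2 * real r * \<sigma>) ^ m" by (rule S_lower)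
    also have "cmod (S m v w) \<le> Z v ^ (m * r + 1) * (12 * (h / X) * (108 * real r ^ 2 * (h / X) ^ 2) ^ m * cmod (\<xi> w)
                        + 2 * (4 * real r ^ 2) ^ m * cmod (\<eta> w - \<omega> * \<xi> w))"
      unfolding S_def by (rule pade_form_upper[OF _ l(1,2) norm_xi_eta_le l(3) hX]) (use r in simp)
    also have "\<dots> \<le> Z v ^ (m * r + 1) * (12 * (h / X) * (108 * real r ^ 2 * (h / X) ^ 2) ^ m * t
                        + 2 * (4 * real r ^ 2) ^ m * (4 * h / (real r * t ^ (r - 1))))"
    proof -
      have "2 * h \<le> Z w ^ r" using h power_mono[OF Zvw, of r] Z1 by simp
      then have "cmod (\<eta> w - \<omega> * \<xi> w) \<le> 4 * h / (real r * t ^ (r - 1))"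
        unfolding t_def by (rule near_diff_le[OF near(2)])
      then show ?thesis using Z1 h X1 norm_xi_eta_le(1)[of w]
        by (intro mult_left_mono add_mono) (auto simp: t_def)
    qed
    finally have "J \<le> Z v ^ (m * r + 1) * (12 * (h / X) * (108 * real r ^ 2 * (h / X) ^ 2) ^ m * t
        + 2 * (4 * real r ^ 2) ^ m * (4 * h / (real r * t ^ (r - 1)))) * (2 * real r * \<sigma>) ^ m"
      using \<sigma>_ge_1 by (simp add: mult_right_mono)
    also have "\<dots> = 12 * (h / X) * Z v * t * (X * (108 * real r ^ 2 * (h / X) ^ 2) * (2 * real r * \<sigma>)) ^ m
        + 8 * h * Z v / (real r * t ^ (r - 1)) * (X * (4 * real r ^ 2) * (2 * real r * \<sigma>)) ^ m"
      unfolding Zr1 power_mult_distrib by (simp add: algebra_simps)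
    also have "X * (108 * real r ^ 2 * (h / X) ^ 2) * (2 * real r * \<sigma>) = 1 / N"
      using X1 G1 h by (simp add: N_def G_def power2_eq_square power3_eq_cube field_simps)
    also have "12 * (h / X) * Z v * t * (1 / N) ^ m < J / 2"
    proof -
      have "N ^ n \<le> N ^ m" using m N1 by (intro power_increasing) auto
      then have "t < u * N ^ m" using n u0 by (meson less_le_trans mult_le_cancel_left_pos)
      then show ?thesis using N0 h X1 Z1 by (simp add: u_def field_simps)
    qed
    also have "8 * h * Z v / (real r * t ^ (r - 1)) * (X * (4 * real r ^ 2) * (2 * real r * \<sigma>)) ^ m
        \<le> 8 * h * Z v / (real r * t ^ (r - 1)) * P ^ (n + 1)"
    proof (rule mult_left_mono)
      have "X * (4 * real r ^ 2) * (2 * real r * \<sigma>) = 8 * (X * (real r ^ 3 * \<sigma>))"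
        by (simp add: power2_eq_square power3_eq_cube)
      also have "\<dots> \<le> 216 * (X * (real r ^ 3 * \<sigma>))"
        using X1 r3 \<sigma>_ge_1 by (intro mult_right_mono) auto
      finally have "X * (4 * real r ^ 2) * (2 * real r * \<sigma>) \<le> P" by (simp add: P_def G_def mult_ac)
      then have "(X * (4 * real r ^ 2) * (2 * real r * \<sigma>)) ^ m \<le> P ^ m"
        using X1 \<sigma>_ge_1 by (intro power_mono) auto
      also have "\<dots> \<le> P ^ (n + 1)" using m P1 by (intro power_increasing) auto
      finally show "(X * (4 * real r ^ 2) * (2 * real r * \<sigma>)) ^ m \<le> P ^ (n + 1)" .
    qed (use h Z1 t0 in simp)
    also have "\<dots> < J / 2" using n1 t0 r by (simp add: field_simps)
    finally show False by simp
  qed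
  have eq: "\<xi> w * pade_form r m (\<xi> v) (\<eta> v) = \<eta> w * pade_form r m (\<eta> v) (\<xi> v)" if "m = n \<or> m = Suc n" for m
    using S0[OF that] by (simp add: S_def)
  have w0: "\<omega> \<noteq> 0" using l(1) r by (auto simp: power_0_left)
  have "\<xi> v \<noteq> 0" using Z1 l(2) by (auto simp: Z_def)
  moreover have "\<eta> v \<noteq> 0" using l(2) w0 calculation by simp
  moreover have "\<xi> v ^ r \<noteq> \<eta> v ^ r" using F F_eq[of v] by auto
  ultimately have ind: "pade_form r n (\<xi> v) (\<eta> v) * pade_form r (Suc n) (\<eta> v) (\<xi> v) \<noteq>
      pade_form r (Suc n) (\<xi> v) (\<eta> v) * pade_form r n (\<eta> v) (\<xi> v)"
    using r by (intro pade_form_independent) auto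
  \<comment> \<open>Two vanishing values of \<open>S\<close> are a homogeneous linear system for
    \<open>(\<xi> w, \<eta> w)\<close> with nonzero determinant, so both entries vanish.\<close>
  have "\<xi> w * (pade_form r n (\<xi> v) (\<eta> v) * pade_form r (Suc n) (\<eta> v) (\<xi> v)) =
      \<xi> w * (pade_form r (Suc n) (\<xi> v) (\<eta> v) * pade_form r n (\<eta> v) (\<xi> v))"
    "\<eta> w * (pade_form r n (\<xi> v) (\<eta> v) * pade_form r (Suc n) (\<eta> v) (\<xi> v)) =
      \<eta> w * (pade_form r (Suc n) (\<xi> v) (\<eta> v) * pade_form r n (\<eta> v) (\<xi> v))"
    using eq[of n] eq[of "Suc n"] by (auto simp: mult_ac) algebra+
  then have "\<xi> w = 0" "\<eta> w = 0" using ind by auto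
  then show False using t0 by (simp add: t_def Z_def)
qed

end

subsection \<open>Counting\<close>

lemma primitive_parallel:
  fixes v w :: "int \<times> int"
  assumes "gcd (fst v) (snd v) = 1" "gcd (fst w) (snd w) = 1" "fst v * snd w = fst w * snd v"
  shows "w = v \<or> w = - v"
proof -
  obtain x y x' y' where vw: "v = (x, y)" "w = (x', y')" by (metis surj_pair)
  have c: "coprime x y" "coprime x' y'" and e: "x * y' = x' * y"
    using assms by (simp_all add: vw coprime_iff_gcd_eq_1)
  have "x dvd x' * y" "x' dvd x * y'" "y dvd x * y'" "y' dvd x' * y"
    using e by (metis dvd_triv_left dvd_triv_right)+
  then have "x dvd x'" "x' dvd x" "y dvd y'" "y' dvd y"
    using c by (simp_all add: coprime_dvd_mult_left_iff coprime_dvd_mult_right_iff coprime_commute)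
  then have a: "x' = x \<or> x' = - x" "y' = y \<or> y' = - y"
    using zdvd_antisym_abs by (metis abs_eq_iff)+
  show ?thesis
  proof (cases "x = 0 \<or> y = 0")
    case True
    then show ?thesis using a by (auto simp: vw)
  next
    case False
    then show ?thesis using a e by (auto simp: vw)
  qed
qed

context diag_form
begin

text \<open>The bound is real here, since the given integer is later enlarged to the value fixed by
  the equation in \<open>diag_form_bound\<close>.\<close>

definition solutions :: "real \<Rightarrow> (int \<times> int) set" where
  "solutions h = {v. gcd (fst v) (snd v) = 1 \<and> F v \<noteq> 0 \<and> \<bar>real_of_int (F v)\<bar> \<le> h}"

definition class_of :: "int \<times> int \<Rightarrow> (int \<times> int) set" where "class_of v = {v, - v}"

lemma det_nonzero:
  assumes "v \<in> solutions h" "w \<in> solutions h" "class_of v \<noteq> class_of w"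
  shows "det v w \<noteq> 0"
proof
  assume "det v w = 0"
  then have "w = v \<or> w = - v"
    using assms by (intro primitive_parallel) (auto simp: solutions_def det_def)
  then show False using assms(3) by (auto simp: class_of_def)
qed

lemma solutions_near:
  assumes "v \<in> solutions h" "2 * h < Z v ^ r"
  obtains \<omega> where "near h \<omega> v"
proof -
  have "cmod (\<xi> v ^ r - \<eta> v ^ r) \<le> h"
    unfolding F_eq[symmetric] using assms(1) by (simp add: solutions_def)
  then obtain \<omega> l where *: "\<xi> v \<noteq> 0" "\<omega> ^ r = 1" "\<eta> v = \<omega> * \<xi> v * exp l"
    "real r * cmod l \<le> 2 * (h / Z v ^ r)" "(\<eta> v / \<xi> v) ^ r \<in> \<real> \<longrightarrow> l \<in> \<real>"
    using r nearby_root_of_unity[of r "\<xi> v" "\<eta> v" h] assms(2) unfolding Z_def by (metis gr0I not_numeral_le_zero)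
  moreover have "Z v > 0" using *(1) by (simp add: Z_def less_max_iff_disj)
  ultimately show thesis using that unfolding near_def by blast
qed

end

text \<open>The equation says \<open>h = (J/2)^(r/2) / (r^6 E)\<close>, squared to avoid the half
  power; \<open>E\<close> stands for \<open>\<bar>\<Delta>\<bar>^\<epsilon>\<close>.\<close>

locale diag_form_bound = diag_form +
  fixes h E \<Psi> :: real and m :: nat
  assumes h: "h \<ge> 1" "h ^ 2 * real r ^ 12 * E ^ 2 = (J / 2) ^ r" and E: "E \<ge> 1" and m: "m \<ge> 3"
    and \<Psi>: "E ^ ((r - 1) ^ (m - 2)) = \<Psi>" "J ^ (r * (r + 2)) \<le> \<Psi> ^ 4"
begin

section \<open>Chains of large solutions\<close>

definition "large v \<longleftrightarrow> J / 2 \<le> Z v ^ 2"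

lemma J_ge_2: "J \<ge> 2"
proof (rule ccontr)
  assume "\<not> J \<ge> 2"
  then have "(J / 2) ^ r < 1 ^ r" using J_pos r by (intro power_strict_mono) auto
  moreover have "1 * 1 * 1 \<le> h ^ 2 * real r ^ 12 * E ^ 2"
    using h(1) E r by (intro mult_mono one_le_power) auto
  ultimately show False using h(2) by simp
qed

lemma Z_nonneg: "Z v \<ge> 0"
  by (simp add: Z_def le_max_iff_disj)

lemma large_ge:
  assumes "large v"
  shows "Z v \<ge> 1" "100 * h \<le> Z v ^ r" "real r ^ 6 * E \<le> real r * J / (8 * h) * Z v ^ (r - 2)"
proof -
  have "1 ^ 2 \<le> Z v ^ 2" using assms J_ge_2 by (simp add: large_def)
  then show "Z v \<ge> 1" by (rule power2_le_imp_le) (rule Z_nonneg)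
  have "(h * real r ^ 6 * E) ^ 2 = (J / 2) ^ r" unfolding h(2)[symmetric] by (simp add: power_mult_distrib)
  also have "\<dots> \<le> (Z v ^ 2) ^ r" using assms J_pos by (intro power_mono) (auto simp: large_def)
  also have "\<dots> = (Z v ^ r) ^ 2" by (simp flip: power_mult add: mult.commute)
  finally have "h * real r ^ 6 * E \<le> Z v ^ r" by (rule power2_le_imp_le) (simp add: Z_nonneg)
  moreover have "h * 100 * 1 \<le> h * real r ^ 6 * E"
  proof (intro mult_mono mult_left_mono)
    have "(5::real) ^ 6 \<le> real r ^ 6" using r by (intro power_mono) auto
    then show "100 \<le> real r ^ 6" by simp
  qed (use h(1) E in auto)
  ultimately show "100 * h \<le> Z v ^ r" by simp
  \<comment> \<open>At the threshold \<open>Z^2 = J/2\<close> the square of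
    \<open>r J / (8 h) * Z^(r-2)\<close> is \<open>r^2 / 16\<close> times that of
    \<open>r^6 E\<close>, and \<open>r \<ge> 4\<close>.\<close>
  have "J ^ 2 * (J / 2) ^ (r - 2) = 4 * (J / 2) ^ r"
  proof -
    have "r = 2 + (r - 2)" using r by simp
    then have "(J / 2) ^ r = (J / 2) ^ 2 * (J / 2) ^ (r - 2)" by (metis power_add)
    also have "4 * \<dots> = J ^ 2 * (J / 2) ^ (r - 2)" by (simp add: power2_eq_square)
    finally show ?thesis ..
  qed
  moreover have "(real r * J / (8 * h)) ^ 2 * K = real r ^ 2 / (64 * h ^ 2) * (J ^ 2 * K)" for K
    by (simp add: power_divide power_mult_distrib)
  ultimately have "(real r * J / (8 * h)) ^ 2 * (J / 2) ^ (r - 2) = real r ^ 2 / (64 * h ^ 2) * (4 * (J / 2) ^ r)"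
    by (simp only:)
  also have "\<dots> = real r ^ 2 / 16 * ((J / 2) ^ r / h ^ 2)" by simp
  also have "\<dots> = real r ^ 2 / 16 * (real r ^ 6 * E) ^ 2"
    using h(1) by (simp add: h(2)[symmetric] power_mult_distrib)
  finally have eq: "(real r * J / (8 * h)) ^ 2 * (J / 2) ^ (r - 2) = real r ^ 2 / 16 * (real r ^ 6 * E) ^ 2" .
  have "(4::real) ^ 2 \<le> real r ^ 2" using r by (intro power_mono) auto
  then have "1 * (real r ^ 6 * E) ^ 2 \<le> real r ^ 2 / 16 * (real r ^ 6 * E) ^ 2"
    by (intro mult_right_mono) auto
  also note eq[symmetric]
  also have "(real r * J / (8 * h)) ^ 2 * (J / 2) ^ (r - 2) \<le> (real r * J / (8 * h)) ^ 2 * (Z v ^ 2) ^ (r - 2)"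
    using assms J_pos by (intro mult_left_mono power_mono) (auto simp: large_def)
  also have "\<dots> = (real r * J / (8 * h) * Z v ^ (r - 2)) ^ 2"
    by (simp only: power_mult_distrib power_mult[symmetric] mult.commute)
  finally have "(real r ^ 6 * E) ^ 2 \<le> (real r * J / (8 * h) * Z v ^ (r - 2)) ^ 2" by simp
  then show "real r ^ 6 * E \<le> real r * J / (8 * h) * Z v ^ (r - 2)"
    by (rule power2_le_imp_le) (use h(1) J_pos Z_nonneg in simp)
qed

lemma max_Z:
  assumes "finite V" "V \<noteq> {}"
  obtains v where "v \<in> V" "\<And>u. u \<in> V \<Longrightarrow> Z u \<le> Z v"
proof -
  have "Max (Z ` V) \<in> Z ` V" using assms by (intro Max_in) auto
  then obtain v where "v \<in> V" "Z v = Max (Z ` V)" by auto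
  then show thesis using that[of v] assms by auto
qed

text \<open>With \<open>c = r J / (8 h)\<close> the gap reads \<open>c Z v^(r-1) \<le> Z w\<close>,
  hence \<open>(c Z v^(r-2))^(r-1) \<le> c Z w^(r-2)\<close>. Thus \<open>c Z^(r-2)\<close> is the
  quantity that is simply raised to the power \<open>r - 1\<close> by every gap.\<close>

lemma chain:
  assumes "finite V" "card V = Suc k" "\<And>v. v \<in> V \<Longrightarrow> near h \<omega> v \<and> large v"
    "\<And>v w. v \<in> V \<Longrightarrow> w \<in> V \<Longrightarrow> v \<noteq> w \<Longrightarrow> det v w \<noteq> 0"
  shows "\<exists>v\<in>V. (real r ^ 6 * E) ^ ((r - 1) ^ k) \<le> real r * J / (8 * h) * Z v ^ (r - 2)"
  using assms
proof (induction k arbitrary: V)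
  case 0
  then obtain v where "v \<in> V" by (metis card_eq_0_iff ex_in_conv nat.distinct(1))
  moreover from this have "large v" using 0(3) by blast
  ultimately show ?case using large_ge(3)[of v] by (intro bexI[of _ v]) simp_all
next
  case (Suc k)
  define c where "c = real r * J / (8 * h)"
  have c0: "c > 0" using r J_pos h by (simp add: c_def)
  have "V \<noteq> {}" using Suc.prems by auto
  then obtain w where w: "w \<in> V" "\<And>u. u \<in> V \<Longrightarrow> Z u \<le> Z w" using max_Z Suc.prems(1) by metis
  have "\<exists>v\<in>V - {w}. (real r ^ 6 * E) ^ ((r - 1) ^ k) \<le> c * Z v ^ (r - 2)"
    unfolding c_def by (rule Suc.IH) (use Suc.prems w in auto)
  then obtain v where v: "v \<in> V" "v \<noteq> w" "(real r ^ 6 * E) ^ ((r - 1) ^ k) \<le> c * Z v ^ (r - 2)" by blast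
  have "real r * J * Z v ^ (r - 1) \<le> 8 * h * Z w"
    using Suc.prems(3)[OF v(1)] Suc.prems(3)[OF w(1)] Suc.prems(4)[OF v(1) w(1) v(2)] w(2)[OF v(1)] h(1)
      large_ge(2)[of v] by (intro gap[of h \<omega> v w]) auto
  then have g: "c * Z v ^ (r - 1) \<le> Z w" using h(1) by (simp add: c_def field_simps)
  have "(real r ^ 6 * E) ^ ((r - 1) ^ Suc k) = ((real r ^ 6 * E) ^ ((r - 1) ^ k)) ^ (r - 1)"
    by (simp add: power_mult[symmetric] mult.commute)
  also have "\<dots> \<le> (c * Z v ^ (r - 2)) ^ (r - 1)" using v(3) E by (intro power_mono) auto
  also have "\<dots> = c * (c * Z v ^ (r - 1)) ^ (r - 2)"
  proof -
    have "c ^ (r - 1) = c * c ^ (r - 2)" using r power_Suc[of c "r - 2"] by (simp add: Suc_diff_le[symmetric] numeral_2_eq_2 Suc_diff_Suc)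
    then show ?thesis by (simp add: power_mult_distrib power_mult[symmetric] mult.commute)
  qed
  also have "\<dots> \<le> c * Z w ^ (r - 2)"
    using g c0 Z_nonneg by (intro mult_left_mono power_mono) auto
  finally show ?case using w(1) unfolding c_def by blast
qed

lemma no_long_chain:
  assumes "V \<subseteq> solutions h" "card V = m" "\<And>v. v \<in> V \<Longrightarrow> near h \<omega> v \<and> large v"
    "\<And>v w. v \<in> V \<Longrightarrow> w \<in> V \<Longrightarrow> v \<noteq> w \<Longrightarrow> det v w \<noteq> 0"
  shows False
proof -
  have fin: "finite V" using assms(2) m by (metis card.infinite not_numeral_le_zero)
  have "V \<noteq> {}" using assms(2) m by auto
  then obtain w where w: "w \<in> V" "\<And>u. u \<in> V \<Longrightarrow> Z u \<le> Z w" using max_Z fin by metis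
  define \<Phi> where "\<Phi> = (real r ^ 6 * E) ^ ((r - 1) ^ (m - 2))"
  \<comment> \<open>The largest solution \<open>w\<close> is set aside as second member of the pair;
    the other \<open>m - 1\<close> make \<open>m - 2\<close> gaps.\<close>
  have "\<exists>v\<in>V - {w}. \<Phi> \<le> real r * J / (8 * h) * Z v ^ (r - 2)"
    unfolding \<Phi>_def by (rule chain[where \<omega> = \<omega>]) (use assms w fin m in auto)
  then obtain v where v: "v \<in> V" "v \<noteq> w" "\<Phi> \<le> real r * J / (8 * h) * Z v ^ (r - 2)" by blast
  define X where "X = Z v ^ r"
  have lv: "large v" using assms(3) v by blast
  note Zv = large_ge[OF lv]
  have \<Phi>0: "\<Phi> > 0" using r E by (simp add: \<Phi>_def)
  have "8 * h * \<Phi> \<le> real r * J * Z v ^ (r - 2)" using v(3) h(1) by (simp add: field_simps)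
  then have "(8 * h * \<Phi>) ^ r \<le> (real r * J * Z v ^ (r - 2)) ^ r"
    using h(1) \<Phi>0 by (intro power_mono) auto
  also have "\<dots> = (real r * J) ^ r * X ^ (r - 2)"
    by (simp add: X_def power_mult_distrib power_mult[symmetric] mult.commute)
  finally have X: "(8 * h * \<Phi>) ^ r \<le> (real r * J) ^ r * X ^ (r - 2)" .
  have \<Phi>: "real r ^ (6 * (r - 1)) * \<Psi> \<le> \<Phi>"
  proof -
    \<comment> \<open>As \<open>m \<ge> 3\<close>, at least one gap has occurred, which yields the
      power \<open>r^(6 (r-1))\<close> that \<open>size_conditions\<close> asks for.\<close>
    have "(r - 1) ^ 1 \<le> (r - 1) ^ (m - 2)" using r m by (intro power_increasing) auto
    then have "(real r ^ 6) ^ (r - 1) \<le> (real r ^ 6) ^ ((r - 1) ^ (m - 2))"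
      using r by (intro power_increasing) auto
    then show ?thesis using E unfolding \<Phi>_def power_mult_distrib \<Psi>(1)[symmetric] power_mult
      by (intro mult_right_mono) auto
  qed
  have hJ: "h ^ 2 \<le> J ^ r"
  proof -
    have "h ^ 2 * 1 * 1 \<le> h ^ 2 * real r ^ 12 * E ^ 2"
      using E r by (intro mult_mono one_le_power) auto
    also have "\<dots> \<le> J ^ r" unfolding h(2) using J_pos by (intro power_mono) auto
    finally show ?thesis by simp
  qed
  have \<Psi>0: "\<Psi> > 0" using E by (simp flip: \<Psi>(1))
  have "J \<ge> 1" "h > 0" "X > 0" using J_ge_2 h(1) Zv(1) by (auto simp: X_def)
  note size = size_conditions[OF r this(1,2) hJ \<sigma>_ge_1 \<sigma>_le \<Psi>0 \<Psi>(2) \<Phi> this(3) X]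
  show False
    by (rule no_far_pair[of h \<omega> v w])
       (use assms(3)[OF v(1)] assms(3)[OF w(1)] assms(4)[OF v(1) w(1) v(2)] w(2)[OF v(1)] h(1) Zv(1,2)
          size[unfolded X_def] v(1) assms(1) in \<open>auto simp: solutions_def\<close>)
qed

text \<open>Whether the set is infinite or too large, it contains \<open>m\<close> classes, and one
  representative from each forms a set excluded by \<open>no_long_chain\<close>.\<close>

lemma card_large_near_classes:
  "finite (class_of ` {v \<in> solutions h. large v \<and> near h \<omega> v}) \<and>
   card (class_of ` {v \<in> solutions h. large v \<and> near h \<omega> v}) \<le> m - 1"
proof (rule ccontr)
  let ?V = "{v \<in> solutions h. large v \<and> near h \<omega> v}"
  assume neg: "\<not> ?thesis"
  have "\<exists>C. C \<subseteq> class_of ` ?V \<and> card C = m"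
  proof (cases "finite (class_of ` ?V)")
    case True
    then have "m \<le> card (class_of ` ?V)" using neg by auto
    then obtain C where "C \<subseteq> class_of ` ?V" "card C = m" by (rule obtain_subset_with_card_n)
    then show ?thesis by blast
  next
    case False
    then show ?thesis using infinite_arbitrarily_large by blast
  qed
  then obtain C where C: "C \<subseteq> class_of ` ?V" "card C = m" by blast
  then obtain V where V: "V \<subseteq> ?V" "inj_on class_of V" "C = class_of ` V" by (meson subset_image_inj)
  have "card V = m" using V C by (simp add: card_image)
  have "det v w \<noteq> 0" if "v \<in> V" "w \<in> V" "v \<noteq> w" for v w
  proof (rule det_nonzero)
    show "class_of v \<noteq> class_of w" using V(2) that by (auto dest: inj_onD)
  qed (use V(1) that in blast)+
  then show False
    using V(1) \<open>card V = m\<close> no_long_chain[of V \<omega>] by blast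
qed

lemma small_unique:
  assumes "v \<in> solutions h" "w \<in> solutions h" "\<not> large v" "\<not> large w"
  shows "class_of v = class_of w"
proof (rule ccontr)
  assume "class_of v \<noteq> class_of w"
  then have "J \<le> cmod (\<xi> v * \<eta> w - \<xi> w * \<eta> v)" using det_nonzero assms(1,2) J_le_norm_det by blast
  also have "\<dots> \<le> Z v * Z w + Z w * Z v"
    apply (rule order.trans[OF norm_triangle_ineq4])
    unfolding norm_mult by (intro add_mono mult_mono norm_xi_eta_le) (auto simp: Z_nonneg)
  also have "\<dots> \<le> Z v ^ 2 + Z w ^ 2"
    using sum_squares_bound[of "Z v" "Z w"] by simp
  also have "\<dots> < J" using assms(3,4) by (simp add: large_def)
  finally show False by simp
qed

definition "roots = {\<omega>. \<exists>v\<in>solutions h. large v \<and> near h \<omega> v}"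

lemma roots_subset: "roots \<subseteq> {\<omega>. \<omega> ^ r = 1}"
  by (auto simp: roots_def near_def)

lemma finite_roots: "finite roots"
  using r by (intro finite_subset[OF roots_subset] finite_roots_unity) auto

lemma card_roots_le: "card roots \<le> r"
proof -
  have "card roots \<le> card {\<omega>::complex. \<omega> ^ r = 1}"
    using r by (intro card_mono roots_subset finite_roots_unity) auto
  also have "\<dots> \<le> r" using r by (intro card_roots_unity) auto
  finally show ?thesis .
qed

lemma card_classes_le:
  "finite (class_of ` solutions h)" "card (class_of ` solutions h) \<le> 1 + card roots * (m - 1)"
proof -
  let ?L = "\<lambda>\<omega>. class_of ` {v \<in> solutions h. large v \<and> near h \<omega> v}"
  let ?S = "class_of ` {v \<in> solutions h. \<not> large v}"
  have sub: "class_of ` solutions h \<subseteq> ?S \<union> (\<Union>\<omega>\<in>roots. ?L \<omega>)"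
  proof
    fix c assume "c \<in> class_of ` solutions h"
    then obtain v where v: "v \<in> solutions h" "c = class_of v" by blast
    show "c \<in> ?S \<union> (\<Union>\<omega>\<in>roots. ?L \<omega>)"
    proof (cases "large v")
      case True
      have "2 * h < Z v ^ r" using large_ge(2)[OF True] h(1) by linarith
      then obtain \<omega> where "near h \<omega> v" using solutions_near[OF v(1)] by blast
      then have "\<omega> \<in> roots" "c \<in> ?L \<omega>" using True v by (auto simp: roots_def)
      then show ?thesis by blast
    qed (use v in blast)
  qed
  have S: "finite ?S \<and> card ?S \<le> 1"
  proof (cases "\<exists>w\<in>solutions h. \<not> large w")
    case True
    then obtain w where w: "w \<in> solutions h" "\<not> large w" by blast
    then have "?S \<subseteq> {class_of w}" using small_unique[OF _ w(1) _ w(2)] by blast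
    then show ?thesis using card_mono[of "{class_of w}" ?S] finite_subset[of ?S "{class_of w}"]
      by simp
  next
    case False
    then have "?S = {}" by blast
    then show ?thesis by (simp only: finite.emptyI card.empty) simp
  qed
  have fU: "finite (\<Union>\<omega>\<in>roots. ?L \<omega>)" 
    by (intro finite_UN_I finite_roots card_large_near_classes[THEN conjunct1])
  then show "finite (class_of ` solutions h)" using S sub by (meson finite_Un finite_subset)
  have "card (class_of ` solutions h) \<le> card (?S \<union> (\<Union>\<omega>\<in>roots. ?L \<omega>))"
    using S fU sub by (intro card_mono) auto
  also have "\<dots> \<le> card ?S + card (\<Union>\<omega>\<in>roots. ?L \<omega>)" by (rule card_Un_le)
  also have "\<dots> \<le> 1 + (\<Sum>\<omega>\<in>roots. card (?L \<omega>))"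
    using S finite_roots by (intro add_mono card_UN_le) auto
  also have "(\<Sum>\<omega>\<in>roots. card (?L \<omega>)) \<le> card roots * (m - 1)"
    using sum_bounded_above[of roots "\<lambda>\<omega>. card (?L \<omega>)" "m - 1"] card_large_near_classes by simp
  finally show "card (class_of ` solutions h) \<le> 1 + card roots * (m - 1)" by simp
qed

section \<open>Positive \<open>D\<close>: the occurring roots of unity\<close>

lemma s_real:
  assumes "D > 0"
  shows "s \<in> \<real>"
proof -
  have "s ^ 2 = of_real (sqrt (of_int D)) ^ 2"
    unfolding s_square of_real_power[symmetric] using assms by simp
  then have "s = of_real (sqrt (of_int D)) \<or> s = - of_real (sqrt (of_int D))"
    by (simp add: power2_eq_iff)
  then show ?thesis by (metis Reals_minus Reals_of_real)
qed

lemma conj_pair_real: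
  assumes "D > 0" "conj_pair s x y"
  shows "x \<in> \<real>" "y \<in> \<real>"
  using assms(2) s_real[OF assms(1)] unfolding conj_pair_def by auto

lemma bilinear_real:
  assumes "D > 0"
  shows "\<xi> v * \<eta> w / \<kappa> \<in> \<real>"
proof -
  have "2 * \<xi> v * \<eta> w / \<kappa> / 2 \<in> \<real>"
    by (rule Reals_divide[OF conj_pair_real(1)[OF assms conj_pair_bilinear]]) simp
  then show ?thesis by simp
qed

lemma near_real:
  assumes "D > 0" "near h \<omega> v"
  obtains l where "\<xi> v \<noteq> 0" "\<eta> v \<noteq> 0" "l \<in> \<real>" "\<eta> v = \<omega> * \<xi> v * exp l" "\<omega> ^ r = 1" "\<omega> \<noteq> 0"
proof -
  obtain l where l: "\<omega> ^ r = 1" "Z v > 0" "\<eta> v = \<omega> * \<xi> v * exp l" "(\<eta> v / \<xi> v) ^ r \<in> \<real> \<longrightarrow> l \<in> \<real>"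
    using assms(2) unfolding near_def by blast
  have "(2 * of_nat r * s * \<eta> v ^ r) / (2 * of_nat r * s * \<xi> v ^ r) \<in> \<real>"
    using conj_pair_real[OF assms(1) conj_pair_power_r] by (intro Reals_divide)
  then have "(\<eta> v / \<xi> v) ^ r \<in> \<real>" using s_nonzero r by (simp add: power_divide)
  then have "l \<in> \<real>" using l(4) by blast
  moreover have "\<omega> \<noteq> 0" using l(1) r by (auto simp: power_0_left)
  moreover have "\<xi> v \<noteq> 0" using l(2,3) by (auto simp: Z_def)
  ultimately show thesis using that l by simp
qed

lemma exp_Reals: "l \<in> \<real> \<Longrightarrow> exp l \<in> (\<real> :: complex set)"
  by (auto elim!: Reals_cases simp flip: exp_of_real)

text \<open>\<open>(\<xi> v * \<eta> w) / (\<xi> w * \<eta> v)\<close> is real, and it equals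
  \<open>\<omega>' / \<omega>\<close> up to the real factor \<open>exp l' / exp l\<close>. A real
  \<open>r\<close>-th root of unity is 1 or -1.\<close>

lemma roots_ratio:
  assumes D: "D > 0" and roots: "\<omega> \<in> roots" "\<omega>' \<in> roots"
  shows "\<omega>' = \<omega> \<or> (even r \<and> \<omega>' = - \<omega>)"
proof -
  obtain v w where vw: "near h \<omega> v" "near h \<omega>' w" using roots unfolding roots_def by blast
  obtain l where l: "\<xi> v \<noteq> 0" "\<eta> v \<noteq> 0" "l \<in> \<real>" "\<eta> v = \<omega> * \<xi> v * exp l" "\<omega> ^ r = 1" "\<omega> \<noteq> 0"
    using near_real[OF D vw(1)] .
  obtain l' where l': "\<xi> w \<noteq> 0" "\<eta> w \<noteq> 0" "l' \<in> \<real>" "\<eta> w = \<omega>' * \<xi> w * exp l'" "\<omega>' ^ r = 1" "\<omega>' \<noteq> 0"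
    using near_real[OF D vw(2)] .
  have "\<omega>' / \<omega> = (\<xi> v * \<eta> w / \<kappa>) / (\<xi> w * \<eta> v / \<kappa>) * (exp l / exp l')"
    using l(1,6) l'(1,6) \<kappa>_nonzero unfolding l(4) l'(4) by (simp add: field_simps)
  also have "\<dots> \<in> \<real>"
    using l(3) l'(3) by (intro Reals_mult Reals_divide bilinear_real D exp_Reals)
  finally obtain t where t: "\<omega>' / \<omega> = of_real t" by (auto elim: Reals_cases)
  have "(\<omega>' / \<omega>) ^ r = 1" using l(5) l'(5) by (simp add: power_divide)
  then have tr: "t ^ r = 1" unfolding t by (metis of_real_1 of_real_eq_iff of_real_power)
  then have "\<bar>t\<bar> ^ r = 1 ^ r" by (simp flip: power_abs)
  then have "\<bar>t\<bar> = 1" using r by (intro power_eq_imp_eq_base[of "\<bar>t\<bar>" r 1]) auto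
  then have "t = 1 \<or> (t = -1 \<and> even r)" using tr by (cases "even r") (auto simp: abs_if split: if_splits)
  moreover have "\<omega>' = of_real t * \<omega>" using t l(6) by (simp add: field_simps)
  ultimately show ?thesis by auto
qed

lemma card_roots_le_2:
  assumes "D > 0"
  shows "card roots \<le> 2" "odd r \<Longrightarrow> card roots \<le> 1"
proof -
  have "card roots \<le> 2 \<and> (odd r \<longrightarrow> card roots \<le> 1)"
  proof (cases "roots = {}")
    case False
    then obtain \<omega> where w: "\<omega> \<in> roots" by blast
    then have "roots \<subseteq> {\<omega>, - \<omega>}" "odd r \<longrightarrow> roots \<subseteq> {\<omega>}"
      using roots_ratio[OF assms w] by auto
    moreover have "card {\<omega>, - \<omega>} \<le> 2" by (simp add: card_insert_if)
    ultimately show ?thesis using card_mono[of "{\<omega>, - \<omega>}" roots] card_mono[of "{\<omega>}" roots] by auto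
  qed simp
  then show "card roots \<le> 2" "odd r \<Longrightarrow> card roots \<le> 1" by auto
qed

text \<open>The linear form \<open>\<eta> - \<omega> \<xi>\<close>, multiplied by
  \<open>\<xi> v / \<kappa>\<close>, has real coefficients. It therefore vanishes at a nonzero real
  point, and so does its multiple \<open>F\<close>.\<close>

lemma roots_empty_if_definite:
  assumes D: "D > 0" and def: "definite_form r a"
  shows "roots = {}"
proof (rule ccontr)
  assume "roots \<noteq> {}"
  then obtain \<omega> v where "near h \<omega> v" unfolding roots_def by blast
  then obtain l where l: "\<xi> v \<noteq> 0" "\<eta> v \<noteq> 0" "l \<in> \<real>" "\<eta> v = \<omega> * \<xi> v * exp l" "\<omega> ^ r = 1" "\<omega> \<noteq> 0"
    using near_real[OF D] by metis
  have wx: "\<omega> * \<xi> v = \<eta> v / exp l" by (simp add: l(4))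
  have eqs: "(\<gamma> - \<omega> * \<alpha>) * \<xi> v / \<kappa> = \<xi> v * \<eta> (1, 0) / \<kappa> - (\<xi> (1, 0) * \<eta> v / \<kappa>) / exp l"
    "(\<delta> - \<omega> * \<beta>) * \<xi> v / \<kappa> = \<xi> v * \<eta> (0, 1) / \<kappa> - (\<xi> (0, 1) * \<eta> v / \<kappa>) / exp l"
  proof -
    have "(\<gamma> - \<omega> * \<alpha>) * \<xi> v / \<kappa> = \<gamma> * \<xi> v / \<kappa> - \<alpha> * (\<omega> * \<xi> v) / \<kappa>"
      "(\<delta> - \<omega> * \<beta>) * \<xi> v / \<kappa> = \<delta> * \<xi> v / \<kappa> - \<beta> * (\<omega> * \<xi> v) / \<kappa>"
      by (simp_all add: left_diff_distrib diff_divide_distrib mult.assoc mult.left_commute)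
    then show "(\<gamma> - \<omega> * \<alpha>) * \<xi> v / \<kappa> = \<xi> v * \<eta> (1, 0) / \<kappa> - (\<xi> (1, 0) * \<eta> v / \<kappa>) / exp l"
      "(\<delta> - \<omega> * \<beta>) * \<xi> v / \<kappa> = \<xi> v * \<eta> (0, 1) / \<kappa> - (\<xi> (0, 1) * \<eta> v / \<kappa>) / exp l"
      unfolding wx by (simp_all add: \<xi>_def[of "(1, 0)"] \<xi>_def[of "(0, 1)"]
          \<eta>_def[of "(1, 0)"] \<eta>_def[of "(0, 1)"] mult.commute)
  qed
  have "(\<gamma> - \<omega> * \<alpha>) * \<xi> v / \<kappa> \<in> \<real>" "(\<delta> - \<omega> * \<beta>) * \<xi> v / \<kappa> \<in> \<real>"
    unfolding eqs
    by (rule Reals_diff[OF bilinear_real[OF D] Reals_divide[OF bilinear_real[OF D] exp_Reals[OF l(3)]]])+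
  then obtain p q where pq: "(\<gamma> - \<omega> * \<alpha>) * \<xi> v / \<kappa> = of_real p" "(\<delta> - \<omega> * \<beta>) * \<xi> v / \<kappa> = of_real q"
    by (auto elim!: Reals_cases)
  have "\<exists>x y :: real. (x, y) \<noteq> (0, 0) \<and> p * x + q * y = 0"
  proof (cases "p = 0 \<and> q = 0")
    case True
    then show ?thesis by (intro exI[of _ 1]) auto
  next
    case False
    then show ?thesis by (intro exI[of _ q] exI[of _ "- p"]) auto
  qed
  then obtain x y :: real where xy: "(x, y) \<noteq> (0, 0)" "p * x + q * y = 0" by blast
  have "((\<gamma> - \<omega> * \<alpha>) * of_real x + (\<delta> - \<omega> * \<beta>) * of_real y) * (\<xi> v / \<kappa>) =
      (\<gamma> - \<omega> * \<alpha>) * \<xi> v / \<kappa> * of_real x + (\<delta> - \<omega> * \<beta>) * \<xi> v / \<kappa> * of_real y"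
    by (simp add: algebra_simps add_divide_distrib diff_divide_distrib)
  also have "\<dots> = of_real (p * x + q * y)" unfolding pq by simp
  finally have "(\<gamma> - \<omega> * \<alpha>) * of_real x + (\<delta> - \<omega> * \<beta>) * of_real y = 0"
    using xy(2) l(1) \<kappa>_nonzero by simp
  then have "\<gamma> * of_real x + \<delta> * of_real y = \<omega> * (\<alpha> * of_real x + \<beta> * of_real y)"
    by (simp add: algebra_simps)
  then have "form_eval r a (of_real x) (of_real y) = (0 :: complex)"
    unfolding form_eval_diag by (simp add: power_mult_distrib l(5))
  moreover have "form_eval r a (of_real x) (of_real y) = complex_of_real (form_eval r a x y)"
    by (simp add: form_eval_def)
  ultimately have "form_eval r a x y = 0" by simp
  moreover have "form_eval r a x y > 0 \<or> form_eval r a x y < 0"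
    using def xy(1) unfolding definite_form_def by blast
  ultimately show False by simp
qed

end

text \<open>With \<open>E = \<bar>\<Delta>\<bar>^\<epsilon>\<close> the given bound is at most
  \<open>(J/2)^(r/2) / (r^6 E)\<close>, which becomes the new \<open>h\<close>. The seventh power of
  \<open>r\<close> is spent on the factor \<open>r^r\<close> of the discriminant.\<close>

lemma (in diag_form) diag_form_boundI:
  fixes k :: int and \<epsilon> :: real and m :: nat
  assumes m: "m \<ge> 3" and \<epsilon>: "\<epsilon> > 0"
    "((real r)\<^sup>2 + real r + 2) / (4 * (real r - 1) * ((real r - 1) ^ (m - 1) - 2 * real r - 1)) < \<epsilon>"
    "\<epsilon> < 1 / (2 * (real r - 1))" and k: "0 < k"
    "real_of_int k \<le> cmod (form_disc r a) powr (1 / (2 * (real r - 1)) - \<epsilon>) / (2 powr (real r / 2) * real r ^ 7)"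
  obtains h E \<Psi> where "real_of_int k \<le> h" "diag_form_bound r a \<alpha> \<beta> \<gamma> \<delta> \<kappa> A B C h E \<Psi> m"
proof -
  define R where "R = real r"
  have R5: "R \<ge> 5" using r by (simp add: R_def)
  define c where "c = 1 / (2 * (R - 1))"
  define \<Delta> where "\<Delta> = cmod (form_disc r a)"
  have \<Delta>: "\<Delta> = R ^ r * J ^ (r * (r - 1))" by (simp add: \<Delta>_def norm_form_disc R_def)
  have \<Delta>0: "\<Delta> > 0" unfolding \<Delta> using R5 J_pos by simp
  have c\<epsilon>: "c - \<epsilon> > 0" using \<epsilon>(3) by (simp add: c_def R_def)
  define q where "q = 2 powr (R / 2) * R ^ 7"
  have q1: "q \<ge> 1"
  proof -
    have "1 \<le> 2 powr (R / 2)" using R5 by (intro ge_one_powr_ge_zero) auto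
    moreover have "1 \<le> R ^ 7" using R5 by (intro one_le_power) auto
    ultimately have "1 * 1 \<le> q" unfolding q_def by (intro mult_mono) auto
    then show ?thesis by simp
  qed
  have k1: "1 \<le> real_of_int k" using k(1) by simp
  have kq: "real_of_int k \<le> \<Delta> powr (c - \<epsilon>) / q" using k(2) by (simp add: \<Delta>_def c_def q_def R_def)
  have "\<Delta> \<ge> 1"
  proof (rule ccontr)
    assume "\<not> \<Delta> \<ge> 1"
    then have "\<Delta> powr (c - \<epsilon>) < 1 powr (c - \<epsilon>)" using \<Delta>0 c\<epsilon> by (intro powr_less_mono2) auto
    then have "\<Delta> powr (c - \<epsilon>) < q" using q1 by simp
    then have "\<Delta> powr (c - \<epsilon>) / q < 1" using q1 by simp
    then show False using kq k1 by linarith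
  qed
  define E where "E = \<Delta> powr \<epsilon>"
  have E1: "E \<ge> 1" unfolding E_def using \<open>\<Delta> \<ge> 1\<close> \<epsilon>(1) by (intro ge_one_powr_ge_zero) auto
  define h where "h = sqrt ((J / 2) ^ r) / (R ^ 6 * E)"
  have sq: "sqrt ((J / 2) ^ r) = J powr (R / 2) / 2 powr (R / 2)"
  proof -
    have "sqrt ((J / 2) ^ r) = ((J / 2) powr R) powr (1 / 2)"
      using J_pos by (simp add: powr_half_sqrt R_def powr_realpow)
    also have "\<dots> = (J / 2) powr (R / 2)" by (simp add: powr_powr)
    also have "\<dots> = J powr (R / 2) / 2 powr (R / 2)" using J_pos by (simp add: powr_divide)
    finally show ?thesis .
  qed
  \<comment> \<open>The power of \<open>r\<close> obtained is \<open>r / (2 (r-1))\<close>, which is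
    at most 1.\<close>
  have "\<Delta> powr c \<le> R * J powr (R / 2)"
  proof -
    have "\<Delta> powr c = (R powr R) powr c * (J powr (R * (R - 1))) powr c"
    proof -
      have "R ^ r = R powr R" using R5 by (simp add: R_def powr_realpow)
      moreover have "J ^ (r * (r - 1)) = J powr (R * (R - 1))"
        using J_pos r powr_realpow[of J "r * (r - 1)"] by (simp add: R_def of_nat_diff)
      ultimately show ?thesis unfolding \<Delta> using R5 J_pos by (simp add: powr_mult)
    qed
    also have "\<dots> = R powr (R * c) * J powr (R / 2)"
    proof -
      have "(R - 1) * c = 1 / 2" using R5 by (simp add: c_def field_simps)
      then have "R * (R - 1) * c = R / 2" by (simp only: mult.assoc)
      then show ?thesis by (simp only: powr_powr)
    qed
    also have "\<dots> \<le> R powr 1 * J powr (R / 2)"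
      using R5 by (intro mult_right_mono powr_mono) (auto simp: c_def field_simps)
    finally show ?thesis using R5 by simp
  qed
  have kh: "real_of_int k \<le> h"
  proof -
    note kq
    also have "\<Delta> powr (c - \<epsilon>) / q = \<Delta> powr c / (E * q)" by (simp add: powr_diff E_def)
    also have "\<dots> \<le> R * J powr (R / 2) / (E * q)"
      using \<open>\<Delta> powr c \<le> _\<close> E1 q1 by (intro divide_right_mono) auto
    also have "\<dots> = h"
      using R5 E1 unfolding h_def sq q_def by (simp add: divide_simps) (simp add: eval_nat_numeral)
    finally show ?thesis .
  qed
  have h1: "h \<ge> 1" using kh k1 by linarith
  have h2: "h ^ 2 * real r ^ 12 * E ^ 2 = (J / 2) ^ r"
  proof -
    have "(h * (R ^ 6 * E)) ^ 2 = (J / 2) ^ r"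
      using R5 E1 J_pos by (simp add: h_def)
    then show ?thesis by (simp add: power_mult_distrib R_def)
  qed
  have J1: "J \<ge> 1"
  proof (rule ccontr)
    assume "\<not> J \<ge> 1"
    then have "(J / 2) ^ r < 1 ^ r" using J_pos r by (intro power_strict_mono) auto
    moreover have "1 * 1 * 1 \<le> h ^ 2 * real r ^ 12 * E ^ 2"
      using h1 E1 r by (intro mult_mono one_le_power) auto
    ultimately show False using h2 by simp
  qed
  define \<Psi> where "\<Psi> = E ^ ((r - 1) ^ (m - 2))"
  \<comment> \<open>Uses \<open>r^2 + r + 2 = (r-1)(r+2) + 4\<close> and drops
    \<open>- 2 r - 1\<close> from the bracket. The bracket has to be positive before the quotient
    can be cleared; \<open>m \<ge> 3\<close> gives at least \<open>r (r-4)\<close>.\<close>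
  have \<epsilon>2: "R + 2 \<le> 4 * \<epsilon> * (R - 1) ^ (m - 1)"
  proof -
    define W where "W = (R - 1) ^ (m - 1) - 2 * R - 1"
    have "(R - 1) ^ 2 \<le> (R - 1) ^ (m - 1)" using R5 m by (intro power_increasing) auto
    moreover have "(R - 1) ^ 2 - 2 * R - 1 = R * (R - 4)" by (simp add: power2_eq_square algebra_simps)
    moreover have "R * (R - 4) > 0" using R5 by simp
    ultimately have W: "W > 0" "W \<le> (R - 1) ^ (m - 1)" using R5 unfolding W_def by linarith+
    have "R\<^sup>2 + R + 2 < \<epsilon> * (4 * (R - 1) * W)"
      using \<epsilon>(2) W(1) R5 unfolding R_def[symmetric] W_def[symmetric] by (simp add: pos_divide_less_eq)
    also have "\<dots> \<le> \<epsilon> * (4 * (R - 1) * (R - 1) ^ (m - 1))"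
      using W R5 \<epsilon>(1) by (intro mult_left_mono) auto
    finally have "(R - 1) * (R + 2) < (R - 1) * (4 * \<epsilon> * (R - 1) ^ (m - 1))"
      by (simp add: power2_eq_square algebra_simps)
    then have "R + 2 < 4 * \<epsilon> * (R - 1) ^ (m - 1)" using R5 by (subst (asm) mult_less_cancel_left_pos) auto
    then show ?thesis by simp
  qed
  have "J ^ (r * (r + 2)) \<le> \<Psi> ^ 4"
  proof -
    have "J ^ (r * (r + 2)) = J powr (R * (R + 2))"
      unfolding powr_realpow[OF J_pos, symmetric] by (simp add: R_def algebra_simps)
    also have "\<dots> \<le> J powr (R * (4 * \<epsilon> * (R - 1) ^ (m - 1)))"
      using \<epsilon>2 J1 R5 by (intro powr_mono mult_left_mono) auto
    also have "R * (4 * \<epsilon> * (R - 1) ^ (m - 1)) = (R * (R - 1)) * \<epsilon> * real ((r - 1) ^ (m - 2) * 4)"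
    proof -
      have "m - 1 = Suc (m - 2)" using m by simp
      then show ?thesis using r by (simp add: R_def of_nat_diff)
    qed
    also have "J powr \<dots> = ((J powr (R * (R - 1))) powr \<epsilon>) ^ ((r - 1) ^ (m - 2) * 4)"
      using J_pos by (subst powr_realpow[symmetric]) (simp_all add: powr_powr)
    also have "\<dots> \<le> E ^ ((r - 1) ^ (m - 2) * 4)"
    proof -
      have "J powr (R * (R - 1)) = J ^ (r * (r - 1))"
        using J_pos r powr_realpow[of J "r * (r - 1)"] by (simp add: R_def of_nat_diff)
      also have "\<dots> \<le> \<Delta>"
        unfolding \<Delta> using R5 J_pos by (simp add: mult_le_cancel_right1)
      finally show ?thesis unfolding E_def using \<epsilon>(1) J_pos by (intro power_mono powr_mono2) auto
    qed
    finally show ?thesis by (simp add: \<Psi>_def power_mult)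
  qed
  then have "diag_form_bound r a \<alpha> \<beta> \<gamma> \<delta> \<kappa> A B C h E \<Psi> m"
    by unfold_locales (use h1 h2 E1 m in \<open>simp_all add: \<Psi>_def\<close>)
  with kh show thesis by (rule that)
qed

lemma (in diag_form_bound) num_solutions_le:
  assumes "real_of_int k \<le> h"
  shows "finite (solution_classes r a k)" "num_solutions r a k \<le> 1 + card roots * (m - 1)"
proof -
  have "solution_classes r a k = class_of ` primitive_solutions r a k"
    unfolding solution_classes_def by (intro image_cong refl) (auto simp: class_of_def)
  moreover have "primitive_solutions r a k \<subseteq> solutions h"
    using assms by (auto simp: primitive_solutions_def solutions_def F_def simp del: of_int_abs simp flip: of_int_abs)
  ultimately have "solution_classes r a k \<subseteq> class_of ` solutions h" by blast
  then show "finite (solution_classes r a k)" "num_solutions r a k \<le> 1 + card roots * (m - 1)"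
    unfolding num_solutions_def using card_classes_le
    by (blast intro: finite_subset, meson card_mono order.trans)
qed

text \<open>Dividing \<open>A, B, C\<close> by their common factor divides \<open>D\<close> by a
  square, and the theorem depends only on the sign of \<open>D\<close>.\<close>

lemma quad_disc_primitive:
  assumes "r \<ge> 5" "quad_disc r a D"
  obtains \<alpha> \<beta> \<gamma> \<delta> \<kappa> A B C where "diag_form r a \<alpha> \<beta> \<gamma> \<delta> \<kappa> A B C" "sgn (diag_form.D A B C) = sgn D"
proof -
  obtain \<alpha> \<beta> \<gamma> \<delta> \<kappa> :: complex and A B C :: int where
    diag: "diagonalization r a \<alpha> \<beta> \<gamma> \<delta>" and
    q: "\<And>x y. (\<alpha> * x + \<beta> * y) * (\<gamma> * x + \<delta> * y) =
                \<kappa> * (of_int A * x\<^sup>2 + of_int B * x * y + of_int C * y\<^sup>2)" and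
    D: "D = B\<^sup>2 - 4 * A * C"
    using assms(2) unfolding quad_disc_def by blast
  have D0: "D \<noteq> 0" using quad_disc_nonzero[OF assms(2)] .
  define g where "g = gcd (gcd A C) (A + B + C)"
  have g0: "g > 0"
  proof -
    have "g \<noteq> 0" using D0 by (auto simp: g_def D)
    then show ?thesis by (simp add: g_def order_less_le)
  qed
  have gA: "g dvd A" and gC: "g dvd C" and gS: "g dvd A + B + C"
    unfolding g_def by (meson dvd_trans gcd_dvd1 gcd_dvd2)+
  have "g dvd (A + B + C) - (A + C)" 
    by (rule dvd_diff[OF gS dvd_add[OF gA gC]])
  moreover have "(A + B + C) - (A + C) = B" by simp
  ultimately have gB: "g dvd B" by (simp only:)
  obtain A' B' C' where ABC: "A = g * A'" "B = g * B'" "C = g * C'"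
    using gA gB gC by (meson dvdE)
  have "g = g * gcd (gcd A' C') (A' + B' + C')"
  proof -
    have "g = gcd (gcd (g * A') (g * C')) (g * (A' + B' + C'))"
      using g_def unfolding ABC by (simp only: distrib_left)
    then show ?thesis using g0 by (simp add: gcd_mult_distrib_int[symmetric])
  qed
  then have prim: "gcd (gcd A' C') (A' + B' + C') = 1" using g0 by simp
  have q': "(\<alpha> * x + \<beta> * y) * (\<gamma> * x + \<delta> * y) =
      (\<kappa> * of_int g) * (of_int A' * x\<^sup>2 + of_int B' * x * y + of_int C' * y\<^sup>2)" for x y
    unfolding q ABC by (simp add: algebra_simps)
  interpret diag_form r a \<alpha> \<beta> \<gamma> \<delta> "\<kappa> * of_int g" A' B' C'
    by unfold_locales (use assms(1) diag q' prim in auto)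
  have "D = g ^ 2 * diag_form.D A' B' C'"
    unfolding D ABC D_def by (simp add: power2_eq_square algebra_simps)
  then have "sgn (diag_form.D A' B' C') = sgn D" using g0 by (simp add: sgn_mult)
  with diag_form_axioms show thesis by (rule that)
qed

theorem corollary1p6:
  fixes r :: nat and a :: "nat \<Rightarrow> int" and h D :: int
  assumes "r \<ge> 5" and "diagonalizable r a" and "quad_disc r a D"
  shows
    "(\<forall>(m :: nat) (\<epsilon> :: real).
        m \<ge> 3 \<and> \<epsilon> > 0 \<and>
        ((real r)\<^sup>2 + real r + 2) /
          (4 * (real r - 1) * ((real r - 1) ^ (m - 1) - 2 * real r - 1)) < \<epsilon> \<and>
        \<epsilon> < 1 / (2 * (real r - 1)) \<and>
        0 < h \<and>
        real_of_int h \<le> cmod (form_disc r a) powr (1 / (2 * (real r - 1)) - \<epsilon>)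
                          / (2 powr (real r / 2) * real r ^ 7)
        \<longrightarrow> finite (solution_classes r a h) \<and>
            (D < 0 \<longrightarrow> num_solutions r a h \<le> r * m) \<and>
            (D > 0 \<and> even r \<and> indefinite_form r a \<longrightarrow> num_solutions r a h \<le> 2 * m) \<and>
            (D > 0 \<and> odd r \<and> indefinite_form r a \<longrightarrow> num_solutions r a h \<le> m) \<and>
            (D > 0 \<and> definite_form r a \<longrightarrow> num_solutions r a h \<le> 1)) \<and>
     (\<forall>\<epsilon> :: real.
        D < 0 \<and> 0 < \<epsilon> \<and> \<epsilon> < 1 / (2 * (real r - 1)) \<and>
        0 < h \<and>
        real_of_int h \<le> cmod (form_disc r a) powr (1 / (2 * (real r - 1)) - \<epsilon>)
                          / (2 powr (real r / 2) * real r ^ 7)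
        \<longrightarrow> finite (solution_classes r a h) \<and>
            int (num_solutions r a h)
              \<le> (4 + \<lceil>(ln (1 / \<epsilon>) - ln 4) / ln (real r - 1)\<rceil>) * int r)"
proof -
  obtain \<alpha> \<beta> \<gamma> \<delta> \<kappa> A B C where form: "diag_form r a \<alpha> \<beta> \<gamma> \<delta> \<kappa> A B C"
    and sgnD: "sgn (diag_form.D A B C) = sgn D"
    using quad_disc_primitive[OF assms(1,3)] .
  define R where "R = real r"
  have R5: "R \<ge> 5" using assms(1) by (simp add: R_def)
  have part1: "finite (solution_classes r a h) \<and>
            num_solutions r a h \<le> r * m \<and>
            (D > 0 \<longrightarrow> num_solutions r a h \<le> 2 * m) \<and>
            (D > 0 \<and> odd r \<longrightarrow> num_solutions r a h \<le> m) \<and>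
            (D > 0 \<and> definite_form r a \<longrightarrow> num_solutions r a h \<le> 1)"
    if prems: "m \<ge> 3" "\<epsilon> > 0"
      "((real r)\<^sup>2 + real r + 2) / (4 * (real r - 1) * ((real r - 1) ^ (m - 1) - 2 * real r - 1)) < \<epsilon>"
      "\<epsilon> < 1 / (2 * (real r - 1))" "0 < h"
      "real_of_int h \<le> cmod (form_disc r a) powr (1 / (2 * (real r - 1)) - \<epsilon>)
                          / (2 powr (real r / 2) * real r ^ 7)" for m \<epsilon>
  proof -
    obtain h' E \<Psi> where h': "real_of_int h \<le> h'" "diag_form_bound r a \<alpha> \<beta> \<gamma> \<delta> \<kappa> A B C h' E \<Psi> m"
      using diag_form.diag_form_boundI[OF form prems] .
    interpret d: diag_form_bound r a \<alpha> \<beta> \<gamma> \<delta> \<kappa> A B C h' E \<Psi> m by (rule h'(2))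
    note N = d.num_solutions_le[OF h'(1)]
    \<comment> \<open>The class of small solutions is charged to one of the \<open>c\<close> roots,
      each of which has at most \<open>m - 1\<close> large classes.\<close>
    have le: "num_solutions r a h \<le> c * m" if "card d.roots \<le> c" "c \<ge> 1" for c
    proof -
      note N(2)
      also have "1 + card d.roots * (m - 1) \<le> c + c * (m - 1)" using that by (intro add_mono mult_mono) auto
      also have "\<dots> = c * m" using \<open>m \<ge> 3\<close> by (cases m) auto
      finally show ?thesis .
    qed
    have pos: "d.D > 0" if "D > 0" using sgnD that by (simp add: sgn_if split: if_splits)
    show ?thesis
      using N le[of r] le[of 2] le[of 1] d.card_roots_le d.card_roots_le_2[OF pos]
        d.roots_empty_if_definite[OF pos] assms(1) by auto
  qed
  have part2: "finite (solution_classes r a h) \<and>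
      int (num_solutions r a h) \<le> (4 + \<lceil>(ln (1 / \<epsilon>) - ln 4) / ln (real r - 1)\<rceil>) * int r"
    if \<epsilon>: "0 < \<epsilon>" "\<epsilon> < 1 / (2 * (real r - 1))" and h: "0 < h"
      "real_of_int h \<le> cmod (form_disc r a) powr (1 / (2 * (real r - 1)) - \<epsilon>)
                          / (2 powr (real r / 2) * real r ^ 7)" for \<epsilon>
  proof -
    define t where "t = (ln (1 / \<epsilon>) - ln 4) / ln (R - 1)"
    have \<epsilon>R: "2 * (R - 1) * \<epsilon> < 1" using \<epsilon>(2) R5 by (simp add: R_def field_simps)
    have "8 * \<epsilon> \<le> 2 * (R - 1) * \<epsilon>" using R5 \<epsilon>(1) by (intro mult_right_mono) auto
    then have "4 * \<epsilon> < 1" using \<epsilon>R \<epsilon>(1) by linarith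
    then have "4 < 1 / \<epsilon>" using \<epsilon>(1) by (simp add: pos_less_divide_eq)
    then have "ln 4 < ln (1 / \<epsilon>)" using \<epsilon>(1) by (subst ln_less_cancel_iff) auto
    then have t0: "t > 0" using R5 by (simp add: t_def)
    \<comment> \<open>\<open>t\<close> solves \<open>(r-1)^t = 1 / (4 \<epsilon>)\<close>, so
      \<open>4 \<epsilon> (r-1)^(m-4) \<ge> 1\<close> and
      \<open>4 \<epsilon> (r-1)^(m-1) \<ge> (r-1)^3\<close>. Moreover \<open>t > 0\<close>, because
      \<epsilon> is below 1/8.\<close>
    define m where "m = nat (4 + \<lceil>t\<rceil>)"
    have m4: "int m = 4 + \<lceil>t\<rceil>" and m5: "m \<ge> 5" using t0 unfolding m_def by linarith+
    have "1 / (4 * \<epsilon>) = exp (ln (1 / \<epsilon>) - ln 4)" using \<epsilon>(1) by (simp add: exp_diff)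
    also have "\<dots> = (R - 1) powr t" using R5 by (simp add: powr_def t_def)
    also have "\<dots> \<le> (R - 1) powr real (m - 4)"
    proof (rule powr_mono)
      have "t \<le> of_int \<lceil>t\<rceil>" by (rule le_of_int_ceiling)
      also have "\<lceil>t\<rceil> = int (m - 4)" using m4 m5 by simp
      finally show "t \<le> real (m - 4)" by simp
    qed (use R5 in simp)
    also have "\<dots> = (R - 1) ^ (m - 4)" using R5 by (simp add: powr_realpow)
    finally have pw: "1 \<le> 4 * \<epsilon> * (R - 1) ^ (m - 4)" using \<epsilon>(1) by (simp add: field_simps)
    define P where "P = (R - 1) ^ (m - 1)"
    have "P = (R - 1) ^ 3 * (R - 1) ^ (m - 4)" unfolding P_def power_add[symmetric] using m5 by simp
    then have eP: "(R - 1) ^ 3 \<le> 4 * \<epsilon> * P"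
      using mult_left_mono[OF pw, of "(R - 1) ^ 3"] R5 by (simp add: mult_ac)
    have "(R - 1) ^ 2 \<le> P" unfolding P_def using R5 m5 by (intro power_increasing) auto
    moreover have "(R - 1) ^ 2 - 2 * R - 1 = R * (R - 4)" by (simp add: power2_eq_square algebra_simps)
    moreover have "R * (R - 4) > 0" using R5 by simp
    ultimately have W: "P - 2 * R - 1 > 0" by linarith
    \<comment> \<open>The part with \<open>P\<close> is at least \<open>(r-1)^4\<close>, while the
      subtracted part is at most \<open>2 (2 r + 1)\<close> since
      \<open>2 (r-1) \<epsilon> < 1\<close>; for \<open>r \<ge> 5\<close> the fourth power
      dominates.\<close>
    have "R\<^sup>2 + R + 2 < \<epsilon> * (4 * (R - 1) * (P - 2 * R - 1))"
    proof -
      have "4 * (R - 1) * \<epsilon> * (2 * R + 1) \<le> 2 * (2 * R + 1)"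
      proof (rule mult_right_mono)
        show "4 * (R - 1) * \<epsilon> \<le> 2" using \<epsilon>R by linarith
      qed (use R5 in simp)
      moreover have "(R - 1) * (R - 1) ^ 3 \<le> (R - 1) * (4 * \<epsilon> * P)"
        using eP R5 by (intro mult_left_mono) auto
      moreover have "R\<^sup>2 + R + 2 + 2 * (2 * R + 1) < (R - 1) * (R - 1) ^ 3"
      proof -
        have "4 ^ 2 * (R - 1) ^ 2 \<le> (R - 1) ^ 2 * (R - 1) ^ 2"
          using R5 by (intro mult_right_mono power_mono) auto
        moreover have "R\<^sup>2 + R + 2 + 2 * (2 * R + 1) < 4 ^ 2 * (R - 1) ^ 2"
        proof -
          have "0 \<le> (R - 5) * (15 * R + 38)" using R5 by simp
          then show ?thesis by (simp add: power2_eq_square algebra_simps)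
        qed
        ultimately show ?thesis by (simp add: power2_eq_square power3_eq_cube mult.assoc)
      qed
      ultimately show ?thesis by (simp add: algebra_simps)
    qed
    then have "(R\<^sup>2 + R + 2) / (4 * (R - 1) * (P - 2 * R - 1)) < \<epsilon>"
      using W R5 by (simp add: pos_divide_less_eq)
    then have *: "finite (solution_classes r a h)" "num_solutions r a h \<le> r * m"
      using part1[of m \<epsilon>] m5 \<epsilon> h unfolding P_def R_def by auto
    have "int (num_solutions r a h) \<le> int (r * m)" using *(2) by (simp only: of_nat_le_iff)
    also have "\<dots> = (4 + \<lceil>t\<rceil>) * int r" using m4 by simp
    finally show ?thesis using *(1) by (simp add: t_def R_def)
  qed
  show ?thesis using part1 part2 by blast
qed

end
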